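(* Let $\Bbbk$ be a field of characteristic zero, let $n\geqslant 2$, let $R=\Bbbk[x_1,\ldots,x_n]$ with its standard grading and with $\mathfrak{S}_n$ acting by permuting the variables, and let $\mathfrak{m}=(x_1,\ldots,x_n)$. Let $I\subseteq R$ be a homogeneous $\mathfrak{S}_n$-stable complete intersection ideal. Assume that, as a graded $\mathfrak{S}_n$-representation, $I/\mathfrak{m}I$ is a direct sum of one standard representation $S^{(n-1,1)}$ in degree $d$ and $m\geqslant 0$ trivial representations in degrees $c_1,\ldots,c_m$. Then the graded character of $R/I$ is $$\chi_{R/I}=\chi_R\left(\sum_{u=0}^{n-1}(-1)^u\chi^{(n-u,1^u)}t^{du}\right)\prod_{i=1}^m(1-t^{c_i}).$$
   Context: The group $\mathfrak{S}_n$ acts on $R$ by $\Bbbk$-algebra automorphisms permuting the variables, $\sigma\cdot x_i=x_{\sigma(i)}$. An ideal of $R$ is called a complete intersection ideal if it is generated by a regular sequence. Let $\mathcal{C}$ be the commutative ring of $\Bbbk$-valued class functions on $\mathfrak{S}_n$ under pointwise addition and multiplication; its identity is the trivial character. For a graded $\mathfrak{S}_n$-representation $V=\bigoplus_{d\geqslant 0}V_d$ over $\Bbbk$ with finite-dimensional components, the graded character of $V$ is $\chi_V=\sum_{d}\chi_{V_d}t^d\in\mathcal{C}[[t]]$, where $\chi_{V_d}$ is the character of $V_d$. For a partition $\lambda$ of $n$, $S^\lambda$ is the irreducible $\mathfrak{S}_n$-representation (Specht module) over $\Bbbk$ associated with $\lambda$, with the convention that $S^{(n)}$ is trivial, $S^{(1^n)}$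 is the sign representation, and $S^{(n-1,1)}$ is the $(n-1)$-dimensional standard representation; $\chi^\lambda$ is its (ungraded) character. The partition $(n-u,1^u)$ is the hook with first part $n-u$ followed by $u$ parts equal to $1$. $R$, $I/\mathfrak{m}I$ and $R/I$ carry the induced gradings and $\mathfrak{S}_n$-actions; the displayed equality is in $\mathcal{C}[[t]]$, and an empty product is $1$. A representation "in degree $c$" is a graded representation concentrated in degree $c$. *)

theory Defs
  imports
    Complex_Main
    "HOL-Library.Poly_Mapping"
    "HOL-Library.Function_Algebras"
    "HOL-Library.Set_Algebras"
    "HOL-Library.FuncSet"
    "HOL-Library.Cardinality"
    "HOL-Combinatorics.Permutations"
    "HOL-Combinatorics.Perm"
    "HOL-Computational_Algebra.Formal_Power_Series"
begin

unbundle permutation_syntax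

section \<open>Linear representations\<close>

text \<open>
  A representation of a group \<open>'g\<close> over \<open>'k\<close> is given by a carrier set with its operations, so that
  submodules and modules of cosets are representations as they stand.
\<close>

record ('k, 'g, 'v) rep =
  rspace :: "'v set"
  rzero :: "'v"
  radd :: "'v \<Rightarrow> 'v \<Rightarrow> 'v"
  rscale :: "'k \<Rightarrow> 'v \<Rightarrow> 'v"
  ract :: "'g \<Rightarrow> 'v \<Rightarrow> 'v"

definition rep_iso :: "('k, 'g, 'v) rep \<Rightarrow> ('k, 'g, 'w) rep \<Rightarrow> bool" where
  "rep_iso V W \<longleftrightarrow> (\<exists>\<phi>. bij_betw \<phi> (rspace V) (rspace W) \<and>
     (\<forall>x\<in>rspace V. \<forall>y\<in>rspace V. \<phi> (radd V x y) = radd W (\<phi> x) (\<phi> y)) \<and>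
     (\<forall>a. \<forall>x\<in>rspace V. \<phi> (rscale V a x) = rscale W a (\<phi> x)) \<and>
     (\<forall>g. \<forall>x\<in>rspace V. \<phi> (ract V g x) = ract W g (\<phi> x)))"

definition trivial_rep :: "('k::field, 'g, 'k) rep" where
  "trivial_rep = \<lparr>rspace = UNIV, rzero = 0, radd = (+), rscale = (*), ract = (\<lambda>g x. x)\<rparr>"

definition rep_sum :: "('k, 'g, 'v) rep \<Rightarrow> ('k, 'g, 'w) rep \<Rightarrow> ('k, 'g, 'v \<times> 'w) rep" where
  "rep_sum V W =
    \<lparr>rspace = rspace V \<times> rspace W,
     rzero = (rzero V, rzero W),
     radd = (\<lambda>x y. (radd V (fst x) (fst y), radd W (snd x) (snd y))),
     rscale = (\<lambda>a x. (rscale V a (fst x), rscale W a (snd x))),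
     ract = (\<lambda>g x. (ract V g (fst x), ract W g (snd x)))\<rparr>"

text \<open>The direct sum of a finite family; for empty \<open>J\<close> it is the zero space.\<close>

definition rep_Sum :: "'i set \<Rightarrow> ('i \<Rightarrow> ('k, 'g, 'v) rep) \<Rightarrow> ('k, 'g, 'i \<Rightarrow> 'v) rep" where
  "rep_Sum J W =
    \<lparr>rspace = (\<Pi>\<^sub>E i\<in>J. rspace (W i)),
     rzero = (\<lambda>i\<in>J. rzero (W i)),
     radd = (\<lambda>x y. \<lambda>i\<in>J. radd (W i) (x i) (y i)),
     rscale = (\<lambda>a x. \<lambda>i\<in>J. rscale (W i) a (x i)),
     ract = (\<lambda>g x. \<lambda>i\<in>J. ract (W i) g (x i))\<rparr>"

text \<open>
  A coordinate system of \<open>V\<close> is a linear isomorphism onto \<open>'k\<^sup>N\<close>, the latter being the space of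
  sequences vanishing from index \<open>N\<close> on.  The character takes the trace of the matrix of \<open>g\<close>
  with respect to some coordinate system; it is meaningful only for finite-dimensional \<open>V\<close>.
\<close>

definition coordinates ::
    "('k::field, 'g, 'v) rep \<Rightarrow> nat \<Rightarrow> ('v \<Rightarrow> nat \<Rightarrow> 'k) \<Rightarrow> bool" where
  "coordinates V N \<kappa> \<longleftrightarrow> bij_betw \<kappa> (rspace V) {c. \<forall>i\<ge>N. c i = 0} \<and>
     (\<forall>x\<in>rspace V. \<forall>y\<in>rspace V. \<forall>i. \<kappa> (radd V x y) i = \<kappa> x i + \<kappa> y i) \<and>
     (\<forall>a. \<forall>x\<in>rspace V. \<forall>i. \<kappa> (rscale V a x) i = a * \<kappa> x i)"

definition character :: "('k::field, 'g, 'v) rep \<Rightarrow> 'g \<Rightarrow> 'k" where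
  "character V g =
    (let (N, \<kappa>) = (SOME (N, \<kappa>). coordinates V N \<kappa>)
     in \<Sum>i<N. \<kappa> (ract V g (inv_into (rspace V) \<kappa> (\<lambda>j. if j = i then 1 else 0))) i)"


section \<open>Graded representations\<close>

type_synonym ('k, 'g, 'v) graded_rep = "nat \<Rightarrow> ('k, 'g, 'v) rep"

definition graded_iso ::
    "('k, 'g, 'v) graded_rep \<Rightarrow> ('k, 'g, 'w) graded_rep \<Rightarrow> bool" where
  "graded_iso V W \<longleftrightarrow> (\<forall>e. rep_iso (V e) (W e))"

definition in_degree :: "nat \<Rightarrow> ('k, 'g, 'v) rep \<Rightarrow> ('k, 'g, 'v) graded_rep" where
  "in_degree c V = (\<lambda>e. if e = c then V else V\<lparr>rspace := {rzero V}\<rparr>)"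

definition graded_sum ::
    "('k, 'g, 'v) graded_rep \<Rightarrow> ('k, 'g, 'w) graded_rep \<Rightarrow> ('k, 'g, 'v \<times> 'w) graded_rep" where
  "graded_sum V W = (\<lambda>e. rep_sum (V e) (W e))"

definition graded_Sum ::
    "'i set \<Rightarrow> ('i \<Rightarrow> ('k, 'g, 'v) graded_rep) \<Rightarrow> ('k, 'g, 'i \<Rightarrow> 'v) graded_rep" where
  "graded_Sum J W = (\<lambda>e. rep_Sum J (\<lambda>i. W i e))"

text \<open>
  The coefficient ring is the ring of all functions \<open>'g \<Rightarrow> 'k\<close> with pointwise operations, of which
  the class functions form a subring.
\<close>

definition graded_character :: "('k::field, 'g, 'v) graded_rep \<Rightarrow> ('g \<Rightarrow> 'k) fps" where
  "graded_character V = Abs_fps (\<lambda>e. character (V e))"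


section \<open>Scalar multiplication on finitely supported functions\<close>

definition pm_scale :: "'k::field \<Rightarrow> ('a \<Rightarrow>\<^sub>0 'k) \<Rightarrow> ('a \<Rightarrow>\<^sub>0 'k)" where
  "pm_scale a v = Poly_Mapping.map ((*) a) v"

lemma lookup_pm_scale [simp]:
  "Poly_Mapping.lookup (pm_scale a v) x = a * Poly_Mapping.lookup v x"
  by (simp add: pm_scale_def Poly_Mapping.map.rep_eq when_def)

interpretation pm: vector_space "pm_scale :: 'k::field \<Rightarrow> ('a \<Rightarrow>\<^sub>0 'k) \<Rightarrow> _"
  by unfold_locales (auto intro!: poly_mapping_eqI simp: lookup_add algebra_simps)


section \<open>Specht modules\<close>

text \<open>The rows and columns of a Young diagram are numbered from 0.\<close>

definition diagram :: "nat list \<Rightarrow> (nat \<times> nat) set" where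
  "diagram \<nu> = {(i, j). i < length \<nu> \<and> j < \<nu> ! i}"

text \<open>Tableaux of shape \<open>\<nu>\<close> have entries in \<open>'n\<close>, which takes the place of \<open>{1, \<dots>, n}\<close>.\<close>

definition tableau :: "nat list \<Rightarrow> (nat \<times> nat \<Rightarrow> 'n) \<Rightarrow> bool" where
  "tableau \<nu> t \<longleftrightarrow> bij_betw t (diagram \<nu>) UNIV"

definition row_of :: "nat list \<Rightarrow> (nat \<times> nat \<Rightarrow> 'n) \<Rightarrow> 'n \<Rightarrow> nat" where
  "row_of \<nu> t a = fst (inv_into (diagram \<nu>) t a)"

definition col_of :: "nat list \<Rightarrow> (nat \<times> nat \<Rightarrow> 'n) \<Rightarrow> 'n \<Rightarrow> nat" where
  "col_of \<nu> t a = snd (inv_into (diagram \<nu>) t a)"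

definition column_group :: "nat list \<Rightarrow> (nat \<times> nat \<Rightarrow> 'n) \<Rightarrow> 'n perm set" where
  "column_group \<nu> t = {\<pi>. \<forall>a. col_of \<nu> t (\<pi> \<langle>$\<rangle> a) = col_of \<nu> t a}"

text \<open>
  The tabloid of \<open>t\<close>, its class under row equivalence, is represented by the function \<open>row_of \<nu> t\<close>
  sending each entry to its row.  In this encoding a permutation \<open>\<sigma>\<close> takes the tabloid \<open>r\<close> to
  \<open>r \<circ> \<sigma>\<^sup>-\<^sup>1\<close>, and the permutation module is contained in \<open>('n \<Rightarrow> nat) \<Rightarrow>\<^sub>0 'k\<close>.
\<close>

definition perm_tabloid :: "'n perm \<Rightarrow> ('n \<Rightarrow> nat) \<Rightarrow> 'n \<Rightarrow> nat" where
  "perm_tabloid \<sigma> r = (\<lambda>a. r (inverse \<sigma> \<langle>$\<rangle> a))"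

definition perm_module :: "'n perm \<Rightarrow> (('n \<Rightarrow> nat) \<Rightarrow>\<^sub>0 'k::field) \<Rightarrow> (('n \<Rightarrow> nat) \<Rightarrow>\<^sub>0 'k)" where
  "perm_module \<sigma> v =
    (\<Sum>r\<in>Poly_Mapping.keys v. Poly_Mapping.single (perm_tabloid \<sigma> r) (Poly_Mapping.lookup v r))"

definition polytabloid ::
    "nat list \<Rightarrow> (nat \<times> nat \<Rightarrow> 'n::finite) \<Rightarrow> (('n \<Rightarrow> nat) \<Rightarrow>\<^sub>0 'k::field)" where
  "polytabloid \<nu> t = (\<Sum>\<pi>\<in>column_group \<nu> t.
     Poly_Mapping.single (perm_tabloid \<pi> (row_of \<nu> t)) (of_int (sign ((\<langle>$\<rangle>) \<pi>))))"

definition specht :: "nat list \<Rightarrow> ('k::field, 'n::finite perm, ('n \<Rightarrow> nat) \<Rightarrow>\<^sub>0 'k) rep" where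
  "specht \<nu> =
    \<lparr>rspace = pm.span (polytabloid \<nu> ` {t. tableau \<nu> t}),
     rzero = 0, radd = (+), rscale = pm_scale, ract = perm_module\<rparr>"

definition hook :: "nat \<Rightarrow> nat \<Rightarrow> nat list" where
  "hook n u = (n - u) # replicate u 1"


section \<open>The polynomial ring\<close>

text \<open>
  Polynomials in the variables \<open>var i\<close> for \<open>i :: 'n\<close>, as finitely supported functions from
  exponent vectors to coefficients; the multiplication of this type is convolution.
\<close>

type_synonym ('n, 'k) mpoly = "('n \<Rightarrow>\<^sub>0 nat) \<Rightarrow>\<^sub>0 'k"

definition var :: "'n \<Rightarrow> ('n, 'k::field) mpoly" where
  "var i = Poly_Mapping.single (Poly_Mapping.single i 1) 1"

definition homogeneous :: "nat \<Rightarrow> ('n::finite, 'k::field) mpoly \<Rightarrow> bool" where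
  "homogeneous e p \<longleftrightarrow>
    (\<forall>\<mu>\<in>Poly_Mapping.keys p. (\<Sum>i\<in>UNIV. Poly_Mapping.lookup \<mu> i) = e)"

text \<open>The \<open>'k\<close>-algebra automorphism with \<open>var i \<mapsto> var (\<sigma> i)\<close>.\<close>

definition perm_poly :: "'n::finite perm \<Rightarrow> ('n, 'k::field) mpoly \<Rightarrow> ('n, 'k) mpoly" where
  "perm_poly \<sigma> p = (\<Sum>\<mu>\<in>Poly_Mapping.keys p. pm_scale (Poly_Mapping.lookup p \<mu>)
     (\<Prod>i\<in>UNIV. var (\<sigma> \<langle>$\<rangle> i) ^ Poly_Mapping.lookup \<mu> i))"

text \<open>Ideals are the submodules of a commutative ring over itself.\<close>

interpretation regular_module: module "(*) :: 'a::comm_ring_1 \<Rightarrow> 'a \<Rightarrow> 'a"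
  by unfold_locales (simp_all add: algebra_simps)

abbreviation is_ideal :: "'a::comm_ring_1 set \<Rightarrow> bool" where
  "is_ideal \<equiv> regular_module.subspace"

abbreviation ideal_gen :: "'a::comm_ring_1 set \<Rightarrow> 'a set" where
  "ideal_gen \<equiv> regular_module.span"

definition ideal_prod :: "'a::comm_ring_1 set \<Rightarrow> 'a set \<Rightarrow> 'a set" where
  "ideal_prod I J = ideal_gen {a * b |a b. a \<in> I \<and> b \<in> J}"

definition regular_sequence :: "'a::comm_ring_1 list \<Rightarrow> bool" where
  "regular_sequence fs \<longleftrightarrow>
     (\<forall>i<length fs. \<forall>g. fs ! i * g \<in> ideal_gen (set (take i fs)) \<longrightarrow> g \<in> ideal_gen (set (take i fs))) \<and>
     ideal_gen (set fs) \<noteq> UNIV"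

definition complete_intersection :: "'a::comm_ring_1 set \<Rightarrow> bool" where
  "complete_intersection I \<longleftrightarrow> (\<exists>fs. regular_sequence fs \<and> I = ideal_gen (set fs))"

definition homogeneous_ideal :: "('n::finite, 'k::field) mpoly set \<Rightarrow> bool" where
  "homogeneous_ideal I \<longleftrightarrow> (\<exists>S. (\<forall>p\<in>S. \<exists>e. homogeneous e p) \<and> I = ideal_gen S)"

definition perm_stable :: "('n::finite, 'k::field) mpoly set \<Rightarrow> bool" where
  "perm_stable I \<longleftrightarrow> (\<forall>\<sigma>. \<forall>p\<in>I. perm_poly \<sigma> p \<in> I)"

definition max_ideal :: "('n, 'k::field) mpoly set" where
  "max_ideal = ideal_gen (range var)"

definition poly_ring_rep :: "('k::field, 'n::finite perm, ('n, 'k) mpoly) graded_rep" where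
  "poly_ring_rep e =
    \<lparr>rspace = {p. homogeneous e p},
     rzero = 0, radd = (+), rscale = pm_scale, ract = perm_poly\<rparr>"

text \<open>
  The graded representation \<open>A/B\<close> for homogeneous stable ideals \<open>B \<subseteq> A\<close>: its elements are the
  cosets \<open>p +o B = p + B\<close>.  The sum of cosets is their setwise sum, and \<open>\<sigma>\<close> maps \<open>p + B\<close> to
  \<open>\<sigma>p + \<sigma>B = \<sigma>p + B\<close>.  In \<open>rscale\<close> the summand \<open>B\<close> is needed for the scalar 0.
\<close>

definition quotient_rep ::
    "('n::finite, 'k::field) mpoly set \<Rightarrow> ('n, 'k) mpoly set
       \<Rightarrow> ('k, 'n perm, ('n, 'k) mpoly set) graded_rep" where
  "quotient_rep A B e =
    \<lparr>rspace = {p +o B |p. p \<in> A \<and> homogeneous e p},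
     rzero = B,
     radd = (+),
     rscale = (\<lambda>a C. pm_scale a ` C + B),
     ract = (\<lambda>\<sigma> C. perm_poly \<sigma> ` C)\<rparr>"

end

theory Submission
  imports Defs "HOL-Combinatorics.Cycles"
begin

text \<open>
  Let \<open>V = I/mI\<close>.  The theorem says that the character of \<open>R\<close> is the product of the characters of
  \<open>R/I\<close> and of the symmetric algebra of \<open>V\<close>, with the latter written as the inverse of an alternating
  sum of exterior powers.

  \<^emph>\<open>The factor \<open>Sym V\<close>.\<close>  For an ideal generated by a regular sequence, the graded ring of the
  \<open>I\<close>-adic filtration is a polynomial ring over \<open>R/I\<close>, on which the group acts as on the tensor product of
  \<open>R/I\<close> and \<open>Sym V\<close>, and traces add up over the filtration.  The argument
  below takes traces in an explicit basis.  By averaging over the group, \<open>I\<close> has minimal homogeneous generators \<open>g\<^sub>i\<close> (\<open>i\<close> in the index set of the variables) and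
  \<open>h\<^sub>1, \<dots>, h\<^sub>m\<close> such that \<open>\<sigma>\<close> takes \<open>g\<^sub>i\<close> to \<open>g\<^bsub>\<sigma> i\<^esub>\<close>, the sum of all \<open>g\<^sub>i\<close> is zero, and the \<open>h\<^sub>j\<close> are
  invariant (\<open>ex_equivariant_generators\<close>); minimality holds after one index \<open>i0\<close> is left out.  If the
  monomials \<open>x\<^sup>\<mu>\<close> with \<open>\<mu> \<in> K\<close> form a basis of \<open>R/I\<close>, then the products \<open>x\<^sup>\<mu> g\<^sup>\<alpha>\<close> form a basis of
  \<open>R\<close> (\<open>basis_index\<close>).  When \<open>\<sigma> x\<^sup>\<mu>\<close> is reduced modulo \<open>I\<close>, the remainder is in \<open>I\<close> and so contributes only
  basis elements of larger degree in \<open>g\<close>; these do not meet the diagonal, and the trace factors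
  (\<open>trace_factorization\<close>).

  \<^emph>\<open>Quasi-regularity.\<close>  Linear independence of the \<open>x\<^sup>\<mu> g\<^sup>\<alpha>\<close> rests on the fact that a form over \<open>R\<close> which
  vanishes at the generators has all its coefficients in \<open>I\<close>.  For a regular sequence this is
  \<open>regular_sequence_quasi_regular\<close>.  The given regular sequence need be neither homogeneous nor related to
  the group, so the property is carried over to the chosen generators in \<open>generators_quasi_regular\<close>,
  by comparing the matrices that express each system in terms of the other.

  \<^emph>\<open>Inverting \<open>Sym V\<close>.\<close>  An invariant generator of degree \<open>c\<close> contributes \<open>1/(1 - t\<^sup>c)\<close>.  The
  standard representation \<open>S\<close> is compared with the permutation representation \<open>P\<close> of dimension \<open>n\<close>, which
  is its sum with a trivial one.  On the symmetric side, the change of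
  variables that splits off the average of the variables shows \<open>Sym P = Sym S / (1 - t)\<close>
  (\<open>character_std_series\<close>).  On the exterior side, the Specht module of the hook with leg length \<open>u\<close> is
  \<open>\<Lambda>\<^sup>u S\<close>, realised as the alternating functions on \<open>u\<close>-tuples that are annihilated by the operator
  summing over one argument (\<open>specht_hook_space\<close>), so that the
  alternating sum of the hook characters times \<open>1 - t\<close> is the alternating sum of the exterior powers of
  \<open>P\<close> (\<open>hook_series\<close>).  For \<open>P\<close> itself the exterior and symmetric series are inverse to each other:
  a permutation with cycle lengths \<open>l\<close> has the series \<open>\<Prod>(1 - t\<^sup>l)\<close> and \<open>\<Prod>1/(1 - t\<^sup>l)\<close>
  (\<open>exterior_symmetric_series\<close>).  Together these give the inverse of the series of \<open>S\<close> generated in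
  degree 1; for generators in degree \<open>d\<close>, \<open>t\<^sup>d\<close> replaces \<open>t\<close>.
\<close>

abbreviation lookup where "lookup \<equiv> Poly_Mapping.lookup"
abbreviation keys where "keys \<equiv> Poly_Mapping.keys"
abbreviation single where "single \<equiv> Poly_Mapping.single"

text \<open>
  For the regular module this rule re-brackets products and makes simplification with \<open>mult_ac\<close> loop.
\<close>

declare regular_module.scale_scale [simp del]

section \<open>Polynomials and substitution\<close>

definition total_degree :: "('i \<Rightarrow>\<^sub>0 nat) \<Rightarrow> nat" where
  "total_degree \<mu> = (\<Sum>i\<in>keys \<mu>. lookup \<mu> i)"

definition monomial_at :: "('i \<Rightarrow> 'a::comm_ring_1) \<Rightarrow> ('i \<Rightarrow>\<^sub>0 nat) \<Rightarrow> 'a" where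
  "monomial_at x \<mu> = (\<Prod>i\<in>keys \<mu>. x i ^ lookup \<mu> i)"

definition ring_hom :: "('a::comm_ring_1 \<Rightarrow> 'b::comm_ring_1) \<Rightarrow> bool" where
  "ring_hom h \<longleftrightarrow> h 1 = 1 \<and> (\<forall>a b. h (a + b) = h a + h b) \<and> (\<forall>a b. h (a * b) = h a * h b)"

text \<open>
  Substitution of \<open>x\<close> for the indeterminates combined with a homomorphism \<open>h\<close> on the coefficients.  With
  \<open>h = id\<close> it evaluates a polynomial over \<open>R\<close> in \<open>R\<close>; with \<open>h = const\<close> it is the substitution of polynomials.
\<close>

definition subst :: "('a::comm_ring_1 \<Rightarrow> 'b::comm_ring_1) \<Rightarrow> ('i \<Rightarrow> 'b) \<Rightarrow> (('i \<Rightarrow>\<^sub>0 nat) \<Rightarrow>\<^sub>0 'a) \<Rightarrow> 'b" where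
  "subst h x P = (\<Sum>\<mu>\<in>keys P. h (lookup P \<mu>) * monomial_at x \<mu>)"

abbreviation const :: "'a::comm_ring_1 \<Rightarrow> ('i \<Rightarrow>\<^sub>0 nat) \<Rightarrow>\<^sub>0 'a" where
  "const \<equiv> single 0"

definition indet :: "'i \<Rightarrow> ('i \<Rightarrow>\<^sub>0 nat) \<Rightarrow>\<^sub>0 'a::comm_ring_1" where
  "indet i = single (single i 1) 1"

lemma keys_add_nat: "keys (\<mu> + \<nu> :: 'i \<Rightarrow>\<^sub>0 nat) = keys \<mu> \<union> keys \<nu>"
  by (auto simp: in_keys_iff lookup_add)

lemma total_degree_superset:
  "finite A \<Longrightarrow> keys \<mu> \<subseteq> A \<Longrightarrow> total_degree \<mu> = (\<Sum>i\<in>A. lookup \<mu> i)"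
  unfolding total_degree_def by (rule sum.mono_neutral_left) (auto simp: in_keys_iff)

lemma total_degree_UNIV: "total_degree \<mu> = (\<Sum>i\<in>UNIV. lookup \<mu> i)" for \<mu> :: "'i::finite \<Rightarrow>\<^sub>0 nat"
  by (rule total_degree_superset) auto

lemma total_degree_add [simp]: "total_degree (\<mu> + \<nu>) = total_degree \<mu> + total_degree \<nu>"
proof -
  let ?A = "keys \<mu> \<union> keys \<nu>"
  have "total_degree (\<mu> + \<nu>) = (\<Sum>i\<in>?A. lookup (\<mu> + \<nu>) i)"
    by (rule total_degree_superset) (auto simp: keys_add_nat)
  then show ?thesis
    by (simp add: lookup_add sum.distrib total_degree_superset[of ?A])
qed

lemma total_degree_0 [simp]: "total_degree 0 = 0"
  by (simp add: total_degree_def)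

lemma total_degree_single [simp]: "total_degree (single i k) = k"
  by (simp add: total_degree_def)

lemma total_degree_eq_0 [simp]: "total_degree \<mu> = 0 \<longleftrightarrow> \<mu> = 0"
  by (auto simp: total_degree_def in_keys_iff intro!: poly_mapping_eqI)

lemma remove_indeterminate:
  assumes "i \<in> keys \<mu>"
  obtains \<nu> :: "'i \<Rightarrow>\<^sub>0 nat" where "\<mu> = \<nu> + single i 1"
proof
  show "\<mu> = (\<mu> - single i 1) + single i 1"
    using assms by (intro poly_mapping_eqI) (auto simp: lookup_add lookup_minus lookup_single when_def in_keys_iff)
qed

lemma monomial_at_superset:
  "finite A \<Longrightarrow> keys \<mu> \<subseteq> A \<Longrightarrow> monomial_at x \<mu> = (\<Prod>i\<in>A. x i ^ lookup \<mu> i)"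
  unfolding monomial_at_def by (rule prod.mono_neutral_left) (auto simp: in_keys_iff)

lemma monomial_at_add: "monomial_at x (\<mu> + \<nu>) = monomial_at x \<mu> * monomial_at x \<nu>"
proof -
  let ?A = "keys \<mu> \<union> keys \<nu>"
  have "monomial_at x (\<mu> + \<nu>) = (\<Prod>i\<in>?A. x i ^ lookup (\<mu> + \<nu>) i)"
    by (rule monomial_at_superset) (auto simp: keys_add_nat)
  then show ?thesis
    by (simp add: lookup_add power_add prod.distrib monomial_at_superset[of ?A])
qed

lemma monomial_at_0 [simp]: "monomial_at x 0 = 1"
  by (simp add: monomial_at_def)

lemma monomial_at_single [simp]: "monomial_at x (single i k) = x i ^ k"
  by (cases "k = 0") (simp_all add: monomial_at_def)

lemma monomial_at_cong: "(\<And>i. i \<in> keys \<mu> \<Longrightarrow> x i = y i) \<Longrightarrow> monomial_at x \<mu> = monomial_at y \<mu>"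
  by (simp add: monomial_at_def)

lemma sum_monomials: "P = (\<Sum>\<mu>\<in>keys P. single \<mu> (lookup P \<mu>))"
proof (rule poly_mapping_eqI)
  fix \<nu>
  have "lookup (\<Sum>\<mu>\<in>keys P. single \<mu> (lookup P \<mu>)) \<nu> = (\<Sum>\<mu>\<in>keys P. if \<mu> = \<nu> then lookup P \<mu> else 0)"
    by (auto simp: lookup_sum lookup_single when_def intro!: sum.cong)
  also have "\<dots> = lookup P \<nu>" by (auto simp: in_keys_iff)
  finally show "lookup P \<nu> = lookup (\<Sum>\<mu>\<in>keys P. single \<mu> (lookup P \<mu>)) \<nu>" by simp
qed

lemma monomials_induct [case_names zero add monomial]:
  fixes P :: "'i \<Rightarrow>\<^sub>0 'a::comm_monoid_add"
  assumes "Q 0" "\<And>p q. Q p \<Longrightarrow> Q q \<Longrightarrow> Q (p + q)"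
    and "\<And>\<mu>. \<mu> \<in> keys P \<Longrightarrow> Q (single \<mu> (lookup P \<mu>))"
  shows "Q P"
proof -
  have "Q (\<Sum>\<mu>\<in>A. single \<mu> (lookup P \<mu>))" if "finite A" "A \<subseteq> keys P" for A
    using that by (induction A rule: finite_induct) (auto intro: assms)
  from this[of "keys P"] show ?thesis by (simp flip: sum_monomials)
qed

lemma ring_homD:
  assumes "ring_hom h"
  shows "h 1 = 1" "h (a + b) = h a + h b" "h (a * b) = h a * h b" "h 0 = 0" "h (- a) = - h a"
    "h (a - b) = h a - h b" "h (a ^ k) = h a ^ k" "h (sum f A) = (\<Sum>i\<in>A. h (f i))"
    "h (prod f A) = (\<Prod>i\<in>A. h (f i))"
proof -
  show 1: "h 1 = 1" and add: "h (a + b) = h a + h b" and mult: "h (a * b) = h a * h b" for a b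
    using assms by (auto simp: ring_hom_def)
  show z: "h 0 = 0" using add[of 0 0] by simp
  show m: "h (- a) = - h a" for a using add[of a "- a"] z by (simp add: eq_neg_iff_add_eq_0 add.commute)
  show "h (a - b) = h a - h b" using add[of a "- b"] m by simp
  show "h (a ^ k) = h a ^ k" by (induction k) (simp_all add: 1 mult)
  show "h (sum f A) = (\<Sum>i\<in>A. h (f i))" by (induction A rule: infinite_finite_induct) (simp_all add: z add)
  show "h (prod f A) = (\<Prod>i\<in>A. h (f i))" by (induction A rule: infinite_finite_induct) (simp_all add: 1 mult)
qed

lemma ring_hom_id [simp]: "ring_hom (\<lambda>x. x)" "ring_hom id"
  by (simp_all add: ring_hom_def)

lemma ring_hom_const [simp]: "ring_hom const"
  by (simp add: ring_hom_def single_add mult_single)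

lemma subst_superset:
  "ring_hom h \<Longrightarrow> finite A \<Longrightarrow> keys P \<subseteq> A \<Longrightarrow>
    subst h x P = (\<Sum>\<mu>\<in>A. h (lookup P \<mu>) * monomial_at x \<mu>)"
  unfolding subst_def by (rule sum.mono_neutral_left) (auto simp: in_keys_iff dest: ring_homD(4))

lemma subst_add:
  assumes "ring_hom h"
  shows "subst h x (P + Q) = subst h x P + subst h x Q"
proof -
  let ?A = "keys P \<union> keys Q"
  have "subst h x (P + Q) = (\<Sum>\<mu>\<in>?A. h (lookup (P + Q) \<mu>) * monomial_at x \<mu>)"
    by (rule subst_superset[OF assms]) (use Poly_Mapping.keys_add[of P Q] in auto)
  then show ?thesis
    by (simp add: lookup_add sum.distrib subst_superset[OF assms, of ?A] ring_homD[OF assms] distrib_right)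
qed

lemma subst_0 [simp]: "subst h x 0 = 0"
  by (simp add: subst_def)

lemma subst_single: "ring_hom h \<Longrightarrow> subst h x (single \<mu> c) = h c * monomial_at x \<mu>"
  by (cases "c = 0") (simp_all add: subst_def ring_homD(4)[of h])

lemma subst_mult:
  assumes h: "ring_hom h"
  shows "subst h x (P * Q) = subst h x P * subst h x Q"
proof -
  have monomials: "subst h x (single \<mu> c * single \<nu> d) = subst h x (single \<mu> c) * subst h x (single \<nu> d)"
    for \<mu> \<nu> c d
    by (simp add: mult_single subst_single[OF h] ring_homD(3)[OF h] monomial_at_add)
  have "subst h x (single \<mu> c * Q) = subst h x (single \<mu> c) * subst h x Q" for \<mu> c
    by (rule monomials_induct[of _ Q]) (simp_all add: distrib_left subst_add[OF h] monomials)
  then show ?thesis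
    by - (rule monomials_induct[of _ P], simp_all add: distrib_right subst_add[OF h])
qed

lemma ring_hom_subst [simp]: "ring_hom h \<Longrightarrow> ring_hom (subst h x)"
  using subst_single[of h x 0 1] ring_homD(1)[of h]
  by (simp add: ring_hom_def[of "subst h x"] subst_add subst_mult)

lemma ring_hom_subst_commute:
  "ring_hom \<Phi> \<Longrightarrow> \<Phi> (subst h x P) = subst (\<lambda>c. \<Phi> (h c)) (\<lambda>i. \<Phi> (x i)) P"
  by (simp add: subst_def ring_homD(3,7,8,9)[of \<Phi>] monomial_at_def)

lemma ring_hom_monomial_at: "ring_hom \<Phi> \<Longrightarrow> \<Phi> (monomial_at x \<mu>) = monomial_at (\<lambda>i. \<Phi> (x i)) \<mu>"
  by (simp add: ring_homD(7,9)[of \<Phi>] monomial_at_def)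

lemma monomial_at_indet [simp]: "monomial_at indet \<mu> = single \<mu> 1"
proof -
  have "(\<Prod>i\<in>A. indet i ^ lookup \<mu> i) = single (\<Sum>i\<in>A. single i (lookup \<mu> i)) (1::'b::comm_ring_1)"
    if "finite A" for A
    using that
  proof (induction A rule: finite_induct)
    case (insert i A)
    have "indet i ^ k = single (single i k) (1::'b)" for k
      by (induction k) (simp_all add: indet_def mult_single add.commute flip: single_add single_one)
    with insert show ?case by (simp add: mult_single)
  qed simp
  from this[of "keys \<mu>"] show ?thesis by (simp add: monomial_at_def flip: sum_monomials)
qed

lemma subst_const_indet [simp]: "subst const indet P = P"
  by (simp add: subst_def mult_single flip: sum_monomials)

lemma subst_hom_const [simp]: "ring_hom h \<Longrightarrow> subst h x (const c) = h c"
  by (simp add: subst_single)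

lemma subst_hom_indet [simp]: "ring_hom h \<Longrightarrow> subst h x (indet i) = x i"
  by (simp add: indet_def subst_single ring_homD(1)[of h])

lemma lookup_const_mult [simp]: "lookup (const c * P) \<mu> = c * lookup P \<mu>"
  by (simp flip: mult_map_scale_conv_mult) (simp add: Poly_Mapping.map.rep_eq when_def)

lemma pm_scale_const: "pm_scale c P = const c * P" for P :: "('i \<Rightarrow>\<^sub>0 nat) \<Rightarrow>\<^sub>0 'a::field"
  by (rule poly_mapping_eqI) simp

lemma lookup_monomial_mult [simp]:
  "lookup (single \<mu> c * P) (\<mu> + \<nu>) = c * lookup P \<nu>"
  for P :: "('i \<Rightarrow>\<^sub>0 nat) \<Rightarrow>\<^sub>0 'a::comm_ring_1"
proof (induction P rule: monomials_induct)
  case (monomial \<kappa>)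
  then show ?case by (simp add: mult_single lookup_single when_def)
qed (simp_all add: distrib_left lookup_add)

section \<open>Forms and homogeneous components\<close>

text \<open>
  Homogeneous polynomials of degree \<open>j\<close> in the indeterminates in \<open>S\<close>.  The coefficients may themselves be
  polynomials; their degrees do not count.
\<close>

definition forms :: "'i set \<Rightarrow> nat \<Rightarrow> (('i \<Rightarrow>\<^sub>0 nat) \<Rightarrow>\<^sub>0 'a::comm_ring_1) set" where
  "forms S j = {P. \<forall>\<mu>\<in>keys P. keys \<mu> \<subseteq> S \<and> total_degree \<mu> = j}"

lemma forms_0 [simp]: "0 \<in> forms S j"
  by (simp add: forms_def)

lemma forms_add: "P \<in> forms S j \<Longrightarrow> Q \<in> forms S j \<Longrightarrow> P + Q \<in> forms S j"
  using subsetD[OF Poly_Mapping.keys_add[of P Q]] by (auto simp: forms_def)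

lemma forms_uminus: "P \<in> forms S j \<Longrightarrow> - P \<in> forms S j"
  by (simp add: forms_def)

lemma forms_diff: "P \<in> forms S j \<Longrightarrow> Q \<in> forms S j \<Longrightarrow> P - Q \<in> forms S j"
  using forms_add[of P S j "- Q"] forms_uminus[of Q] by simp

lemma forms_sum: "(\<And>i. i \<in> A \<Longrightarrow> f i \<in> forms S j) \<Longrightarrow> (\<Sum>i\<in>A. f i) \<in> forms S j"
  by (induction A rule: infinite_finite_induct) (auto intro: forms_add)

lemma forms_single: "keys \<mu> \<subseteq> S \<Longrightarrow> total_degree \<mu> = j \<Longrightarrow> single \<mu> c \<in> forms S j"
  by (simp add: forms_def)

lemma forms_mult:
  assumes "P \<in> forms S j" "Q \<in> forms S k"
  shows "P * Q \<in> forms S (j + k)"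
  unfolding forms_def
proof safe
  fix \<mu> assume "\<mu> \<in> keys (P * Q)"
  then obtain a b where "\<mu> = a + b" "a \<in> keys P" "b \<in> keys Q" using keys_mult[of P Q] by blast
  with assms show "i \<in> S" if "i \<in> keys \<mu>" for i using that by (auto simp: forms_def keys_add_nat)
  show "total_degree \<mu> = j + k" using assms \<open>\<mu> = a + b\<close> \<open>a \<in> keys P\<close> \<open>b \<in> keys Q\<close>
    by (auto simp: forms_def)
qed

lemma forms_const [simp]: "const c \<in> forms S 0"
  by (rule forms_single) auto

lemma forms_indet: "i \<in> S \<Longrightarrow> indet i \<in> forms S 1"
  unfolding indet_def by (rule forms_single) auto

lemma forms_const_mult: "P \<in> forms S j \<Longrightarrow> const c * P \<in> forms S j"
  using forms_mult[OF forms_const, of P S j c] by simp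

lemma forms_monomial_at:
  assumes "\<And>i. i \<in> keys \<mu> \<Longrightarrow> x i \<in> forms S (w i)"
  shows "monomial_at x \<mu> \<in> forms S (\<Sum>i\<in>keys \<mu>. w i * lookup \<mu> i)"
proof -
  have pow: "y \<in> forms S k \<Longrightarrow> y ^ l \<in> forms S (k * l)" for y k l
    by (induction l) (auto dest: forms_mult simp flip: single_one)
  have "(\<Prod>i\<in>A. x i ^ lookup \<mu> i) \<in> forms S (\<Sum>i\<in>A. w i * lookup \<mu> i)" if "finite A" "A \<subseteq> keys \<mu>" for A
    using that
  proof (induction A rule: finite_induct)
    case (insert i A)
    then show ?case using assms[of i] by (auto intro!: forms_mult pow)
  qed (simp flip: single_one)
  then show ?thesis by (simp add: monomial_at_def)
qed

lemma forms_subst_linear: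
  assumes "P \<in> forms S j" "\<And>i. i \<in> S \<Longrightarrow> x i \<in> forms S' 1"
  shows "subst const x P \<in> forms S' j"
  unfolding subst_def
proof (rule forms_sum, rule forms_const_mult)
  fix \<mu> assume "\<mu> \<in> keys P"
  with assms have \<mu>: "keys \<mu> \<subseteq> S" "total_degree \<mu> = j" by (auto simp: forms_def)
  have "monomial_at x \<mu> \<in> forms S' (\<Sum>i\<in>keys \<mu>. 1 * lookup \<mu> i)"
    by (rule forms_monomial_at) (use assms \<mu> in auto)
  with \<mu> show "monomial_at x \<mu> \<in> forms S' j" by (simp add: total_degree_def)
qed

definition hcomp :: "nat \<Rightarrow> (('i \<Rightarrow>\<^sub>0 nat) \<Rightarrow>\<^sub>0 'a::comm_ring_1) \<Rightarrow> (('i \<Rightarrow>\<^sub>0 nat) \<Rightarrow>\<^sub>0 'a)" where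
  "hcomp e p = (\<Sum>\<mu>\<in>{\<mu>\<in>keys p. total_degree \<mu> = e}. single \<mu> (lookup p \<mu>))"

lemma lookup_hcomp [simp]: "lookup (hcomp e p) \<mu> = (if total_degree \<mu> = e then lookup p \<mu> else 0)"
proof -
  have "lookup (hcomp e p) \<mu> = (\<Sum>\<nu>\<in>{\<mu>\<in>keys p. total_degree \<mu> = e}. if \<nu> = \<mu> then lookup p \<nu> else 0)"
    by (auto simp: hcomp_def lookup_sum lookup_single when_def intro!: sum.cong)
  then show ?thesis by (auto simp: in_keys_iff)
qed

lemma hcomp_add: "hcomp e (p + q) = hcomp e p + hcomp e q"
  by (rule poly_mapping_eqI) (simp add: lookup_add)

lemma hcomp_0 [simp]: "hcomp e 0 = 0"
  by (rule poly_mapping_eqI) simp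

lemma hcomp_sum: "hcomp e (sum f A) = (\<Sum>i\<in>A. hcomp e (f i))"
  by (induction A rule: infinite_finite_induct) (simp_all add: hcomp_add)

lemma hcomp_diff: "hcomp e (p - q) = hcomp e p - hcomp e q"
  by (rule poly_mapping_eqI) (simp add: lookup_minus)

lemma hcomp_form: "p \<in> forms UNIV e \<Longrightarrow> hcomp e' p = (if e = e' then p else 0)"
  by (rule poly_mapping_eqI) (auto simp: forms_def in_keys_iff)

lemma forms_hcomp [simp]: "hcomp e p \<in> forms UNIV e"
  by (auto simp: forms_def in_keys_iff split: if_splits)

lemma sum_hcomp:
  assumes "\<And>\<mu>. \<mu> \<in> keys p \<Longrightarrow> total_degree \<mu> < N"
  shows "p = (\<Sum>e<N. hcomp e p)"
  by (rule poly_mapping_eqI) (use assms in \<open>auto simp: lookup_sum in_keys_iff\<close>)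

lemma ex_degree_bound: "\<exists>N. \<forall>\<mu>\<in>keys p. total_degree \<mu> < N"
proof (intro exI ballI)
  fix \<mu> assume "\<mu> \<in> keys p"
  then show "total_degree \<mu> < Suc (\<Sum>\<mu>\<in>keys p. total_degree \<mu>)"
    by (simp add: less_Suc_eq_le member_le_sum)
qed

lemma hcomp_mult_form:
  assumes "q \<in> forms UNIV d"
  shows "hcomp e (p * q) = (if d \<le> e then hcomp (e - d) p * q else 0)"
proof -
  obtain N where N: "\<forall>\<mu>\<in>keys p. total_degree \<mu> < N" using ex_degree_bound by blast
  have "hcomp e (p * q) = (\<Sum>a<N. hcomp e (hcomp a p * q))"
    by (subst sum_hcomp[of p N]) (use N in \<open>auto simp: sum_distrib_right hcomp_sum\<close>)
  also have "\<dots> = (\<Sum>a<N. if a + d = e then hcomp a p * q else 0)"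
    by (rule sum.cong) (auto simp: hcomp_form[OF forms_mult[OF forms_hcomp assms]])
  also have "\<dots> = (\<Sum>a<N. if a = e - d \<and> d \<le> e then hcomp a p * q else 0)"
    by (rule sum.cong) auto
  also have "\<dots> = (if d \<le> e then hcomp (e - d) p * q else 0)"
  proof (cases "e - d < N")
    case False
    then have "hcomp (e - d) p = 0" using N by (intro poly_mapping_eqI) (metis in_keys_iff lookup_hcomp lookup_zero)
    then show ?thesis by (auto intro!: sum.neutral)
  qed auto
  finally show ?thesis .
qed

section \<open>Ideals and coefficients\<close>

abbreviation eval :: "('i \<Rightarrow> 'a::comm_ring_1) \<Rightarrow> (('i \<Rightarrow>\<^sub>0 nat) \<Rightarrow>\<^sub>0 'a) \<Rightarrow> 'a" where
  "eval \<equiv> subst (\<lambda>c. c)"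

definition coeffs_in :: "'a::comm_ring_1 set \<Rightarrow> (('i \<Rightarrow>\<^sub>0 nat) \<Rightarrow>\<^sub>0 'a) set" where
  "coeffs_in J = {P. \<forall>\<mu>. lookup P \<mu> \<in> J}"

lemmas ideal_0 = regular_module.subspace_0
lemmas ideal_add = regular_module.subspace_add
lemmas ideal_mult = regular_module.subspace_scale
lemmas ideal_diff = regular_module.subspace_diff
lemmas ideal_sum = regular_module.subspace_sum

lemma ideal_mult_right: "is_ideal J \<Longrightarrow> a \<in> J \<Longrightarrow> a * b \<in> J"
  using ideal_mult[of J a b] by (simp add: mult.commute)

lemma ideal_uminus: "is_ideal J \<Longrightarrow> - a \<in> J \<longleftrightarrow> a \<in> J"
  using ideal_mult[of J a "-1"] ideal_mult[of J "- a" "-1"] by auto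

lemma single_in_coeffs_in: "is_ideal J \<Longrightarrow> c \<in> J \<Longrightarrow> single \<mu> c \<in> coeffs_in J"
  by (auto simp: coeffs_in_def lookup_single when_def ideal_0)

lemma ideal_coeffs_in:
  assumes J: "is_ideal J"
  shows "is_ideal (coeffs_in J :: (('i \<Rightarrow>\<^sub>0 nat) \<Rightarrow>\<^sub>0 'a::comm_ring_1) set)"
proof (rule regular_module.subspaceI)
  show zero: "0 \<in> coeffs_in J" using ideal_0[OF J] by (simp add: coeffs_in_def)
  show add: "P + Q \<in> coeffs_in J" if "P \<in> coeffs_in J" "Q \<in> coeffs_in J" for P Q :: "('i \<Rightarrow>\<^sub>0 nat) \<Rightarrow>\<^sub>0 'a"
    using that ideal_add[OF J] by (simp add: coeffs_in_def lookup_add)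
  fix P Q :: "('i \<Rightarrow>\<^sub>0 nat) \<Rightarrow>\<^sub>0 'a" assume Q: "Q \<in> coeffs_in J"
  then have coeff: "lookup Q \<nu> \<in> J" for \<nu> by (simp add: coeffs_in_def)
  have "single \<mu> c * Q \<in> coeffs_in J" for \<mu> c
    by (rule monomials_induct[of "\<lambda>Q. single \<mu> c * Q \<in> coeffs_in J" Q])
      (auto simp: zero add distrib_left mult_single coeff intro!: single_in_coeffs_in ideal_mult J)
  then show "P * Q \<in> coeffs_in J"
    by - (rule monomials_induct[of "\<lambda>P. P * Q \<in> coeffs_in J" P], auto simp: zero add distrib_right)
qed

lemma subst_in_ideal:
  assumes J: "is_ideal J" and P: "P \<in> coeffs_in I" and h: "\<And>c. c \<in> I \<Longrightarrow> h c \<in> J"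
  shows "subst h x P \<in> J"
  unfolding subst_def using P by (intro ideal_sum J ideal_mult_right h) (auto simp: coeffs_in_def)

lemma monomial_at_cong_ideal:
  assumes J: "is_ideal J" and xy: "\<And>i. i \<in> keys \<mu> \<Longrightarrow> x i - y i \<in> J"
  shows "monomial_at x \<mu> - monomial_at y \<mu> \<in> J"
proof -
  have mult: "a * b - a' * b' \<in> J" if "a - a' \<in> J" "b - b' \<in> J" for a a' b b'
  proof -
    have "a * b - a' * b' = (a - a') * b + a' * (b - b')" by (simp add: algebra_simps)
    with that show ?thesis by (simp add: ideal_add ideal_mult ideal_mult_right J)
  qed
  have pow: "a ^ k - b ^ k \<in> J" if "a - b \<in> J" for a b k
    by (induction k) (use that J in \<open>auto intro: mult ideal_0\<close>)
  have "(\<Prod>i\<in>A. x i ^ lookup \<mu> i) - (\<Prod>i\<in>A. y i ^ lookup \<mu> i) \<in> J" if "finite A" "A \<subseteq> keys \<mu>" for A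
    using that by (induction A rule: finite_induct) (use J xy in \<open>auto intro: mult pow ideal_0\<close>)
  then show ?thesis by (simp add: monomial_at_def)
qed

lemma subst_cong_ideal:
  assumes J: "is_ideal J" and P: "P \<in> forms S j" and xy: "\<And>i. i \<in> S \<Longrightarrow> x i - y i \<in> J"
  shows "subst h x P - subst h y P \<in> J"
proof -
  have "subst h x P - subst h y P = (\<Sum>\<mu>\<in>keys P. h (lookup P \<mu>) * (monomial_at x \<mu> - monomial_at y \<mu>))"
    by (simp add: subst_def sum_subtractf algebra_simps)
  also have "\<dots> \<in> J"
    using P by (intro ideal_sum J ideal_mult monomial_at_cong_ideal xy) (auto simp: forms_def)
  finally show ?thesis .
qed

lemma ideal_gen_image:
  assumes "finite S" "x \<in> ideal_gen (g ` S)"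
  shows "\<exists>q. x = (\<Sum>v\<in>S. q v * g v)"
  using assms(2)
proof (induction rule: regular_module.span_induct_alt)
  case base
  show ?case by (rule exI[of _ "\<lambda>_. 0"]) simp
next
  case (step c y z)
  then obtain q v where q: "z = (\<Sum>v\<in>S. q v * g v)" and v: "v \<in> S" "y = g v" by auto
  have "c * y + z = (\<Sum>w\<in>S. (q w + (if w = v then c else 0)) * g w)"
    using v assms(1) by (simp add: q sum.distrib distrib_right if_distrib[of "\<lambda>a. a * _"] cong: if_cong)
  then show ?case by (intro exI)
qed

section \<open>Regular sequences are quasi-regular\<close>

text \<open>
  If the point \<open>f\<close> lies in \<open>J\<close>, the surplus factors of a monomial of degree greater than \<open>j\<close> can be
  evaluated and moved into the coefficient, which then lies in \<open>J\<close>.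
\<close>

lemma lower_degree:
  assumes J: "is_ideal J" and f: "\<And>i. i \<in> S \<Longrightarrow> f i \<in> J"
    and P: "\<And>\<mu>. \<mu> \<in> keys P \<Longrightarrow> keys \<mu> \<subseteq> S \<and> j < total_degree \<mu>"
  shows "\<exists>Q. Q \<in> forms S j \<and> Q \<in> coeffs_in J \<and> eval f Q = eval f P"
proof -
  have monomial: "\<exists>Q. Q \<in> forms S j \<and> Q \<in> coeffs_in J \<and> eval f Q = c * monomial_at f \<mu>"
    if "keys \<mu> \<subseteq> S" "total_degree \<mu> = Suc (j + n)" for \<mu> c n
    using that
  proof (induction n arbitrary: \<mu> c)
    case 0
    then obtain i where i: "i \<in> keys \<mu>" by (metis add_is_0 ex_in_conv keys_eq_empty nat.simps(3) total_degree_0)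
    then obtain \<nu> where \<nu>: "\<mu> = \<nu> + single i 1" by (rule remove_indeterminate)
    have "single \<nu> (c * f i) \<in> forms S j"
      using 0 \<nu> by (intro forms_single) (auto simp: keys_add_nat)
    moreover have "single \<nu> (c * f i) \<in> coeffs_in J"
      using 0 i f by (intro single_in_coeffs_in J ideal_mult) auto
    ultimately show ?case
      by (intro exI[of _ "single \<nu> (c * f i)"]) (simp add: \<nu> monomial_at_add subst_single)
  next
    case (Suc n)
    then obtain i where i: "i \<in> keys \<mu>" by (metis ex_in_conv keys_eq_empty nat.simps(3) total_degree_0)
    then obtain \<nu> where \<nu>: "\<mu> = \<nu> + single i 1" by (rule remove_indeterminate)
    have \<nu>': "keys \<nu> \<subseteq> S" "total_degree \<nu> = Suc (j + n)"
      using Suc.prems \<nu> by (auto simp: keys_add_nat)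
    have "c * monomial_at f \<mu> = (c * f i) * monomial_at f \<nu>"
      unfolding \<nu> monomial_at_add monomial_at_single by (simp add: mult_ac)
    with Suc.IH[OF \<nu>', of "c * f i"] show ?case by (simp only:)
  qed
  show ?thesis
  proof (rule monomials_induct[of "\<lambda>P. \<exists>Q. Q \<in> forms S j \<and> Q \<in> coeffs_in J \<and> eval f Q = eval f P" P])
    show "\<exists>Q. Q \<in> forms S j \<and> Q \<in> coeffs_in J \<and> eval f Q = eval f 0"
      by (rule exI[of _ 0]) (simp add: ideal_0[OF ideal_coeffs_in[OF J]])
  next
    fix p q
    assume "\<exists>Q. Q \<in> forms S j \<and> Q \<in> coeffs_in J \<and> eval f Q = eval f p"
      "\<exists>Q. Q \<in> forms S j \<and> Q \<in> coeffs_in J \<and> eval f Q = eval f q"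
    then obtain Q Q' where "Q \<in> forms S j" "Q \<in> coeffs_in J" "eval f Q = eval f p"
      "Q' \<in> forms S j" "Q' \<in> coeffs_in J" "eval f Q' = eval f q" by blast
    then show "\<exists>Q. Q \<in> forms S j \<and> Q \<in> coeffs_in J \<and> eval f Q = eval f (p + q)"
      by (intro exI[of _ "Q + Q'"]) (simp add: subst_add forms_add ideal_add[OF ideal_coeffs_in[OF J]])
  next
    fix \<mu> assume "\<mu> \<in> keys P"
    with P obtain n where "keys \<mu> \<subseteq> S" "total_degree \<mu> = Suc (j + n)" by (metis less_imp_Suc_add)
    from monomial[OF this] show "\<exists>Q. Q \<in> forms S j \<and> Q \<in> coeffs_in J \<and>
        eval f Q = eval f (single \<mu> (lookup P \<mu>))"
      by (simp add: subst_single)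
  qed
qed

text \<open>
  Conversely, a coefficient in the ideal generated by \<open>f\<close> is a linear form in \<open>f\<close> and can be traded for
  one more degree.
\<close>

lemma raise_degree:
  assumes P: "P \<in> forms S j" "P \<in> coeffs_in (ideal_gen (f ` S))" and S: "finite S"
  shows "\<exists>Q\<in>forms S (Suc j). eval f Q = eval f P"
proof -
  let ?R = "\<lambda>P. \<exists>Q\<in>forms S (Suc j). eval f Q = eval f P"
  have add: "?R (p + q)" if "?R p" "?R q" for p q
    using that by (metis forms_add ring_hom_id(1) subst_add)
  show ?thesis
  proof (rule monomials_induct[of ?R P])
    show "?R 0" by (rule bexI[of _ 0]) auto
    fix \<mu> assume \<mu>: "\<mu> \<in> keys P"
    obtain q where q: "lookup P \<mu> = (\<Sum>v\<in>S. q v * f v)"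
      using ideal_gen_image[OF S, of "lookup P \<mu>" f] P(2) by (auto simp: coeffs_in_def)
    let ?Q = "\<Sum>v\<in>S. single (\<mu> + single v 1) (q v)"
    have "?Q \<in> forms S (Suc j)"
      using \<mu> P(1) by (intro forms_sum forms_single) (auto simp: forms_def keys_add_nat)
    moreover have "eval f ?Q = eval f (single \<mu> (lookup P \<mu>))"
      by (simp add: ring_homD(8)[OF ring_hom_subst[OF ring_hom_id(1)]] subst_single monomial_at_add q
          sum_distrib_right sum_distrib_left mult_ac)
    ultimately show "?R (single \<mu> (lookup P \<mu>))" by blast
  qed (rule add)
qed

text \<open>
  Equivalently, the graded ring of the ideal \<open>J\<close> generated by \<open>f 0, \<dots>, f (r - 1)\<close> is the polynomial ring
  in \<open>r\<close> indeterminates over the quotient by \<open>J\<close>.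
\<close>

definition quasi_regular :: "(nat \<Rightarrow> 'a::comm_ring_1) \<Rightarrow> nat \<Rightarrow> bool" where
  "quasi_regular f r \<longleftrightarrow> (\<forall>j. \<forall>P\<in>forms {..<r} j. eval f P = 0 \<longrightarrow> P \<in> coeffs_in (ideal_gen (f ` {..<r})))"

lemma quasi_regular_0: "quasi_regular f 0"
  unfolding quasi_regular_def
proof (intro allI ballI impI)
  fix j and P :: "(nat \<Rightarrow>\<^sub>0 nat) \<Rightarrow>\<^sub>0 'a"
  assume P: "P \<in> forms {..<0} j" "eval f P = 0"
  have "P = const (lookup P 0)"
    using P(1) by (intro poly_mapping_eqI) (auto simp: forms_def lookup_single when_def in_keys_iff)
  with P(2) have "P = 0" by (metis ring_hom_id(1) single_zero subst_hom_const)
  then show "P \<in> coeffs_in (ideal_gen (f ` {..<0}))" by (simp add: coeffs_in_def)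
qed

text \<open>
  An element that is regular modulo the ideal is regular modulo its powers: \<open>a\<close> lies in the \<open>j\<close>-th power
  by induction, and quasi-regularity shows that \<open>f r\<close> times its coefficients, hence by \<open>reg\<close> the
  coefficients themselves, lie in the ideal, so that the degree can be raised.
\<close>

lemma regular_mod_power:
  assumes qr: "quasi_regular f r"
    and reg: "\<And>g. f r * g \<in> ideal_gen (f ` {..<r}) \<Longrightarrow> g \<in> ideal_gen (f ` {..<r})"
    and P: "P \<in> forms {..<r} j" "f r * a = eval f P"
  shows "\<exists>Q\<in>forms {..<r} j. a = eval f Q"
  using P
proof (induction j arbitrary: P)
  case 0
  show ?case by (rule bexI[of _ "const a"]) auto
next
  case (Suc j)
  let ?J = "ideal_gen (f ` {..<r})"
  have J: "is_ideal ?J" by (rule regular_module.subspace_span)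
  obtain P' where P': "P' \<in> forms {..<r} j" "P' \<in> coeffs_in ?J" "eval f P' = eval f P"
    using lower_degree[OF J, of "{..<r}" f P j] Suc.prems(1)
    by (force simp: forms_def intro: regular_module.span_base)
  with Suc.IH[of P'] Suc.prems obtain Q where Q: "Q \<in> forms {..<r} j" "a = eval f Q" by auto
  have "const (f r) * Q - P' \<in> forms {..<r} j"
    using Q P' by (intro forms_diff forms_const_mult)
  moreover have "eval f (const (f r) * Q - P') = 0"
    using Q P' Suc.prems by (simp add: ring_homD(6)[OF ring_hom_subst[OF ring_hom_id(1)]] subst_mult)
  ultimately have "const (f r) * Q - P' \<in> coeffs_in ?J"
    using qr by (auto simp: quasi_regular_def)
  with P' have "(const (f r) * Q - P') + P' \<in> coeffs_in ?J"
    by (intro ideal_add ideal_coeffs_in J)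
  then have "Q \<in> coeffs_in ?J" using reg by (simp add: coeffs_in_def)
  then obtain T where "T \<in> forms {..<r} (Suc j)" "eval f T = eval f Q"
    using raise_degree[OF Q(1)] by blast
  with Q(2) show ?case by (intro bexI[of _ T]) auto
qed

lemma split_last_indeterminate:
  fixes P :: "(nat \<Rightarrow>\<^sub>0 nat) \<Rightarrow>\<^sub>0 'a::comm_ring_1"
  assumes "P \<in> forms {..<Suc r} (Suc j)"
  obtains G H where "G \<in> forms {..<r} (Suc j)" "H \<in> forms {..<Suc r} j" "P = G + indet r * H"
proof -
  let ?R = "\<lambda>P :: (nat \<Rightarrow>\<^sub>0 nat) \<Rightarrow>\<^sub>0 'a. \<exists>G\<in>forms {..<r} (Suc j). \<exists>H\<in>forms {..<Suc r} j. P = G + indet r * H"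
  have "?R P"
  proof (rule monomials_induct[of ?R P])
    show "?R 0" by (intro bexI[of _ 0]) auto
  next
    fix p q :: "(nat \<Rightarrow>\<^sub>0 nat) \<Rightarrow>\<^sub>0 'a" assume "?R p" "?R q"
    then obtain G H G' H' where "G \<in> forms {..<r} (Suc j)" "H \<in> forms {..<Suc r} j" "p = G + indet r * H"
      "G' \<in> forms {..<r} (Suc j)" "H' \<in> forms {..<Suc r} j" "q = G' + indet r * H'" by blast
    then show "?R (p + q)"
      by (intro bexI[of _ "G + G'"] bexI[of _ "H + H'"]) (auto simp: algebra_simps intro: forms_add)
  next
    fix \<mu> assume "\<mu> \<in> keys P"
    with assms have \<mu>: "keys \<mu> \<subseteq> {..<Suc r}" "total_degree \<mu> = Suc j" by (auto simp: forms_def)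
    show "?R (single \<mu> (lookup P \<mu>))"
    proof (cases "r \<in> keys \<mu>")
      case True
      then obtain \<nu> where \<nu>: "\<mu> = \<nu> + single r 1" by (rule remove_indeterminate)
      with \<mu> show ?thesis
        by (intro bexI[of _ 0] bexI[of _ "single \<nu> (lookup P \<mu>)"])
          (auto simp: indet_def mult_single add.commute keys_add_nat intro!: forms_single)
    next
      case False
      then have "keys \<mu> \<subseteq> {..<r}" using \<mu>(1) by (force simp: less_Suc_eq)
      with \<mu> show ?thesis
        by (intro bexI[of _ 0] bexI[of _ "single \<mu> (lookup P \<mu>)"]) (auto intro!: forms_single)
    qed
  qed
  with that show thesis by blast
qed

text \<open>
  Write the form as \<open>G + X\<^sub>r H\<close> with \<open>G\<close> free of \<open>X\<^sub>r\<close>.  As \<open>f r\<close> times the value of \<open>H\<close> is a value of a form in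
  the first \<open>r\<close> elements, so is the value of \<open>H\<close> itself, by \<open>regular_mod_power\<close>.  This
  reduces \<open>H\<close> to a form of smaller degree and \<open>G\<close> to a form in fewer indeterminates.
\<close>

lemma quasi_regular_Suc:
  assumes qr: "quasi_regular f r"
    and reg: "\<And>g. f r * g \<in> ideal_gen (f ` {..<r}) \<Longrightarrow> g \<in> ideal_gen (f ` {..<r})"
  shows "quasi_regular f (Suc r)"
  unfolding quasi_regular_def
proof (intro allI ballI impI)
  let ?J = "ideal_gen (f ` {..<r})" and ?J' = "ideal_gen (f ` {..<Suc r})"
  have J: "is_ideal ?J" and J': "is_ideal ?J'" by (rule regular_module.subspace_span)+
  have JJ': "?J \<subseteq> ?J'" by (rule regular_module.span_mono) auto
  have f: "f i \<in> ?J'" if "i < Suc r" for i using that by (intro regular_module.span_base) auto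
  note hom = ring_hom_subst[OF ring_hom_id(1), of f]
  fix j P
  assume "P \<in> forms {..<Suc r} j" "eval f P = 0"
  then show "P \<in> coeffs_in ?J'"
  proof (induction j arbitrary: P)
    case 0
    have "P = const (lookup P 0)"
      using 0(1) by (intro poly_mapping_eqI) (auto simp: forms_def lookup_single when_def in_keys_iff)
    with 0(2) have "P = 0" by (metis ring_hom_id(1) single_zero subst_hom_const)
    then show ?case by (simp add: ideal_0[OF ideal_coeffs_in[OF J']])
  next
    case (Suc j)
    obtain G H where G: "G \<in> forms {..<r} (Suc j)" and H: "H \<in> forms {..<Suc r} j"
      and P: "P = G + indet r * H"
      using split_last_indeterminate[OF Suc.prems(1)] .
    have "f r * eval f H = eval f (- G)"
      using Suc.prems(2) by (simp add: P subst_add subst_mult ring_homD(5)[OF hom] eq_neg_iff_add_eq_0 add.commute)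
    then obtain h where h: "h \<in> forms {..<r} (Suc j)" "eval f H = eval f h"
      using regular_mod_power[OF qr reg forms_uminus[OF G]] by blast
    obtain h' where h': "h' \<in> forms {..<Suc r} j" "h' \<in> coeffs_in ?J'" "eval f h' = eval f h"
      using lower_degree[OF J', of "{..<Suc r}" f h j] h(1) f by (force simp: forms_def)
    have "H - h' \<in> coeffs_in ?J'"
      using H h h' by (intro Suc.IH forms_diff) (auto simp: ring_homD(6)[OF hom])
    then have H': "H \<in> coeffs_in ?J'"
      using ideal_add[OF ideal_coeffs_in[OF J'], of "H - h'" h'] h'(2) by simp
    have "G + const (f r) * h \<in> forms {..<r} (Suc j)"
      using G h by (intro forms_add forms_const_mult)
    moreover have "eval f (G + const (f r) * h) = 0"
      using Suc.prems(2) h by (simp add: P subst_add subst_mult)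
    ultimately have "G + const (f r) * h \<in> coeffs_in ?J"
      using qr by (auto simp: quasi_regular_def)
    then have "(G + const (f r) * h) - const (f r) * h \<in> coeffs_in ?J'"
      using JJ' by (intro ideal_diff ideal_mult_right ideal_coeffs_in J' single_in_coeffs_in f)
        (auto simp: coeffs_in_def)
    then have "G \<in> coeffs_in ?J'" by simp
    with H' show ?case
      unfolding P by (intro ideal_add ideal_mult ideal_coeffs_in J')
  qed
qed

lemma regular_sequence_quasi_regular:
  assumes "regular_sequence fs"
  shows "quasi_regular (\<lambda>i. fs ! i) (length fs)"
proof -
  have set_take: "set (take r fs) = (\<lambda>i. fs ! i) ` {..<r}" if "r \<le> length fs" for r
    using nth_image[OF that] by (simp add: lessThan_atLeast0)
  have "quasi_regular (\<lambda>i. fs ! i) r" if "r \<le> length fs" for r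
    using that
  proof (induction r)
    case (Suc r)
    then have "g \<in> ideal_gen (set (take r fs))" if "fs ! r * g \<in> ideal_gen (set (take r fs))" for g
      using assms that unfolding regular_sequence_def by (meson Suc_le_eq)
    with Suc set_take[of r] show ?case by (intro quasi_regular_Suc) auto
  qed (rule quasi_regular_0)
  then show ?thesis by simp
qed

section \<open>Homogeneous generators of a complete intersection\<close>

lemma hcomp_mult: "hcomp e (p * q) = (\<Sum>a\<le>e. hcomp (e - a) p * hcomp a q)"
proof -
  obtain N where N: "\<forall>\<mu>\<in>keys q. total_degree \<mu> < N" using ex_degree_bound by blast
  let ?M = "max N (Suc e)"
  have "hcomp e (p * q) = (\<Sum>a<?M. hcomp e (p * hcomp a q))"
    by (subst sum_hcomp[of q ?M]) (use N in \<open>auto simp: sum_distrib_left hcomp_sum\<close>)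
  also have "\<dots> = (\<Sum>a<?M. if a \<le> e then hcomp (e - a) p * hcomp a q else 0)"
    by (simp add: hcomp_mult_form[OF forms_hcomp])
  also have "\<dots> = (\<Sum>a\<le>e. hcomp (e - a) p * hcomp a q)"
    by (rule sum.mono_neutral_cong_right) auto
  finally show ?thesis .
qed

lemma single_1_eq_iff: "single i (Suc 0) = single l (Suc 0) \<longleftrightarrow> i = l"
  by (metis lookup_single_eq lookup_single_not_eq zero_neq_one One_nat_def)

text \<open>
  Let \<open>f = A g\<close> and \<open>g = B f\<close>.  Quasi-regularity of \<open>f\<close> gives \<open>A B = 1\<close> modulo \<open>I\<close>, so \<open>C = 1 - B A\<close>
  is idempotent modulo \<open>I\<close>.  By the relation \<open>C g = 0\<close> and \<open>indep\<close> the entries of \<open>C\<close> have no constant term, and an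
  idempotent of this kind is zero modulo \<open>I\<close>; as \<open>I\<close> is homogeneous, this follows degree by
  degree.  So \<open>B A = 1\<close> modulo \<open>I\<close>.
  If now \<open>P(g) = 0\<close>, then \<open>P(B T)\<close> vanishes at \<open>f\<close> and has coefficients in \<open>I\<close>; substituting
  \<open>A T\<close> for \<open>T\<close> recovers \<open>P\<close> modulo \<open>I\<close>.
\<close>

lemma generators_quasi_regular:
  fixes I :: "(('n \<Rightarrow>\<^sub>0 nat) \<Rightarrow>\<^sub>0 'a::comm_ring_1) set" and g :: "'i \<Rightarrow> ('n \<Rightarrow>\<^sub>0 nat) \<Rightarrow>\<^sub>0 'a"
  assumes qr: "quasi_regular f r" and If: "I = ideal_gen (f ` {..<r})"
    and Ig: "I = ideal_gen (g ` S)" and S: "finite S"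
    and indep: "\<And>q. (\<Sum>v\<in>S. q v * g v) = 0 \<Longrightarrow> \<forall>v\<in>S. hcomp 0 (q v) = 0"
    and homog: "\<And>p e. p \<in> I \<Longrightarrow> hcomp e p \<in> I"
    and P: "P \<in> forms S j" "eval g P = 0"
  shows "P \<in> coeffs_in I"
proof -
  have I: "is_ideal I" unfolding If by (rule regular_module.subspace_span)
  have "\<exists>q. f i = (\<Sum>v\<in>S. q v * g v)" if "i < r" for i
    using that S by (intro ideal_gen_image) (auto simp flip: Ig simp: If intro: regular_module.span_base)
  then obtain A where A: "f i = (\<Sum>v\<in>S. A i v * g v)" if "i < r" for i by metis
  have "\<exists>q. g v = (\<Sum>i<r. q i * f i)" if "v \<in> S" for v
    using that by (intro ideal_gen_image) (auto simp flip: If simp: Ig intro: regular_module.span_base)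
  then obtain B where B: "g v = (\<Sum>i<r. B v i * f i)" if "v \<in> S" for v by metis
  define AB where "AB i l = (\<Sum>v\<in>S. A i v * B v l)" for i l
  \<comment> \<open>Row \<open>i\<close> of \<open>A B - 1\<close> consists of the coefficients of a linear form that vanishes at \<open>f\<close>.\<close>
  have AB: "AB i l - (if i = l then 1 else 0) \<in> I" if "i < r" "l < r" for i l
  proof -
    define L where "L = (\<Sum>k<r. const (AB i k - (if i = k then 1 else 0)) * indet k)"
    have "L \<in> forms {..<r} 1" unfolding L_def by (intro forms_sum forms_const_mult forms_indet) auto
    moreover have "eval f L = 0"
    proof -
      have "eval f L = (\<Sum>k<r. (AB i k - (if i = k then 1 else 0)) * f k)"
        by (simp add: L_def ring_homD(8)[OF ring_hom_subst[OF ring_hom_id(1)]] subst_mult)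
      also have "\<dots> = (\<Sum>k<r. AB i k * f k) - f i"
        using that by (simp add: left_diff_distrib sum_subtractf if_distrib[of "\<lambda>a. a * _"] cong: if_cong)
      also have "(\<Sum>k<r. AB i k * f k) = (\<Sum>v\<in>S. A i v * (\<Sum>k<r. B v k * f k))"
        unfolding AB_def sum_distrib_left sum_distrib_right by (subst sum.swap) (simp add: mult.assoc)
      also have "\<dots> = f i" using A[OF that(1)] B by simp
      finally show ?thesis by simp
    qed
    ultimately have "lookup L (single l 1) \<in> I"
      using qr unfolding quasi_regular_def If coeffs_in_def by blast
    also have "lookup L (single l 1) = (\<Sum>k<r. if k = l then AB i k - (if i = k then 1 else 0) else 0)"
      unfolding L_def lookup_sum
      by (rule sum.cong) (auto simp: indet_def lookup_single when_def single_1_eq_iff)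
    also have "\<dots> = AB i l - (if i = l then 1 else 0)" using that by simp
    finally show ?thesis .
  qed
  define C where "C v w = (if v = w then 1 else 0) - (\<Sum>i<r. B v i * A i w)" for v w
  have C0: "hcomp 0 (C v w) = 0" if "v \<in> S" "w \<in> S" for v w
  proof -
    have "(\<Sum>w\<in>S. C v w * g w) = g v - (\<Sum>w\<in>S. (\<Sum>i<r. B v i * A i w) * g w)"
      using that S by (simp add: C_def left_diff_distrib sum_subtractf if_distrib[of "\<lambda>a. a * _"] cong: if_cong)
    also have "(\<Sum>w\<in>S. (\<Sum>i<r. B v i * A i w) * g w) = (\<Sum>i<r. B v i * (\<Sum>w\<in>S. A i w * g w))"
      unfolding sum_distrib_left sum_distrib_right by (subst sum.swap) (simp add: mult.assoc)
    also have "\<dots> = g v" using A B[OF that(1)] by simp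
    finally show ?thesis using indep[of "C v"] that by simp
  qed
  have C_idem: "(\<Sum>u\<in>S. C v u * C u w) - C v w \<in> I" if "v \<in> S" "w \<in> S" for v w
  proof -
    define D where "D v w = (\<Sum>i<r. B v i * A i w)" for v w
    have "(\<Sum>u\<in>S. C v u * C u w) =
        (\<Sum>u\<in>S. (if v = u then C u w else 0) - (if u = w then D v u else 0) + D v u * D u w)"
      by (rule sum.cong) (auto simp: C_def D_def algebra_simps)
    also have "\<dots> = C v w - D v w + (\<Sum>u\<in>S. D v u * D u w)"
      using that S by (simp add: sum.distrib sum_subtractf)
    also have "(\<Sum>u\<in>S. D v u * D u w) = (\<Sum>u\<in>S. \<Sum>i<r. \<Sum>l<r. B v i * (A i u * B u l) * A l w)"
      by (simp add: D_def sum_product mult.assoc)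
    also have "\<dots> = (\<Sum>i<r. \<Sum>l<r. B v i * AB i l * A l w)"
      unfolding AB_def sum_distrib_left sum_distrib_right
      by (subst sum.swap, rule sum.cong[OF refl], subst sum.swap) simp
    also have "D v w = (\<Sum>i<r. \<Sum>l<r. B v i * (if i = l then 1 else 0) * A l w)"
      by (simp add: D_def if_distrib[of "\<lambda>a. a * _"] if_distrib[of "(*) _"] cong: if_cong)
    finally have "(\<Sum>u\<in>S. C v u * C u w) - C v w =
        (\<Sum>i<r. \<Sum>l<r. B v i * (AB i l - (if i = l then 1 else 0)) * A l w)"
      by (simp add: algebra_simps sum_subtractf)
    also have "\<dots> \<in> I"
      using AB by (intro ideal_sum I ideal_mult_right ideal_mult) auto
    finally show ?thesis .
  qed
  \<comment> \<open>In degree \<open>e\<close>, each term of \<open>C C\<close> has a factor of degree 0, which is zero, or a left factor of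
      degree less than \<open>e\<close>, which is in \<open>I\<close> by induction.\<close>
  have "\<forall>e<k. hcomp e (C v w) \<in> I" if "v \<in> S" "w \<in> S" for v w k
    using that
  proof (induction k arbitrary: v w)
    case (Suc k)
    show ?case
    proof (intro allI impI)
      fix e assume e: "e < Suc k"
      have "hcomp e (C v u * C u w) \<in> I" if "u \<in> S" for u
        unfolding hcomp_mult
      proof (intro ideal_sum I)
        fix a assume a: "a \<in> {..e}"
        show "hcomp (e - a) (C v u) * hcomp a (C u w) \<in> I"
        proof (cases "a = 0")
          case True
          then show ?thesis using C0[OF that Suc.prems(2)] ideal_0[OF I] by simp
        next
          case False
          then have "e - a < k" using e a by auto
          then show ?thesis using Suc.IH[OF Suc.prems(1) that] by (intro ideal_mult_right I) auto
        qed
      qed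
      then have "hcomp e (\<Sum>u\<in>S. C v u * C u w) \<in> I" unfolding hcomp_sum by (intro ideal_sum I)
      with homog[OF C_idem[OF Suc.prems], of e]
      have "hcomp e (\<Sum>u\<in>S. C v u * C u w) - hcomp e ((\<Sum>u\<in>S. C v u * C u w) - C v w) \<in> I"
        by (intro ideal_diff I)
      then show "hcomp e (C v w) \<in> I" by (simp add: hcomp_diff)
    qed
  qed simp
  then have Cs: "hcomp e (C v w) \<in> I" if "v \<in> S" "w \<in> S" for v w e
    using that by blast
  have C: "C v w \<in> I" if "v \<in> S" "w \<in> S" for v w
  proof -
    obtain N where N: "\<forall>\<mu>\<in>keys (C v w). total_degree \<mu> < N" using ex_degree_bound by blast
    show ?thesis
      by (subst sum_hcomp[of "C v w" N]) (use N Cs that in \<open>auto intro!: ideal_sum I\<close>)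
  qed
  \<comment> \<open>\<open>P\<^sub>1 = P(B T)\<close> and \<open>P\<^sub>2 = P(B A T)\<close>.\<close>
  define P1 where "P1 = subst const (\<lambda>v. \<Sum>i<r. const (B v i) * indet i) P"
  have P1: "P1 \<in> forms {..<r} j" unfolding P1_def
    by (rule forms_subst_linear[OF P(1)]) (auto intro!: forms_sum forms_const_mult forms_indet[unfolded One_nat_def])
  have "eval f P1 = subst (\<lambda>c. c) (\<lambda>v. \<Sum>i<r. B v i * f i) P"
    by (simp add: P1_def ring_hom_subst_commute ring_homD(8)[OF ring_hom_subst[OF ring_hom_id(1)]] subst_mult)
  also have "\<dots> = eval g P"
    unfolding subst_def using P(1) B
    by (intro sum.cong refl arg_cong[of _ _ "(*) _"] monomial_at_cong) (force simp: forms_def)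
  finally have "P1 \<in> coeffs_in I" using qr P1 P(2) by (simp add: If quasi_regular_def)
  define P2 where "P2 = subst const (\<lambda>i. \<Sum>w\<in>S. const (A i w) * indet w) P1"
  have "P2 \<in> coeffs_in I"
    unfolding P2_def by (rule subst_in_ideal[OF ideal_coeffs_in[OF I] \<open>P1 \<in> coeffs_in I\<close>])
      (intro single_in_coeffs_in I)
  moreover have "subst const indet P - P2 \<in> coeffs_in I"
  proof -
    have "P2 = subst const (\<lambda>v. \<Sum>i<r. const (B v i) * (\<Sum>w\<in>S. const (A i w) * indet w)) P"
      by (simp add: P2_def P1_def ring_hom_subst_commute ring_homD(8)[OF ring_hom_subst[OF ring_hom_const]] subst_mult)
    moreover have "indet v - (\<Sum>i<r. const (B v i) * (\<Sum>w\<in>S. const (A i w) * indet w)) \<in> coeffs_in I"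
      if "v \<in> S" for v
    proof -
      have "(\<Sum>w\<in>S. const (C v w) * indet w) =
          (\<Sum>w\<in>S. (if v = w then indet w else 0) - (\<Sum>i<r. const (B v i) * const (A i w)) * indet w)"
        by (rule sum.cong)
          (auto simp: C_def ring_homD(6,8)[OF ring_hom_const] mult_single left_diff_distrib)
      also have "\<dots> = indet v - (\<Sum>w\<in>S. (\<Sum>i<r. const (B v i) * const (A i w)) * indet w)"
        using that S by (simp add: sum_subtractf)
      also have "(\<Sum>w\<in>S. (\<Sum>i<r. const (B v i) * const (A i w)) * indet w) =
          (\<Sum>i<r. const (B v i) * (\<Sum>w\<in>S. const (A i w) * indet w))"
        unfolding sum_distrib_left sum_distrib_right by (subst sum.swap) (simp add: mult.assoc)
      finally have *: "indet v - (\<Sum>i<r. const (B v i) * (\<Sum>w\<in>S. const (A i w) * indet w)) =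
          (\<Sum>w\<in>S. const (C v w) * indet w)" by simp
      show ?thesis unfolding * using C that
        by (intro ideal_sum ideal_mult_right ideal_coeffs_in I single_in_coeffs_in) auto
    qed
    ultimately show ?thesis
      using subst_cong_ideal[OF ideal_coeffs_in[OF I] P(1), of indet
          "\<lambda>v. \<Sum>i<r. const (B v i) * (\<Sum>w\<in>S. const (A i w) * indet w)" const] by simp
  qed
  ultimately have "(subst const indet P - P2) + P2 \<in> coeffs_in I"
    by (intro ideal_add ideal_coeffs_in I)
  then show ?thesis by simp
qed

section \<open>Characters in arbitrary bases\<close>

text \<open>
  The notion \<open>coordinates\<close> with an arbitrary finite index set in place of an initial segment of the
  natural numbers.
\<close>

definition coords :: "('k::field, 'g, 'v) rep \<Rightarrow> 'j set \<Rightarrow> ('v \<Rightarrow> 'j \<Rightarrow> 'k) \<Rightarrow> bool" where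
  "coords V J \<kappa> \<longleftrightarrow> finite J \<and> bij_betw \<kappa> (rspace V) {c. \<forall>j. j \<notin> J \<longrightarrow> c j = 0} \<and>
     (\<forall>x\<in>rspace V. \<forall>y\<in>rspace V. \<forall>j. \<kappa> (radd V x y) j = \<kappa> x j + \<kappa> y j) \<and>
     (\<forall>a. \<forall>x\<in>rspace V. \<forall>j. \<kappa> (rscale V a x) j = a * \<kappa> x j)"

definition linear_action :: "('k::field, 'g, 'v) rep \<Rightarrow> 'g \<Rightarrow> bool" where
  "linear_action V g \<longleftrightarrow>
     (\<forall>x\<in>rspace V. \<forall>y\<in>rspace V. radd V x y \<in> rspace V \<and>
        ract V g (radd V x y) = radd V (ract V g x) (ract V g y)) \<and>
     (\<forall>a. \<forall>x\<in>rspace V. rscale V a x \<in> rspace V \<and> ract V g (rscale V a x) = rscale V a (ract V g x)) \<and>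
     (\<forall>x\<in>rspace V. ract V g x \<in> rspace V)"

abbreviation unit_fun :: "'j \<Rightarrow> 'j \<Rightarrow> 'k::zero_neq_one" where
  "unit_fun j \<equiv> (\<lambda>i. if i = j then 1 else 0)"

abbreviation coord_basis :: "('k::field, 'g, 'v) rep \<Rightarrow> ('v \<Rightarrow> 'j \<Rightarrow> 'k) \<Rightarrow> 'j \<Rightarrow> 'v" where
  "coord_basis V \<kappa> j \<equiv> inv_into (rspace V) \<kappa> (unit_fun j)"

lemma coords_inv:
  assumes "coords V J \<kappa>" "\<And>j. j \<notin> J \<Longrightarrow> c j = 0"
  shows "inv_into (rspace V) \<kappa> c \<in> rspace V" "\<kappa> (inv_into (rspace V) \<kappa> c) = c"
proof -
  have "c \<in> \<kappa> ` rspace V" using assms unfolding coords_def bij_betw_def by auto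
  then show "inv_into (rspace V) \<kappa> c \<in> rspace V" "\<kappa> (inv_into (rspace V) \<kappa> c) = c"
    by (auto intro: inv_into_into f_inv_into_f)
qed

lemma linear_functional_expansion:
  assumes V: "coords V J \<kappa>" "linear_action V g" and x: "x \<in> rspace V"
    and add: "\<And>x y. x \<in> rspace V \<Longrightarrow> y \<in> rspace V \<Longrightarrow> \<phi> (radd V x y) = \<phi> x + \<phi> y"
    and scale: "\<And>a x. x \<in> rspace V \<Longrightarrow> \<phi> (rscale V a x) = a * \<phi> x"
  shows "\<phi> x = (\<Sum>j\<in>J. \<kappa> x j * \<phi> (coord_basis V \<kappa> j))"
proof -
  let ?inv = "inv_into (rspace V) \<kappa>"
  have inj: "inj_on \<kappa> (rspace V)" using V(1) by (auto simp: coords_def bij_betw_def)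
  have \<kappa>_add: "\<kappa> (radd V x y) = (\<lambda>j. \<kappa> x j + \<kappa> y j)" if "x \<in> rspace V" "y \<in> rspace V" for x y
    using V(1) that by (auto simp: coords_def)
  have \<kappa>_scale: "\<kappa> (rscale V a x) = (\<lambda>j. a * \<kappa> x j)" if "x \<in> rspace V" for a x
    using V(1) that by (auto simp: coords_def)
  have closed: "radd V x y \<in> rspace V" "rscale V a x \<in> rspace V" if "x \<in> rspace V" "y \<in> rspace V" for a x y
    using V(2) that by (auto simp: linear_action_def)
  have "\<forall>x\<in>rspace V. (\<forall>j. j \<notin> A \<longrightarrow> \<kappa> x j = 0) \<longrightarrow> \<phi> x = (\<Sum>j\<in>A. \<kappa> x j * \<phi> (coord_basis V \<kappa> j))"
    if "finite A" "A \<subseteq> J" for A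
    using that
  proof (induction A rule: finite_induct)
    case empty
    show ?case
    proof (intro ballI impI)
      fix x assume x: "x \<in> rspace V" "\<forall>j. j \<notin> {} \<longrightarrow> \<kappa> x j = 0"
      then have "\<kappa> (rscale V 0 x) = \<kappa> x" using \<kappa>_scale[of x 0] by auto
      then have "rscale V 0 x = x"
        using x(1) closed(2) by (intro inj_onD[OF inj]) auto
      then have "\<phi> x = 0 * \<phi> x" using scale[OF x(1), of 0] by simp
      then show "\<phi> x = (\<Sum>j\<in>{}. \<kappa> x j * \<phi> (coord_basis V \<kappa> j))" by simp
    qed
  next
    case (insert i A)
    show ?case
    proof (intro ballI impI)
      fix x assume x: "x \<in> rspace V" "\<forall>j. j \<notin> insert i A \<longrightarrow> \<kappa> x j = 0"
      let ?c = "(\<kappa> x)(i := 0)"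
      have e: "coord_basis V \<kappa> i \<in> rspace V" "\<kappa> (coord_basis V \<kappa> i) = unit_fun i"
        using insert.prems by (intro coords_inv[OF V(1)]; auto)+
      have y: "?inv ?c \<in> rspace V" "\<kappa> (?inv ?c) = ?c"
        using insert.prems x(2) by (intro coords_inv[OF V(1)]; auto)+
      have "x = radd V (?inv ?c) (rscale V (\<kappa> x i) (coord_basis V \<kappa> i))"
        by (rule inj_onD[OF inj])
          (use x e y closed in \<open>auto simp: \<kappa>_add \<kappa>_scale e(2) y(2) intro!: ext\<close>)
      then have "\<phi> x = \<phi> (?inv ?c) + \<kappa> x i * \<phi> (coord_basis V \<kappa> i)"
        using add[OF y(1) closed(2)[OF e(1) e(1), of "\<kappa> x i"]] scale[OF e(1)] by simp
      also have "\<phi> (?inv ?c) = (\<Sum>j\<in>A. ?c j * \<phi> (coord_basis V \<kappa> j))"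
        using insert x(2) y by auto
      also have "\<dots> = (\<Sum>j\<in>A. \<kappa> x j * \<phi> (coord_basis V \<kappa> j))"
        using insert.hyps by (intro sum.cong) auto
      finally show "\<phi> x = (\<Sum>j\<in>insert i A. \<kappa> x j * \<phi> (coord_basis V \<kappa> j))"
        using insert.hyps by (simp add: add.commute)
    qed
  qed
  from this[of J] show ?thesis using V(1) x by (auto simp: coords_def bij_betw_def)
qed

text \<open>
  The trace does not depend on the coordinates: expanding each basis in the other turns both sums into
  the same double sum.
\<close>

lemma coords_trace_unique:
  assumes V: "linear_action V g" and c: "coords V J \<kappa>" and c': "coords V J' \<kappa>'"
  shows "(\<Sum>j\<in>J. \<kappa> (ract V g (coord_basis V \<kappa> j)) j) = (\<Sum>j\<in>J'. \<kappa>' (ract V g (coord_basis V \<kappa>' j)) j)"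
proof -
  let ?e = "coord_basis V \<kappa>" and ?e' = "coord_basis V \<kappa>'"
  have e: "?e j \<in> rspace V" "ract V g (?e j) \<in> rspace V" if "j \<in> J" for j
  proof -
    have "unit_fun j i = 0" if "i \<notin> J" for i using that \<open>j \<in> J\<close> by auto
    from coords_inv(1)[OF c this] V show "?e j \<in> rspace V" "ract V g (?e j) \<in> rspace V"
      by (auto simp: linear_action_def)
  qed
  have e': "?e' j \<in> rspace V" "ract V g (?e' j) \<in> rspace V" "\<kappa>' (?e' j) = unit_fun j" if "j \<in> J'" for j
  proof -
    have "unit_fun j i = 0" if "i \<notin> J'" for i using that \<open>j \<in> J'\<close> by auto
    from coords_inv[OF c' this] V
    show "?e' j \<in> rspace V" "ract V g (?e' j) \<in> rspace V" "\<kappa>' (?e' j) = unit_fun j"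
      by (auto simp: linear_action_def)
  qed
  have fin: "finite J" "finite J'" using c c' by (auto simp: coords_def)
  have \<kappa>: "\<kappa> y j = (\<Sum>l\<in>J'. \<kappa>' y l * \<kappa> (?e' l) j)" if "y \<in> rspace V" for y j
    using c by (intro linear_functional_expansion[OF c' V that]) (auto simp: coords_def)
  have \<kappa>': "\<kappa>' y i = (\<Sum>j\<in>J. \<kappa> y j * \<kappa>' (?e j) i)" if "y \<in> rspace V" for y i
    using c' by (intro linear_functional_expansion[OF c V that]) (auto simp: coords_def)
  have g: "\<kappa>' (ract V g y) l = (\<Sum>i\<in>J'. \<kappa>' y i * \<kappa>' (ract V g (?e' i)) l)" if "y \<in> rspace V" for y l
    using c' V by (intro linear_functional_expansion[OF c' V that]) (auto simp: coords_def linear_action_def)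
  have "(\<Sum>j\<in>J. \<kappa> (ract V g (?e j)) j) =
      (\<Sum>j\<in>J. \<Sum>l\<in>J'. (\<Sum>i\<in>J'. \<kappa>' (?e j) i * \<kappa>' (ract V g (?e' i)) l) * \<kappa> (?e' l) j)"
    by (rule sum.cong) (simp_all add: \<kappa>[OF e(2)] g[OF e(1)])
  also have "\<dots> = (\<Sum>j\<in>J. \<Sum>l\<in>J'. \<Sum>i\<in>J'. \<kappa>' (ract V g (?e' i)) l * (\<kappa> (?e' l) j * \<kappa>' (?e j) i))"
    by (simp add: sum_distrib_right sum_distrib_left mult_ac)
  also have "\<dots> = (\<Sum>l\<in>J'. \<Sum>i\<in>J'. \<Sum>j\<in>J. \<kappa>' (ract V g (?e' i)) l * (\<kappa> (?e' l) j * \<kappa>' (?e j) i))"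
    by (subst sum.swap, rule sum.cong[OF refl], rule sum.swap)
  also have "\<dots> = (\<Sum>l\<in>J'. \<Sum>i\<in>J'. \<kappa>' (ract V g (?e' i)) l * \<kappa>' (?e' l) i)"
    by (intro sum.cong refl) (simp add: \<kappa>'[OF e'(1)] sum_distrib_left)
  also have "\<dots> = (\<Sum>l\<in>J'. \<kappa>' (ract V g (?e' l)) l)"
    using fin by (intro sum.cong refl) (simp add: e'(3) if_distrib[of "(*) _"] cong: if_cong)
  finally show ?thesis .
qed

lemma ex_coordinates:
  assumes "coords V J \<kappa>"
  shows "\<exists>N \<kappa>'. coordinates V N \<kappa>'"
proof -
  obtain h where h: "bij_betw h {..<card J} J"
    using assms ex_bij_betw_nat_finite[of J] by (auto simp: coords_def lessThan_atLeast0)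
  let ?\<kappa>' = "\<lambda>x i. if i < card J then \<kappa> x (h i) else 0"
  let ?re = "\<lambda>c i. if i < card J then c (h i) else (0::'a)"
  have "bij_betw ?re {c. \<forall>j. j \<notin> J \<longrightarrow> c j = 0} {c. \<forall>i\<ge>card J. c i = 0}"
  proof (rule bij_betw_byWitness[where f' = "\<lambda>c j. if j \<in> J then c (inv_into {..<card J} h j) else 0"])
    show "\<forall>c\<in>{c. \<forall>j. j \<notin> J \<longrightarrow> c j = 0}. (\<lambda>j. if j \<in> J then ?re c (inv_into {..<card J} h j) else 0) = c"
    proof (intro ballI ext)
      fix c :: "'d \<Rightarrow> 'a" and j assume c: "c \<in> {c. \<forall>j. j \<notin> J \<longrightarrow> c j = 0}"
      have "inv_into {..<card J} h j < card J" "h (inv_into {..<card J} h j) = j" if "j \<in> J"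
        using that bij_betw_imp_surj_on[OF h] f_inv_into_f[of j h "{..<card J}"]
          inv_into_into[of j h "{..<card J}"] by auto
      then show "(if j \<in> J then ?re c (inv_into {..<card J} h j) else 0) = c j" using c by auto
    qed
    show "\<forall>c\<in>{c. \<forall>i\<ge>card J. c i = 0}. ?re (\<lambda>j. if j \<in> J then c (inv_into {..<card J} h j) else 0) = c"
      using h by (auto simp: fun_eq_iff bij_betw_inv_into_left bij_betwE)
  qed auto
  moreover have "bij_betw \<kappa> (rspace V) {c. \<forall>j. j \<notin> J \<longrightarrow> c j = 0}"
    using assms by (simp add: coords_def)
  ultimately have "bij_betw (?re \<circ> \<kappa>) (rspace V) {c. \<forall>i\<ge>card J. c i = 0}"
    by (rule bij_betw_trans[rotated])
  then have "coordinates V (card J) ?\<kappa>'"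
    using assms by (auto simp: coordinates_def coords_def o_def)
  then show ?thesis by blast
qed

text \<open>
  Every choice of coordinates computes the character, not only the one picked in its definition.
\<close>

lemma character_eq:
  assumes V: "linear_action V g" and c: "coords V J \<kappa>"
    and b: "\<And>j. j \<in> J \<Longrightarrow> b j \<in> rspace V \<and> \<kappa> (b j) = unit_fun j"
  shows "character V g = (\<Sum>j\<in>J. \<kappa> (ract V g (b j)) j)"
proof -
  obtain N \<kappa>' where some: "(SOME (N, \<kappa>). coordinates V N \<kappa>) = (N, \<kappa>')" by fastforce
  have "case (SOME (N, \<kappa>). coordinates V N \<kappa>) of (N, \<kappa>) \<Rightarrow> coordinates V N \<kappa>"
    using ex_coordinates[OF c] by (intro someI_ex[of "\<lambda>(N, \<kappa>). coordinates V N \<kappa>"]) auto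
  then have "coordinates V N \<kappa>'" by (simp only: some prod.case)
  then have "coords V {..<N} \<kappa>'" by (auto simp: coordinates_def coords_def not_less)
  from coords_trace_unique[OF V this c]
  have "character V g = (\<Sum>j\<in>J. \<kappa> (ract V g (coord_basis V \<kappa> j)) j)"
    by (simp add: character_def some)
  also have "\<dots> = (\<Sum>j\<in>J. \<kappa> (ract V g (b j)) j)"
  proof (rule sum.cong)
    fix j assume "j \<in> J"
    from b[OF this] c have "coord_basis V \<kappa> j = b j"
      by (intro inv_into_f_eq) (auto simp: coords_def bij_betw_def)
    then show "\<kappa> (ract V g (coord_basis V \<kappa> j)) j = \<kappa> (ract V g (b j)) j" by simp
  qed simp
  finally show ?thesis .
qed

lemma coordsI:
  assumes J: "finite J" and z: "z \<in> rspace V" and V: "linear_action V g"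
    and supp: "\<And>x j. x \<in> rspace V \<Longrightarrow> j \<notin> J \<Longrightarrow> \<kappa> x j = 0"
    and add: "\<And>x y j. x \<in> rspace V \<Longrightarrow> y \<in> rspace V \<Longrightarrow> \<kappa> (radd V x y) j = \<kappa> x j + \<kappa> y j"
    and scale: "\<And>a x j. x \<in> rspace V \<Longrightarrow> \<kappa> (rscale V a x) j = a * \<kappa> x j"
    and inj: "\<And>x y. x \<in> rspace V \<Longrightarrow> y \<in> rspace V \<Longrightarrow> \<forall>j\<in>J. \<kappa> x j = \<kappa> y j \<Longrightarrow> x = y"
    and b: "\<And>j. j \<in> J \<Longrightarrow> b j \<in> rspace V \<and> \<kappa> (b j) = unit_fun j"
  shows "coords V J \<kappa>"
proof -
  have closed: "radd V x y \<in> rspace V" "rscale V a x \<in> rspace V" if "x \<in> rspace V" "y \<in> rspace V" for a x y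
    using V that by (auto simp: linear_action_def)
  have "\<exists>x\<in>rspace V. \<kappa> x = c" if "finite A" "A \<subseteq> J" "\<forall>j. j \<notin> A \<longrightarrow> c j = 0" for A c
    using that
  proof (induction A arbitrary: c rule: finite_induct)
    case empty
    then show ?case using z closed(2)[OF z z, of 0] scale[OF z, of 0] by (intro bexI[of _ "rscale V 0 z"]) auto
  next
    case (insert i A)
    have "\<forall>j. j \<notin> A \<longrightarrow> (c(i := 0)) j = 0" using insert.prems by auto
    then obtain x where x: "x \<in> rspace V" "\<kappa> x = c(i := 0)"
      using insert.IH[of "c(i := 0)"] insert.prems by blast
    from insert b[of i] have bi: "b i \<in> rspace V" "\<kappa> (b i) = unit_fun i" by auto
    show ?case
      by (rule bexI[of _ "radd V x (rscale V (c i) (b i))"])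
        (use x bi closed in \<open>auto simp: add scale fun_eq_iff\<close>)
  qed
  from this[OF J] have "{c. \<forall>j. j \<notin> J \<longrightarrow> c j = 0} \<subseteq> \<kappa> ` rspace V" by blast
  moreover have "inj_on \<kappa> (rspace V)" by (rule inj_onI) (auto intro: inj)
  ultimately show ?thesis
    using J supp add scale by (auto simp: coords_def bij_betw_def)
qed

section \<open>Bases of subquotients\<close>

text \<open>The family \<open>b\<close> represents a basis of \<open>(U + N)/N\<close>.\<close>

definition basis_mod :: "('a \<Rightarrow>\<^sub>0 'k::field) set \<Rightarrow> ('a \<Rightarrow>\<^sub>0 'k) set \<Rightarrow> 'j set \<Rightarrow> ('j \<Rightarrow> 'a \<Rightarrow>\<^sub>0 'k) \<Rightarrow> bool" where
  "basis_mod N U J b \<longleftrightarrow> finite J \<and> b ` J \<subseteq> U \<and>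
     (\<forall>x\<in>U. \<exists>c. x - (\<Sum>j\<in>J. pm_scale (c j) (b j)) \<in> N) \<and>
     (\<forall>c. (\<Sum>j\<in>J. pm_scale (c j) (b j)) \<in> N \<longrightarrow> (\<forall>j\<in>J. c j = 0))"

text \<open>
  \<open>V\<close> is isomorphic to \<open>U/N\<close> by means of the projection \<open>q\<close>, and \<open>f\<close> is a lift of the action of \<open>g\<close>.  In
  this form, traces on modules of cosets are computed with representatives.
\<close>

definition presents ::
    "('k::field, 'g, 'v) rep \<Rightarrow> 'g \<Rightarrow> ('a \<Rightarrow>\<^sub>0 'k) set \<Rightarrow> ('a \<Rightarrow>\<^sub>0 'k) set \<Rightarrow>
     (('a \<Rightarrow>\<^sub>0 'k) \<Rightarrow> ('a \<Rightarrow>\<^sub>0 'k)) \<Rightarrow> (('a \<Rightarrow>\<^sub>0 'k) \<Rightarrow> 'v) \<Rightarrow> bool" where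
  "presents V g U N f q \<longleftrightarrow> pm.subspace U \<and> pm.subspace N \<and> rspace V = q ` U \<and> f ` U \<subseteq> U \<and>
     (\<forall>x y. f (x + y) = f x + f y) \<and> (\<forall>a x. f (pm_scale a x) = pm_scale a (f x)) \<and>
     (\<forall>x\<in>U. \<forall>y\<in>U. (q x = q y \<longleftrightarrow> x - y \<in> N) \<and> q (x + y) = radd V (q x) (q y)) \<and>
     (\<forall>a. \<forall>x\<in>U. q (pm_scale a x) = rscale V a (q x)) \<and> (\<forall>x\<in>U. q (f x) = ract V g (q x))"

lemma presents_linear_action:
  assumes "presents V g U N f q"
  shows "linear_action V g"
proof -
  have U: "x + y \<in> U" "pm_scale a x \<in> U" "f x \<in> U" if "x \<in> U" "y \<in> U" for x y a
    using assms that by (auto simp: presents_def pm.subspace_def)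
  have q: "radd V (q x) (q y) = q (x + y)" "rscale V a (q x) = q (pm_scale a x)" "ract V g (q x) = q (f x)"
    "f (x + y) = f x + f y" "f (pm_scale a x) = pm_scale a (f x)" if "x \<in> U" "y \<in> U" for x y a
    using assms that by (simp_all add: presents_def)
  have V: "rspace V = q ` U" using assms by (simp add: presents_def)
  show ?thesis unfolding linear_action_def V
    by (auto simp: q U)
qed

lemma basis_mod_independent:
  "basis_mod N U J b \<Longrightarrow> (\<Sum>j\<in>J. pm_scale (c j) (b j)) \<in> N \<Longrightarrow> j \<in> J \<Longrightarrow> c j = 0"
  unfolding basis_mod_def by (elim conjE) simp

text \<open>
  The entries \<open>a i j\<close> need to be known only modulo \<open>N\<close>, which makes remainders harmless.
\<close>

lemma character_basis:
  assumes V: "presents V g U N f q" and b: "basis_mod N U J b"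
    and a: "\<And>j. j \<in> J \<Longrightarrow> f (b j) - (\<Sum>i\<in>J. pm_scale (a i j) (b i)) \<in> N"
  shows "character V g = (\<Sum>j\<in>J. a j j)"
proof -
  let ?lin = "\<lambda>c. \<Sum>j\<in>J. pm_scale (c j) (b j)"
  have N: "pm.subspace N" and U: "pm.subspace U" using V by (auto simp: presents_def)
  define P where "P x c \<longleftrightarrow> (\<forall>j. j \<notin> J \<longrightarrow> c j = 0) \<and> x - ?lin c \<in> N" for x c
  have lin_add: "?lin (\<lambda>j. c j + c' j) = ?lin c + ?lin c'" for c c'
    by (simp add: pm.scale_left_distrib sum.distrib)
  have lin_diff: "?lin (\<lambda>j. c j - c' j) = ?lin c - ?lin c'" for c c'
    by (simp add: pm.scale_left_diff_distrib sum_subtractf)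
  have lin_scale: "?lin (\<lambda>j. r * c j) = pm_scale r (?lin c)" for r c
    by (simp add: pm.scale_sum_right)
  have ex: "\<exists>c. P x c" if "x \<in> U" for x
  proof -
    from b that obtain c where "x - ?lin c \<in> N" by (auto simp: basis_mod_def)
    moreover have "?lin (\<lambda>j. if j \<in> J then c j else 0) = ?lin c" by (rule sum.cong) auto
    ultimately show ?thesis by (intro exI[of _ "\<lambda>j. if j \<in> J then c j else 0"]) (auto simp: P_def)
  qed
  have unique: "c = c'" if "P x c" "P y c'" "x - y \<in> N" for x y c c'
  proof -
    have "?lin (\<lambda>j. c j - c' j) = (x - y) - (x - ?lin c) + (y - ?lin c')"
      unfolding lin_diff by simp
    also have "\<dots> \<in> N"
      using that pm.subspace_add[OF N pm.subspace_diff[OF N]] unfolding P_def by blast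
    finally have "c j = c' j" if "j \<in> J" for j
      using basis_mod_independent[OF b, of "\<lambda>j. c j - c' j" j] that by simp
    then show ?thesis using \<open>P x c\<close> \<open>P y c'\<close> unfolding P_def by (intro ext) metis
  qed
  define \<kappa> where "\<kappa> v = (SOME c. \<exists>x\<in>U. v = q x \<and> P x c)" for v
  have \<kappa>: "\<kappa> (q x) = c" if "x \<in> U" "P x c" for x c
  proof -
    have "\<exists>y\<in>U. q x = q y \<and> P y (\<kappa> (q x))"
      unfolding \<kappa>_def by (rule someI[of _ c]) (use that in blast)
    then obtain y where "y \<in> U" "q x = q y" "P y (\<kappa> (q x))" by blast
    moreover have "y - x \<in> N"
      using \<open>y \<in> U\<close> \<open>q x = q y\<close>[symmetric] that(1) V by (simp add: presents_def)
    ultimately show ?thesis using that by (intro unique[of y _ x])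
  qed
  have \<kappa>_P: "P x (\<kappa> (q x))" if "x \<in> U" for x using ex[OF that] \<kappa>[OF that] by auto
  have add: "P (x + y) (\<lambda>j. c j + c' j)" if "P x c" "P y c'" for x y c c'
  proof -
    have "x + y - ?lin (\<lambda>j. c j + c' j) = (x - ?lin c) + (y - ?lin c')"
      unfolding lin_add by simp
    also have "\<dots> \<in> N" using that by (intro pm.subspace_add[OF N]) (auto simp: P_def)
    finally show ?thesis using that by (simp add: P_def)
  qed
  have scale: "P (pm_scale r x) (\<lambda>j. r * c j)" if "P x c" for x r c
    using that pm.subspace_scale[OF N, of "x - ?lin c" r]
    by (simp add: P_def lin_scale pm.scale_right_diff_distrib)
  have J: "finite J" and bU: "b j \<in> U" if "j \<in> J" for j using b that by (auto simp: basis_mod_def)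
  have bJ: "P (b j) (unit_fun j)" if "j \<in> J" for j
  proof -
    have "?lin (unit_fun j) = (\<Sum>i\<in>J. if i = j then b i else 0)" by (rule sum.cong) auto
    with that b have "?lin (unit_fun j) = b j" by (simp add: basis_mod_def)
    with that show ?thesis using pm.subspace_0[OF N] by (auto simp: P_def)
  qed
  have \<kappa>b: "\<kappa> (q (b j)) = unit_fun j" if "j \<in> J" for j by (rule \<kappa>[OF bU bJ]) (use that in auto)
  have Vq: "rspace V = q ` U" using V by (simp add: presents_def)
  have q: "radd V (q x) (q y) = q (x + y)" "rscale V r (q x) = q (pm_scale r x)" "ract V g (q x) = q (f x)"
    "x + y \<in> U" "pm_scale r x \<in> U" "f x \<in> U" "x - y \<in> N \<Longrightarrow> q x = q y"
    if "x \<in> U" "y \<in> U" for x y r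
    using V that by (auto simp: presents_def pm.subspace_add pm.subspace_scale)
  have coords: "coords V J \<kappa>"
  proof (rule coordsI[where b = "\<lambda>j. q (b j)" and z = "q 0"])
    show "finite J" using b by (simp add: basis_mod_def)
    show "linear_action V g" by (rule presents_linear_action[OF V])
    show "q 0 \<in> rspace V" using Vq pm.subspace_0[OF U] by auto
    show "\<kappa> x j = 0" if "x \<in> rspace V" "j \<notin> J" for x j using that \<kappa>_P by (auto simp: Vq P_def)
    show "\<kappa> (radd V x y) j = \<kappa> x j + \<kappa> y j" if "x \<in> rspace V" "y \<in> rspace V" for x y j
      using that \<kappa>[OF _ add[OF \<kappa>_P \<kappa>_P]] by (auto simp: Vq q)
    show "\<kappa> (rscale V r x) j = r * \<kappa> x j" if "x \<in> rspace V" for r x j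
      using that \<kappa>[OF _ scale[OF \<kappa>_P]] by (auto simp: Vq q)
    show "q (b j) \<in> rspace V \<and> \<kappa> (q (b j)) = unit_fun j" if "j \<in> J" for j
      using that bU \<kappa>b by (auto simp: Vq)
    show "x = y" if xy: "x \<in> rspace V" "y \<in> rspace V" and eq: "\<forall>j\<in>J. \<kappa> x j = \<kappa> y j" for x y
    proof -
      obtain x' y' where x': "x = q x'" "x' \<in> U" and y': "y = q y'" "y' \<in> U" using xy by (auto simp: Vq)
      have "?lin (\<kappa> x) = ?lin (\<kappa> y)" using eq by (intro sum.cong) auto
      then have "x' - y' = (x' - ?lin (\<kappa> x)) - (y' - ?lin (\<kappa> y))" by simp
      also have "\<dots> \<in> N"
        using \<kappa>_P[of x'] \<kappa>_P[of y'] x' y' pm.subspace_diff[OF N] unfolding P_def by blast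
      finally show ?thesis using q(7) x' y' by simp
    qed
  qed
  have "character V g = (\<Sum>j\<in>J. \<kappa> (ract V g (q (b j))) j)"
    by (rule character_eq[OF presents_linear_action[OF V] coords]) (use bU \<kappa>b in \<open>auto simp: Vq\<close>)
  also have "\<dots> = (\<Sum>j\<in>J. a j j)"
  proof (rule sum.cong)
    fix j assume j: "j \<in> J"
    let ?c = "\<lambda>i. if i \<in> J then a i j else 0"
    have "?lin ?c = (\<Sum>i\<in>J. pm_scale (a i j) (b i))" by (rule sum.cong) auto
    then have "P (f (b j)) ?c" using a[OF j] by (simp add: P_def)
    then have "\<kappa> (q (f (b j))) = ?c" by (rule \<kappa>[rotated]) (use q(6)[OF bU[OF j] bU[OF j]] in simp)
    then show "\<kappa> (ract V g (q (b j))) j = a j j" using j q(3)[OF bU[OF j] bU[OF j]] by simp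
  qed simp
  finally show ?thesis .
qed

text \<open>A spanning subfamily of least cardinality is independent modulo \<open>N\<close>.\<close>

lemma ex_basis_mod:
  assumes N: "pm.subspace N" and J0: "finite J0" "b ` J0 \<subseteq> U"
    and span: "\<And>x. x \<in> U \<Longrightarrow> \<exists>c. x - (\<Sum>j\<in>J0. pm_scale (c j) (b j)) \<in> N"
  shows "\<exists>J\<subseteq>J0. basis_mod N U J b"
proof -
  let ?S = "\<lambda>J. J \<subseteq> J0 \<and> (\<forall>x\<in>U. \<exists>c. x - (\<Sum>j\<in>J. pm_scale (c j) (b j)) \<in> N)"
  have "?S J0" using span by auto
  then obtain J where J: "?S J" and min: "\<And>J'. ?S J' \<Longrightarrow> card J \<le> card J'"
    using ex_has_least_nat[of ?S J0 card] by blast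
  have fin: "finite J" using J J0 finite_subset by blast
  have "c i = 0" if c: "(\<Sum>j\<in>J. pm_scale (c j) (b j)) \<in> N" and i: "i \<in> J" for c i
  proof (rule ccontr)
    assume ci: "c i \<noteq> 0"
    have "?S (J - {i})"
    proof (intro conjI ballI)
      fix x assume "x \<in> U"
      then obtain r where r: "x - (\<Sum>j\<in>J. pm_scale (r j) (b j)) \<in> N" using J by blast
      let ?s = "\<lambda>j. r j - (r i / c i) * c j"
      have "x - (\<Sum>j\<in>J - {i}. pm_scale (?s j) (b j)) = x - (\<Sum>j\<in>J. pm_scale (?s j) (b j))"
        using ci i fin by (simp add: sum.remove[of J i])
      also have "\<dots> = (x - (\<Sum>j\<in>J. pm_scale (r j) (b j))) + pm_scale (r i / c i) (\<Sum>j\<in>J. pm_scale (c j) (b j))"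
        by (simp add: pm.scale_left_diff_distrib sum_subtractf pm.scale_sum_right)
      also have "\<dots> \<in> N" using c r by (intro pm.subspace_add pm.subspace_scale N)
      finally show "\<exists>c. x - (\<Sum>j\<in>J - {i}. pm_scale (c j) (b j)) \<in> N" by (intro exI)
    qed (use J in auto)
    from min[OF this] i fin show False by (simp add: card_Diff_singleton_if) (metis card_gt_0_iff empty_iff diff_less less_le_not_le zero_less_one One_nat_def)
  qed
  moreover have "b ` J \<subseteq> U" using J J0 by blast
  ultimately have "basis_mod N U J b" using J fin by (auto simp: basis_mod_def)
  then show ?thesis using J by blast
qed

section \<open>The action on polynomials\<close>

lemma homogeneous_forms: "homogeneous e p \<longleftrightarrow> p \<in> forms UNIV e"
  by (simp add: homogeneous_def forms_def total_degree_UNIV)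

lemma perm_poly_subst: "perm_poly \<sigma> p = subst const (\<lambda>i. indet (\<sigma> \<langle>$\<rangle> i)) p"
  by (simp add: perm_poly_def subst_def pm_scale_const var_def indet_def
      monomial_at_superset[of "UNIV :: 'a set"])

lemma ring_hom_perm_poly [simp]: "ring_hom (perm_poly \<sigma>)"
  using ring_hom_subst[OF ring_hom_const, of "\<lambda>i. indet (\<sigma> \<langle>$\<rangle> i)"]
  unfolding ring_hom_def perm_poly_subst .

lemma perm_poly_const [simp]: "perm_poly \<sigma> (const c) = const c"
  by (simp add: perm_poly_subst)

lemma perm_poly_indet [simp]: "perm_poly \<sigma> (indet i) = indet (\<sigma> \<langle>$\<rangle> i)"
  by (simp add: perm_poly_subst)

lemma perm_poly_pm_scale: "perm_poly \<sigma> (pm_scale a p) = pm_scale a (perm_poly \<sigma> p)"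
  by (simp add: pm_scale_const ring_homD(3)[OF ring_hom_perm_poly])

lemma perm_poly_times: "perm_poly (\<sigma> * \<tau>) p = perm_poly \<sigma> (perm_poly \<tau> p)"
  unfolding perm_poly_subst[of \<tau>] perm_poly_subst[of "\<sigma> * \<tau>"]
  by (subst ring_hom_subst_commute[OF ring_hom_perm_poly]) (simp add: apply_times)

lemma perm_poly_1 [simp]: "perm_poly 1 p = p"
  by (simp add: perm_poly_subst)

lemma perm_poly_inverse [simp]: "perm_poly \<sigma> (perm_poly (inverse \<sigma>) p) = p"
  "perm_poly (inverse \<sigma>) (perm_poly \<sigma> p) = p"
  by (simp_all flip: perm_poly_times)

lemma perm_poly_forms: "p \<in> forms UNIV e \<Longrightarrow> perm_poly \<sigma> p \<in> forms UNIV e"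
  unfolding perm_poly_subst by (rule forms_subst_linear) (auto intro: forms_indet[unfolded One_nat_def])

definition perm_exponent :: "'n perm \<Rightarrow> ('n \<Rightarrow>\<^sub>0 nat) \<Rightarrow> ('n \<Rightarrow>\<^sub>0 nat)" where
  "perm_exponent \<sigma> \<mu> = Poly_Mapping.map_key ((\<langle>$\<rangle>) (inverse \<sigma>)) \<mu>"

lemma inj_apply_perm: "inj ((\<langle>$\<rangle>) \<sigma>)"
  by (rule bij_is_inj) simp

lemma lookup_perm_exponent [simp]: "lookup (perm_exponent \<sigma> \<mu>) i = lookup \<mu> (inverse \<sigma> \<langle>$\<rangle> i)"
  by (simp add: perm_exponent_def map_key.rep_eq[OF inj_apply_perm])

lemma inverse_perm_apply [simp]: "inverse \<sigma> \<langle>$\<rangle> (\<sigma> \<langle>$\<rangle> i) = i" "\<sigma> \<langle>$\<rangle> (inverse \<sigma> \<langle>$\<rangle> i) = i"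
  by (simp_all flip: apply_times add: apply_sequence)

lemma monomial_at_perm:
  fixes \<mu> :: "'n::finite \<Rightarrow>\<^sub>0 nat"
  shows "monomial_at (\<lambda>i. x (\<sigma> \<langle>$\<rangle> i)) \<mu> = monomial_at x (perm_exponent \<sigma> \<mu>)"
proof -
  have "monomial_at (\<lambda>i. x (\<sigma> \<langle>$\<rangle> i)) \<mu> = (\<Prod>i\<in>UNIV. x (\<sigma> \<langle>$\<rangle> i) ^ lookup (perm_exponent \<sigma> \<mu>) (\<sigma> \<langle>$\<rangle> i))"
    by (simp add: monomial_at_superset[of UNIV])
  also have "\<dots> = (\<Prod>i\<in>UNIV. x i ^ lookup (perm_exponent \<sigma> \<mu>) i)"
    by (rule prod.reindex_bij_betw[of "(\<langle>$\<rangle>) \<sigma>" UNIV UNIV]) simp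
  also have "\<dots> = monomial_at x (perm_exponent \<sigma> \<mu>)"
    by (simp add: monomial_at_superset[of UNIV])
  finally show ?thesis .
qed

lemma perm_poly_monomial: "perm_poly \<sigma> (single \<mu> 1) = single (perm_exponent \<sigma> \<mu>) 1"
  by (simp add: perm_poly_subst subst_single monomial_at_perm[of indet])

lemma total_degree_perm_exponent [simp]:
  fixes \<mu> :: "'n::finite \<Rightarrow>\<^sub>0 nat"
  shows "total_degree (perm_exponent \<sigma> \<mu>) = total_degree \<mu>"
  unfolding total_degree_UNIV
  by (simp, rule sum.reindex_bij_betw[of "(\<langle>$\<rangle>) (inverse \<sigma>)" UNIV UNIV]) simp

lemma finite_exponents [simp]: "finite {\<mu> :: 'n::finite \<Rightarrow>\<^sub>0 nat. total_degree \<mu> = e}"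
proof (rule finite_imageD)
  have "lookup \<mu> i \<le> total_degree \<mu>" for \<mu> :: "'n \<Rightarrow>\<^sub>0 nat" and i
    unfolding total_degree_UNIV by (rule member_le_sum) auto
  then have "lookup ` {\<mu> :: 'n \<Rightarrow>\<^sub>0 nat. total_degree \<mu> = e} \<subseteq> PiE UNIV (\<lambda>_. {..e})"
    by auto
  then show "finite (lookup ` {\<mu> :: 'n \<Rightarrow>\<^sub>0 nat. total_degree \<mu> = e})"
    by (rule finite_subset) (rule finite_PiE, auto)
  show "inj_on lookup {\<mu> :: 'n \<Rightarrow>\<^sub>0 nat. total_degree \<mu> = e}"
    by (rule inj_onI, rule poly_mapping_eqI) simp
qed

lemma forms_subspace: "pm.subspace (forms S e :: (('i \<Rightarrow>\<^sub>0 nat) \<Rightarrow>\<^sub>0 'k::field) set)"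
  by (rule pm.subspaceI) (auto simp: pm_scale_const intro: forms_add forms_const_mult)

lemma ideal_subspace: "is_ideal I \<Longrightarrow> pm.subspace (I :: (('i \<Rightarrow>\<^sub>0 nat) \<Rightarrow>\<^sub>0 'k::field) set)"
  by (rule pm.subspaceI) (auto simp: pm_scale_const ideal_0 ideal_add ideal_mult)

lemma basis_mod_monomials:
  "basis_mod {0} (forms UNIV e) {\<mu> :: 'n::finite \<Rightarrow>\<^sub>0 nat. total_degree \<mu> = e} (\<lambda>\<mu>. single \<mu> (1 :: 'k::field))"
proof -
  have lin: "(\<Sum>\<mu>\<in>A. pm_scale (c \<mu>) (single \<mu> (1 :: 'k))) = (\<Sum>\<mu>\<in>A. single \<mu> (c \<mu>))" for A and c :: "('n \<Rightarrow>\<^sub>0 nat) \<Rightarrow> 'k"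
    by (simp add: pm_scale_const mult_single)
  have lookup: "lookup (\<Sum>\<mu> | total_degree \<mu> = e. single \<mu> (c \<mu>)) \<nu> = (if total_degree \<nu> = e then c \<nu> else 0)"
    for c :: "('n \<Rightarrow>\<^sub>0 nat) \<Rightarrow> 'k" and \<nu>
    by (simp add: lookup_sum lookup_single when_def)
  show ?thesis
    unfolding basis_mod_def lin
  proof (intro conjI ballI allI impI)
    fix p :: "('n \<Rightarrow>\<^sub>0 nat) \<Rightarrow>\<^sub>0 'k" assume p: "p \<in> forms UNIV e"
    have "p = (\<Sum>\<mu> | total_degree \<mu> = e. single \<mu> (lookup p \<mu>))"
      by (rule poly_mapping_eqI) (use p in \<open>auto simp: lookup forms_def in_keys_iff\<close>)
    then show "\<exists>c. p - (\<Sum>\<mu> | total_degree \<mu> = e. single \<mu> (c \<mu>)) \<in> {0}" by (intro exI[of _ "lookup p"]) simp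
  next
    fix c :: "('n \<Rightarrow>\<^sub>0 nat) \<Rightarrow> 'k" and \<mu> :: "'n \<Rightarrow>\<^sub>0 nat"
    assume "(\<Sum>\<mu> | total_degree \<mu> = e. single \<mu> (c \<mu>)) \<in> {0}" "\<mu> \<in> {\<mu>. total_degree \<mu> = e}"
    then show "c \<mu> = 0" using lookup[of c \<mu>] by simp
  qed (auto intro: forms_single)
qed

lemma presents_poly_ring:
  "presents (poly_ring_rep e) \<sigma> (forms UNIV e) {0} (perm_poly \<sigma>) (\<lambda>p. p)"
  by (auto simp: presents_def poly_ring_rep_def homogeneous_forms forms_subspace perm_poly_pm_scale
      perm_poly_forms ring_homD(2)[OF ring_hom_perm_poly])

text \<open>Monomials are permuted, so the trace counts the fixed ones.\<close>

lemma character_poly_ring: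
  "character (poly_ring_rep e :: ('k::field, 'n::finite perm, ('n, 'k) mpoly) rep) \<sigma> =
    of_nat (card {\<mu> :: 'n \<Rightarrow>\<^sub>0 nat. total_degree \<mu> = e \<and> perm_exponent \<sigma> \<mu> = \<mu>})"
proof -
  let ?J = "{\<mu> :: 'n \<Rightarrow>\<^sub>0 nat. total_degree \<mu> = e}"
  have "character (poly_ring_rep e :: ('k, 'n perm, ('n, 'k) mpoly) rep) \<sigma> =
      (\<Sum>\<mu>\<in>?J. if \<mu> = perm_exponent \<sigma> \<mu> then 1 else 0)"
  proof (rule character_basis[OF presents_poly_ring basis_mod_monomials,
        where a = "\<lambda>\<nu> \<mu>. if \<nu> = perm_exponent \<sigma> \<mu> then 1 else 0"])
    fix \<mu> :: "'n \<Rightarrow>\<^sub>0 nat" assume \<mu>: "\<mu> \<in> ?J"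
    have "(\<Sum>\<nu>\<in>?J. pm_scale (if \<nu> = perm_exponent \<sigma> \<mu> then 1 else 0) (single \<nu> (1 :: 'k))) =
        (\<Sum>\<nu>\<in>?J. if \<nu> = perm_exponent \<sigma> \<mu> then single \<nu> 1 else 0)"
      by (rule sum.cong) auto
    also have "\<dots> = single (perm_exponent \<sigma> \<mu>) 1" using \<mu> by simp
    finally show "perm_poly \<sigma> (single \<mu> 1) -
        (\<Sum>\<nu>\<in>?J. pm_scale (if \<nu> = perm_exponent \<sigma> \<mu> then 1 else 0) (single \<nu> (1 :: 'k))) \<in> {0}"
      by (simp add: perm_poly_monomial)
  qed
  also have "\<dots> = of_nat (card {\<mu>\<in>?J. \<mu> = perm_exponent \<sigma> \<mu>})"
    by (simp flip: sum.inter_filter)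
  also have "{\<mu>\<in>?J. \<mu> = perm_exponent \<sigma> \<mu>} = {\<mu>. total_degree \<mu> = e \<and> perm_exponent \<sigma> \<mu> = \<mu>}" by auto
  finally show ?thesis .
qed

lemma coset_eq_iff:
  assumes B: "is_ideal B"
  shows "x +o B = y +o B \<longleftrightarrow> x - y \<in> B"
proof
  assume "x +o B = y +o B"
  then have "x \<in> y +o B" using ideal_0[OF B] by (force simp: elt_set_plus_def)
  then show "x - y \<in> B" by (auto simp: elt_set_plus_def)
next
  have le: "x +o B \<subseteq> y +o B" if "x - y \<in> B" for x y
  proof
    fix z assume "z \<in> x +o B"
    then have "z - x \<in> B" by (auto simp: elt_set_plus_def)
    from ideal_add[OF B this that] show "z \<in> y +o B" by (auto simp: elt_set_plus_def intro!: bexI[of _ "z - y"])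
  qed
  assume "x - y \<in> B"
  moreover from this have "y - x \<in> B" using ideal_uminus[OF B, of "x - y"] by simp
  ultimately show "x +o B = y +o B" using le by blast
qed

lemma perm_poly_image_ideal:
  assumes "perm_stable B"
  shows "perm_poly \<sigma> ` B = B"
proof
  show "perm_poly \<sigma> ` B \<subseteq> B" using assms by (auto simp: perm_stable_def)
  show "B \<subseteq> perm_poly \<sigma> ` B"
  proof
    fix p assume "p \<in> B"
    then have "perm_poly (inverse \<sigma>) p \<in> B" using assms by (auto simp: perm_stable_def)
    then show "p \<in> perm_poly \<sigma> ` B" by (intro image_eqI[of _ _ "perm_poly (inverse \<sigma>) p"]) auto
  qed
qed

lemma coset_add:
  assumes B: "is_ideal B"
  shows "(x + y) +o B = (x +o B) + (y +o B)"
proof (intro equalityI subsetI)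
  fix z assume "z \<in> (x + y) +o B"
  then obtain b where "b \<in> B" "z = (x + b) + (y + 0)" by (auto simp: elt_set_plus_def algebra_simps)
  with ideal_0[OF B] show "z \<in> (x +o B) + (y +o B)" by (auto simp: elt_set_plus_def set_plus_def)
next
  fix z assume "z \<in> (x +o B) + (y +o B)"
  then obtain b b' where "b \<in> B" "b' \<in> B" "z = (x + y) + (b + b')"
    by (auto simp: elt_set_plus_def set_plus_def algebra_simps)
  with ideal_add[OF B] show "z \<in> (x + y) +o B" by (auto simp: elt_set_plus_def)
qed

lemma coset_scale:
  fixes x :: "('n, 'k::field) mpoly"
  assumes B: "is_ideal B"
  shows "pm_scale a x +o B = pm_scale a ` (x +o B) + B"
proof (intro equalityI subsetI)
  fix z assume "z \<in> pm_scale a x +o B"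
  then obtain b where "b \<in> B" "z = pm_scale a (x + 0) + b" by (auto simp: elt_set_plus_def)
  with ideal_0[OF B] show "z \<in> pm_scale a ` (x +o B) + B" by (auto simp: elt_set_plus_def set_plus_def)
next
  fix z assume "z \<in> pm_scale a ` (x +o B) + B"
  then obtain b b' where b: "b \<in> B" "b' \<in> B" "z = pm_scale a x + (pm_scale a b + b')"
    by (auto simp: elt_set_plus_def set_plus_def pm.scale_right_distrib algebra_simps)
  then have "pm_scale a b + b' \<in> B" unfolding pm_scale_const by (intro ideal_add ideal_mult B)
  with b show "z \<in> pm_scale a x +o B" by (auto simp: elt_set_plus_def)
qed

text \<open>For a stable ideal this makes the setwise image of a coset the coset of the image.\<close>

lemma set_plus_image_elt: "perm_poly \<sigma> ` (x +o B) = perm_poly \<sigma> x +o perm_poly \<sigma> ` B"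
proof (intro equalityI subsetI)
  fix z assume "z \<in> perm_poly \<sigma> x +o perm_poly \<sigma> ` B"
  then obtain b where "b \<in> B" "z = perm_poly \<sigma> (x + b)"
    by (auto simp: elt_set_plus_def ring_homD(2)[OF ring_hom_perm_poly])
  then show "z \<in> perm_poly \<sigma> ` (x +o B)" by (auto simp: elt_set_plus_def)
qed (auto simp: elt_set_plus_def ring_homD(2)[OF ring_hom_perm_poly])

lemma coset_perm:
  assumes "perm_stable B"
  shows "perm_poly \<sigma> x +o B = perm_poly \<sigma> ` (x +o B)"
proof -
  have "perm_poly \<sigma> ` (x +o B) = perm_poly \<sigma> x +o perm_poly \<sigma> ` B"
    by (simp add: set_plus_image_elt)
  then show ?thesis by (simp add: perm_poly_image_ideal[OF assms])
qed

lemma presents_quotient: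
  assumes "is_ideal A" "perm_stable A" "is_ideal B" "perm_stable B"
  shows "presents (quotient_rep A B e) \<sigma> (A \<inter> forms UNIV e) B (perm_poly \<sigma>) (\<lambda>p. p +o B)"
  unfolding presents_def
proof (intro conjI)
  show "rspace (quotient_rep A B e) = (\<lambda>p. p +o B) ` (A \<inter> forms UNIV e)"
    by (auto simp: quotient_rep_def homogeneous_forms)
  show "perm_poly \<sigma> ` (A \<inter> forms UNIV e) \<subseteq> A \<inter> forms UNIV e"
    using assms by (auto simp: perm_stable_def perm_poly_forms)
qed (use assms in \<open>simp_all add: quotient_rep_def pm.subspace_inter ideal_subspace forms_subspace
    ring_homD(2)[OF ring_hom_perm_poly] perm_poly_pm_scale coset_eq_iff coset_add coset_scale coset_perm\<close>)

lemma basis_mod_quotient_monomials: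
  assumes "is_ideal I"
  shows "\<exists>K\<subseteq>{\<mu>. total_degree \<mu> = e}. basis_mod I (forms UNIV e) K (\<lambda>\<mu> :: 'n::finite \<Rightarrow>\<^sub>0 nat. single \<mu> (1 :: 'k::field))"
proof (rule ex_basis_mod)
  show "pm.subspace I" by (rule ideal_subspace[OF assms])
  show "finite {\<mu> :: 'n \<Rightarrow>\<^sub>0 nat. total_degree \<mu> = e}" by simp
  show "\<exists>c. x - (\<Sum>\<mu> | total_degree \<mu> = e. pm_scale (c \<mu>) (single \<mu> 1)) \<in> I"
    if "x \<in> forms UNIV e" for x :: "('n, 'k) mpoly"
  proof -
    have "basis_mod {0} (forms UNIV e) {\<mu> :: 'n \<Rightarrow>\<^sub>0 nat. total_degree \<mu> = e} (\<lambda>\<mu>. single \<mu> (1 :: 'k))"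
      by (rule basis_mod_monomials)
    then obtain c where "x - (\<Sum>\<mu> | total_degree \<mu> = e. pm_scale (c \<mu>) (single \<mu> 1)) \<in> {0}"
      using \<open>x \<in> forms UNIV e\<close> unfolding basis_mod_def by blast
    then show ?thesis using ideal_0[OF assms] by (intro exI[of _ c]) simp
  qed
qed (auto intro: forms_single)

section \<open>Alternating functions\<close>

text \<open>
  The \<open>u\<close>-th exterior power of the permutation representation, as functions on lists of length \<open>u\<close> that
  change sign when neighbours are exchanged.
\<close>

definition alternating :: "nat \<Rightarrow> ('n list \<Rightarrow> 'k::field) set" where
  "alternating u = {v. (\<forall>bs. length bs \<noteq> u \<longrightarrow> v bs = 0) \<and>
     (\<forall>xs a b ys. v (xs @ a # b # ys) = - v (xs @ b # a # ys))}"

text \<open>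
  Summation over the first argument.  This is contraction with the invariant linear form, and its kernel is
  the exterior power of the standard representation.
\<close>

definition boundary :: "('n::finite list \<Rightarrow> 'k::field) \<Rightarrow> 'n list \<Rightarrow> 'k" where
  "boundary v bs = (\<Sum>b\<in>UNIV. v (b # bs))"

text \<open>
  The alternating function that corresponds to the product of the basis vectors listed in \<open>cs\<close>.
\<close>

definition wedge :: "'n list \<Rightarrow> 'n list \<Rightarrow> 'k::field" where
  "wedge cs ds = (\<Sum>\<pi> | \<pi> permutes set cs. if map \<pi> cs = ds then of_int (sign \<pi>) else 0)"

definition enum :: "'n set \<Rightarrow> 'n list" where
  "enum X = (SOME xs. set xs = X \<and> distinct xs)"

lemma enum: "set (enum X) = X" "distinct (enum X)" for X :: "'n::finite set"
  using someI_ex[OF finite_distinct_list[of X]] by (simp_all add: enum_def)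

lemma length_enum [simp]: "length (enum X) = card X" for X :: "'n::finite set"
  using distinct_card[OF enum(2), of X] by (simp add: enum)

lemma alternating_swap: "v \<in> alternating u \<Longrightarrow> v (xs @ a # b # ys) = - v (xs @ b # a # ys)"
  unfolding alternating_def by blast

lemma alternating_length: "v \<in> alternating u \<Longrightarrow> length bs \<noteq> u \<Longrightarrow> v bs = 0"
  unfolding alternating_def by blast

lemma alternating_move:
  assumes "v \<in> alternating u"
  shows "v (xs @ y # ys @ zs) = 0 \<longleftrightarrow> v (xs @ ys @ y # zs) = 0"
proof (induction ys arbitrary: xs)
  case (Cons a ys)
  have "v (xs @ y # a # (ys @ zs)) = 0 \<longleftrightarrow> v (xs @ a # y # (ys @ zs)) = 0"
    by (subst alternating_swap[OF assms]) simp
  then show ?case using Cons[of "xs @ [a]"] by simp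
qed simp

lemma alternating_not_distinct:
  fixes v :: "'n list \<Rightarrow> 'k::field_char_0"
  assumes v: "v \<in> alternating u" and "\<not> distinct bs"
  shows "v bs = 0"
proof -
  obtain xs ys zs y where bs: "bs = xs @ y # ys @ y # zs"
    using not_distinct_decomp[OF assms(2)] by auto
  have "v ((xs @ ys) @ y # y # zs) = - v ((xs @ ys) @ y # y # zs)" by (rule alternating_swap[OF v])
  then have "v (xs @ ys @ y # (y # zs)) = 0" by (simp add: eq_neg_iff_add_eq_0)
  then show ?thesis using alternating_move[OF v, of xs y ys "y # zs"] by (simp add: bs)
qed

text \<open>Only the vanishing is compared, so that no signs have to be tracked.\<close>

lemma alternating_mset:
  assumes v: "v \<in> alternating u" and "mset bs = mset cs"
  shows "v bs = 0 \<longleftrightarrow> v cs = 0"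
proof -
  have "v (xs @ bs) = 0 \<longleftrightarrow> v (xs @ cs) = 0" for xs
    using assms(2)
  proof (induction bs arbitrary: xs cs)
    case (Cons b bs)
    then have "b \<in> set cs" by (metis list.set_intros(1) mset_eq_setD)
    then obtain ys zs where cs: "cs = ys @ b # zs" by (metis split_list)
    with Cons.prems have "mset bs = mset (ys @ zs)" by simp
    from Cons.IH[OF this, of "xs @ [b]"] show ?case
      using alternating_move[OF v, of xs b ys zs] by (simp add: cs)
  qed simp
  from this[of "[]"] show ?thesis by simp
qed

lemma wedge_0:
  assumes "\<And>\<pi>. \<pi> permutes set cs \<Longrightarrow> map \<pi> cs \<noteq> ds"
  shows "wedge cs ds = 0"
  unfolding wedge_def by (rule sum.neutral) (use assms in auto)

lemma wedge_set: "set ds \<noteq> set cs \<Longrightarrow> wedge cs ds = 0"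
  by (rule wedge_0) (metis list.set_map permutes_image)

lemma wedge_not_distinct: "distinct cs \<Longrightarrow> \<not> distinct ds \<Longrightarrow> wedge cs ds = 0"
  by (rule wedge_0) (metis distinct_map permutes_inj_on)

lemma wedge_length: "length ds \<noteq> length cs \<Longrightarrow> wedge cs ds = 0"
  by (rule wedge_0) auto

lemma wedge_map:
  assumes "\<rho> permutes set cs"
  shows "wedge cs (map \<rho> cs) = of_int (sign \<rho>)"
proof -
  have "\<pi> = \<rho>" if "\<pi> permutes set cs" "map \<pi> cs = map \<rho> cs" for \<pi>
  proof
    fix x show "\<pi> x = \<rho> x"
      using that assms by (cases "x \<in> set cs") (auto simp: permutes_not_in)
  qed
  then have "wedge cs (map \<rho> cs) = (\<Sum>\<pi> | \<pi> permutes set cs. if \<pi> = \<rho> then of_int (sign \<pi>) else 0)"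
    unfolding wedge_def by (intro sum.cong) auto
  also have "\<dots> = of_int (sign \<rho>)" using assms by (simp add: finite_permutations)
  finally show ?thesis .
qed

lemma wedge_self: "wedge cs cs = 1"
  using wedge_map[of id cs] by (simp add: permutes_id)

lemma wedge_alternating:
  assumes cs: "distinct cs" "length cs = u"
  shows "wedge cs \<in> alternating u"
  unfolding alternating_def
proof (safe)
  show "wedge cs bs = 0" if "length bs \<noteq> u" for bs using that cs by (simp add: wedge_length)
  fix xs ys :: "'a list" and a b
  show "wedge cs (xs @ a # b # ys) = - wedge cs (xs @ b # a # ys)"
  proof (cases "distinct (xs @ a # b # ys) \<and> set (xs @ a # b # ys) = set cs")
    case False
    then have "\<not> distinct (xs @ b # a # ys) \<or> set (xs @ b # a # ys) \<noteq> set cs" by auto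
    with False show ?thesis using cs wedge_set wedge_not_distinct by (metis neg_equal_zero neg_0_equal_iff_equal)
  next
    case True
    let ?t = "Transposition.transpose a b"
    have t: "?t permutes set cs" using True by (intro permutes_swap_id) auto
    have ab: "a \<noteq> b" using True by auto
    have "?t x = x" if "x \<in> set xs \<union> set ys" for x
      using True that by (intro transpose_apply_other) auto
    then have t_list: "map ?t (xs @ a # b # ys) = xs @ b # a # ys" by (simp add: map_idI)
    have "map (?t \<circ> \<pi>) cs = xs @ a # b # ys \<longleftrightarrow> map \<pi> cs = xs @ b # a # ys" for \<pi>
    proof -
      have "map (?t \<circ> \<pi>) cs = xs @ a # b # ys \<longleftrightarrow> map ?t (map ?t (map \<pi> cs)) = map ?t (xs @ a # b # ys)"
        by (subst inj_map_eq_map) (simp_all add: inj_transpose)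
      also have "map ?t (map ?t (map \<pi> cs)) = map \<pi> cs" by (simp add: o_def)
      finally show ?thesis by (simp only: t_list)
    qed
    moreover have "sign (?t \<circ> \<pi>) = - sign \<pi>" if "\<pi> permutes set cs" for \<pi>
      using that ab by (subst sign_compose)
        (auto simp: sign_swap_id permutation_swap_id intro: permutes_imp_permutation)
    ultimately show ?thesis
      unfolding wedge_def
      by (subst setum_permutations_compose_left[OF t]) (auto simp flip: sum_negf intro!: sum.cong)
  qed
qed

lemma boundary_alternating:
  assumes "v \<in> alternating (Suc u)"
  shows "boundary v \<in> alternating u"
  unfolding alternating_def
proof safe
  show "boundary v bs = 0" if "length bs \<noteq> u" for bs
    using that assms by (simp add: boundary_def alternating_length)
  fix xs a b ys
  have "v (c # xs @ a # b # ys) = - v (c # xs @ b # a # ys)" for c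
    using alternating_swap[OF assms, of "c # xs" a b ys] by simp
  then show "boundary v (xs @ a # b # ys) = - boundary v (xs @ b # a # ys)"
    by (simp add: boundary_def sum_negf)
qed

lemma boundary_boundary:
  fixes v :: "'n::finite list \<Rightarrow> 'k::field_char_0"
  assumes "v \<in> alternating u"
  shows "boundary (boundary v) bs = 0"
proof -
  have "v (b # a # bs) = - v (a # b # bs)" for a b
    using alternating_swap[OF assms, of "[]" b a bs] by simp
  then have "(\<Sum>a\<in>UNIV. \<Sum>b\<in>UNIV. v (b # a # bs)) = (\<Sum>a\<in>UNIV. \<Sum>b\<in>UNIV. - v (a # b # bs))"
    by (intro sum.cong refl)
  then have "(\<Sum>a\<in>UNIV. \<Sum>b\<in>UNIV. v (b # a # bs)) = - (\<Sum>a\<in>UNIV. \<Sum>b\<in>UNIV. v (a # b # bs))"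
    by (simp only: sum_negf)
  also have "(\<Sum>a\<in>UNIV. \<Sum>b\<in>UNIV. v (a # b # bs)) = (\<Sum>a\<in>UNIV. \<Sum>b\<in>UNIV. v (b # a # bs))"
    by (rule sum.swap)
  finally show ?thesis by (simp add: boundary_def eq_neg_iff_add_eq_0)
qed

lemma alternating_0_iff:
  fixes v :: "'n::finite list \<Rightarrow> 'k::field_char_0"
  assumes v: "v \<in> alternating u" and "\<And>X. card X = u \<Longrightarrow> v (enum X) = 0"
  shows "v bs = 0"
proof (cases "distinct bs \<and> length bs = u")
  case True
  then have "mset bs = mset (enum (set bs))" using enum[of "set bs"] by (simp add: set_eq_iff_mset_eq_distinct flip: enum)
  then show ?thesis
    using alternating_mset[OF v] assms(2)[of "set bs"] True by (metis distinct_card)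
next
  case False
  then show ?thesis using v alternating_not_distinct alternating_length by blast
qed

text \<open>
  On a list with \<open>i0\<close>, move \<open>i0\<close> to the front and drop it: the vanishing sum over the first argument has then only the
  term of \<open>i0\<close>, because the others are values on lists without \<open>i0\<close>.
\<close>

lemma cycle_eq_0:
  fixes v :: "'n::finite list \<Rightarrow> 'k::field_char_0"
  assumes v: "v \<in> alternating u" and cyc: "\<And>bs. boundary v bs = 0"
    and X: "\<And>X. card X = u \<Longrightarrow> i0 \<notin> X \<Longrightarrow> v (enum X) = 0"
  shows "v bs = 0"
proof -
  have avoid: "v bs = 0" if "i0 \<notin> set bs" for bs
  proof (cases "distinct bs \<and> length bs = u")
    case True
    then have "mset bs = mset (enum (set bs))" using enum[of "set bs"] by (simp add: set_eq_iff_mset_eq_distinct flip: enum)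
    then show ?thesis
      using alternating_mset[OF v] X[of "set bs"] True that by (metis distinct_card)
  next
    case False
    then show ?thesis using v alternating_not_distinct alternating_length by blast
  qed
  show ?thesis
  proof (cases "distinct bs \<and> i0 \<in> set bs")
    case True
    let ?bs = "remove1 i0 bs"
    have "i0 \<notin> set ?bs" using True by simp
    then have "v (b # ?bs) = 0" if "b \<noteq> i0" for b using avoid[of "b # ?bs"] that by auto
    then have "boundary v ?bs = v (i0 # ?bs)"
      unfolding boundary_def by (subst sum.remove[of _ i0]) (auto intro!: sum.neutral)
    with cyc have "v (i0 # ?bs) = 0" by simp
    moreover have "mset bs = mset (i0 # ?bs)" using True by simp
    ultimately show ?thesis using alternating_mset[OF v] by blast
  next
    case False
    then show ?thesis using avoid alternating_not_distinct[OF v] by blast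
  qed
qed

definition alternating_rep :: "nat \<Rightarrow> ('k::field, 'n::finite perm, 'n list \<Rightarrow> 'k) rep" where
  "alternating_rep u =
    \<lparr>rspace = alternating u, rzero = (\<lambda>_. 0), radd = (\<lambda>v w bs. v bs + w bs),
     rscale = (\<lambda>a v bs. a * v bs), ract = (\<lambda>\<sigma> v bs. v (map ((\<langle>$\<rangle>) (inverse \<sigma>)) bs))\<rparr>"

text \<open>
  The functions \<open>boundary (wedge (i0 # enum X))\<close>, for the sets \<open>X\<close> of size \<open>u\<close> without \<open>i0\<close>, form a basis
  of the kernel of the boundary, whose coordinates are the values at the \<open>enum X\<close>.  This is the trace of
  \<open>\<sigma>\<close> in this basis.
\<close>

definition hook_trace :: "'n::finite \<Rightarrow> 'n perm \<Rightarrow> nat \<Rightarrow> 'k::field" where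
  "hook_trace i0 \<sigma> u = (\<Sum>X | card X = u \<and> i0 \<notin> X.
     boundary (wedge (i0 # enum X)) (map ((\<langle>$\<rangle>) (inverse \<sigma>)) (enum X)))"

lemma alternatingI:
  assumes "\<And>bs. length bs \<noteq> u \<Longrightarrow> v bs = 0" "\<And>xs a b ys. v (xs @ a # b # ys) = - v (xs @ b # a # ys)"
  shows "v \<in> alternating u"
  unfolding alternating_def using assms by blast

lemma alternating_add:
  assumes "v \<in> alternating u" "w \<in> alternating u"
  shows "(\<lambda>bs. v bs + w bs) \<in> alternating u"
proof (rule alternatingI)
  show "v bs + w bs = 0" if "length bs \<noteq> u" for bs
    using assms that by (simp add: alternating_length)
  show "v (xs @ a # b # ys) + w (xs @ a # b # ys) = - (v (xs @ b # a # ys) + w (xs @ b # a # ys))" for xs a b ys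
    using alternating_swap[OF assms(1), of xs a b ys] alternating_swap[OF assms(2), of xs a b ys] by simp
qed

lemma alternating_scale:
  assumes "v \<in> alternating u"
  shows "(\<lambda>bs. c * v bs) \<in> alternating u"
proof (rule alternatingI)
  show "c * v bs = 0" if "length bs \<noteq> u" for bs
    using assms that by (simp add: alternating_length)
  show "c * v (xs @ a # b # ys) = - (c * v (xs @ b # a # ys))" for xs a b ys
    using alternating_swap[OF assms, of xs a b ys] by simp
qed

lemma alternating_act:
  assumes "v \<in> alternating u"
  shows "(\<lambda>bs. v (map f bs)) \<in> alternating u"
proof (rule alternatingI)
  show "v (map f bs) = 0" if "length bs \<noteq> u" for bs
    using assms that by (simp add: alternating_length)
  show "v (map f (xs @ a # b # ys)) = - v (map f (xs @ b # a # ys))" for xs a b ys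
    using alternating_swap[OF assms, of "map f xs" "f a" "f b" "map f ys"] by simp
qed

lemma alternating_linear_action: "linear_action (alternating_rep u) \<sigma>"
  by (auto simp: linear_action_def alternating_rep_def intro: alternating_add alternating_scale alternating_act)

lemma boundary_act:
  "boundary (\<lambda>bs. v (map ((\<langle>$\<rangle>) \<tau>) bs)) bs = boundary v (map ((\<langle>$\<rangle>) \<tau>) bs)"
  unfolding boundary_def by (simp, rule sum.reindex_bij_betw) simp

lemma boundary_wedge_basis:
  assumes "i0 \<notin> X" "i0 \<notin> X'" "card X = card X'"
  shows "boundary (wedge (i0 # enum X)) (enum X') = (if X' = X then 1 else (0 :: 'k::field))"
proof -
  have "wedge (i0 # enum X) (b # enum X') = (if b = i0 \<and> X' = X then 1 else (0::'k))" for b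
  proof (cases "b = i0 \<and> X' = X")
    case False
    have "insert b X' \<noteq> insert i0 X"
    proof
      assume eq: "insert b X' = insert i0 X"
      have "i0 \<in> insert b X'" unfolding eq by simp
      with assms(2) have "b = i0" by simp
      with eq have "X' = X" using insert_ident[OF assms(2,1)] by metis
      with \<open>b = i0\<close> False show False by simp
    qed
    then have "set (b # enum X') \<noteq> set (i0 # enum X)" by (simp add: enum)
    then show ?thesis using False by (simp add: wedge_set)
  qed (auto simp: wedge_self)
  then have "boundary (wedge (i0 # enum X)) (enum X') = (\<Sum>b\<in>UNIV. if b = i0 \<and> X' = X then 1 else (0 :: 'k))"
    unfolding boundary_def by (rule sum.cong[OF refl])
  also have "\<dots> = (if X' = X then 1 else 0)" by (cases "X' = X") simp_all
  finally show ?thesis .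
qed

text \<open>
  Exactness of the boundary splits the exterior power of degree \<open>u + 1\<close> of the permutation representation into
  those of degree \<open>u + 1\<close> and \<open>u\<close> of the standard representation.  Its trace is
  computed in two coordinate systems: the values at all \<open>enum X\<close>, and the values of the function at the sets
  without \<open>i0\<close> together with those of its boundary.
\<close>

lemma hook_trace_step:
  fixes \<sigma> :: "'n::finite perm"
  shows "(hook_trace i0 \<sigma> (Suc u) :: 'k::field_char_0) + hook_trace i0 \<sigma> u =
    (\<Sum>X | card X = Suc u. wedge (enum X) (map ((\<langle>$\<rangle>) (inverse \<sigma>)) (enum X)))"
proof -
  let ?V = "alternating_rep (Suc u) :: ('k, 'n perm, 'n list \<Rightarrow> 'k) rep"
  let ?Z = "\<lambda>u. {X :: 'n set. card X = u \<and> i0 \<notin> X}"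
  let ?J1 = "{X :: 'n set. card X = Suc u}" and ?J2 = "Inl ` ?Z (Suc u) \<union> Inr ` ?Z u"
  let ?\<kappa>1 = "\<lambda>v X. if X \<in> ?J1 then v (enum X) else (0 :: 'k)"
  let ?\<kappa>2 = "\<lambda>v j. if j \<in> ?J2 then case_sum (\<lambda>X. v (enum X)) (\<lambda>Y. boundary v (enum Y)) j else (0 :: 'k)"
  let ?b2 = "case_sum (\<lambda>X. boundary (wedge (i0 # enum X))) (\<lambda>Y. wedge (i0 # enum Y)) :: _ \<Rightarrow> 'n list \<Rightarrow> 'k"
  have V: "rspace ?V = alternating (Suc u)" "radd ?V = (\<lambda>v w bs. v bs + w bs)"
    "rscale ?V = (\<lambda>a v bs. a * v bs)" "ract ?V = (\<lambda>\<sigma> v bs. v (map ((\<langle>$\<rangle>) (inverse \<sigma>)) bs))"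
    by (simp_all add: alternating_rep_def)
  have zero: "(\<lambda>_. 0) \<in> rspace ?V" by (simp add: V alternating_def)
  have diff: "(\<lambda>bs. v bs - w bs) \<in> alternating n" if "v \<in> alternating n" "w \<in> alternating n"
    for v w :: "'n list \<Rightarrow> 'k" and n
    using alternating_add[OF that(1) alternating_scale[OF that(2), of "- 1"]] by simp
  have b1: "wedge (enum X) \<in> rspace ?V \<and> ?\<kappa>1 (wedge (enum X)) = unit_fun X" if "X \<in> ?J1" for X
  proof -
    have "wedge (enum X) (enum Y) = (if Y = X then 1 else (0 :: 'k))" for Y
      using wedge_set[of "enum Y" "enum X"] by (auto simp: wedge_self enum)
    then show ?thesis using that by (auto simp: V enum wedge_alternating)
  qed
  have c1: "coords ?V ?J1 ?\<kappa>1"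
  proof (rule coordsI[OF _ zero alternating_linear_action, where b = "\<lambda>X. wedge (enum X)"])
    fix v w assume vw: "v \<in> rspace ?V" "w \<in> rspace ?V" "\<forall>X\<in>?J1. ?\<kappa>1 v X = ?\<kappa>1 w X"
    have "v bs - w bs = 0" for bs
      by (rule alternating_0_iff[OF diff[of v "Suc u" w]]) (use vw in \<open>auto simp: V\<close>)
    then show "v = w" by (simp add: fun_eq_iff)
  qed (use b1 in \<open>auto simp: V\<close>)
  have b2: "?b2 j \<in> rspace ?V \<and> ?\<kappa>2 (?b2 j) = unit_fun j" if j: "j \<in> ?J2" for j
  proof (cases j)
    case (Inl X)
    with j have X: "card X = Suc u" "i0 \<notin> X" by auto
    have wX: "wedge (i0 # enum X) \<in> (alternating (Suc (Suc u)) :: ('n list \<Rightarrow> 'k) set)"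
      using X by (intro wedge_alternating) (auto simp: enum)
    have "?\<kappa>2 (?b2 j) l = unit_fun j l" for l
      using X by (cases l) (simp_all add: Inl boundary_wedge_basis boundary_boundary[OF wX] image_iff)
    then show ?thesis using boundary_alternating[OF wX] by (auto simp: Inl V)
  next
    case (Inr Y)
    with j have Y: "card Y = u" "i0 \<notin> Y" by auto
    have wY: "wedge (i0 # enum Y) \<in> (alternating (Suc u) :: ('n list \<Rightarrow> 'k) set)"
      using Y by (intro wedge_alternating) (auto simp: enum)
    have "wedge (i0 # enum Y) (enum X) = (0 :: 'k)" if "i0 \<notin> X" for X
      by (rule wedge_set) (use that in \<open>auto simp: enum\<close>)
    then have "?\<kappa>2 (?b2 j) l = unit_fun j l" for l
      using Y by (cases l) (simp_all add: Inr boundary_wedge_basis image_iff)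
    then show ?thesis using wY by (auto simp: Inr V)
  qed
  have c2: "coords ?V ?J2 ?\<kappa>2"
  proof (rule coordsI[OF _ zero alternating_linear_action, where b = ?b2])
    fix v w assume vw: "v \<in> rspace ?V" "w \<in> rspace ?V" "\<forall>j\<in>?J2. ?\<kappa>2 v j = ?\<kappa>2 w j"
    let ?d = "\<lambda>bs. v bs - w bs"
    have d: "?d \<in> alternating (Suc u)" using vw by (intro diff) (auto simp: V)
    have bd: "boundary ?d bs = boundary v bs - boundary w bs" for bs
      by (simp add: boundary_def sum_subtractf)
    have cyc: "boundary ?d bs = 0" for bs
    proof (rule cycle_eq_0[OF boundary_alternating[OF d], of i0])
      show "boundary (boundary ?d) bs = 0" for bs by (rule boundary_boundary[OF d])
      fix Y assume "card Y = u" "i0 \<notin> Y"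
      then have "?\<kappa>2 v (Inr Y) = ?\<kappa>2 w (Inr Y)" using vw(3) by blast
      with \<open>card Y = u\<close> \<open>i0 \<notin> Y\<close> show "boundary ?d (enum Y) = 0" by (simp add: bd)
    qed
    have "?d (enum X) = 0" if "card X = Suc u" "i0 \<notin> X" for X
    proof -
      have "?\<kappa>2 v (Inl X) = ?\<kappa>2 w (Inl X)" using vw(3) that by blast
      with that show ?thesis by simp
    qed
    then have "?d bs = 0" for bs by (rule cycle_eq_0[OF d cyc])
    then show "v = w" by (simp add: fun_eq_iff)
  qed (use b2 in \<open>auto simp: V boundary_def sum.distrib sum_distrib_left split: sum.splits\<close>)
  have "(\<Sum>X\<in>?J1. ?\<kappa>1 (ract ?V \<sigma> (wedge (enum X))) X) = (\<Sum>j\<in>?J2. ?\<kappa>2 (ract ?V \<sigma> (?b2 j)) j)"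
    using character_eq[OF alternating_linear_action c1 b1, of \<sigma>]
      character_eq[OF alternating_linear_action c2 b2, of \<sigma>] by simp
  also have "\<dots> = (\<Sum>j\<in>Inl ` ?Z (Suc u). ?\<kappa>2 (ract ?V \<sigma> (?b2 j)) j) + (\<Sum>j\<in>Inr ` ?Z u. ?\<kappa>2 (ract ?V \<sigma> (?b2 j)) j)"
    by (rule sum.union_disjoint) auto
  also have "\<dots> = hook_trace i0 \<sigma> (Suc u) + hook_trace i0 \<sigma> u"
    by (simp add: sum.reindex hook_trace_def V boundary_act cong: sum.cong)
  finally have "hook_trace i0 \<sigma> (Suc u) + hook_trace i0 \<sigma> u =
      (\<Sum>X\<in>?J1. ?\<kappa>1 (ract ?V \<sigma> (wedge (enum X))) X)" by (rule sym)
  also have "\<dots> = (\<Sum>X | card X = Suc u. wedge (enum X) (map ((\<langle>$\<rangle>) (inverse \<sigma>)) (enum X)))"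
    by (rule sum.cong) (simp_all add: V)
  finally show ?thesis .
qed

lemma hook_trace_0: "hook_trace i0 \<sigma> 0 = 1" for i0 :: "'n::finite"
proof -
  have "{X. card X = 0 \<and> i0 \<notin> X} = {{}}" by auto
  moreover have e: "enum {} = ([] :: 'n list)" using enum(1)[of "{} :: 'n set"] by simp
  ultimately show ?thesis
    using boundary_wedge_basis[of i0 "{}" "{}"] unfolding hook_trace_def by (simp add: e)
qed

lemma hook_trace_top: "hook_trace i0 \<sigma> CARD('n) = 0" for i0 :: "'n::finite"
proof -
  have empty: "{X. card X = CARD('n) \<and> i0 \<notin> X} = {}"
    by (auto dest: card_eq_UNIV_imp_eq_UNIV[rotated])
  show ?thesis unfolding hook_trace_def empty by simp
qed

section \<open>Specht modules of hooks\<close>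

text \<open>
  A tabloid of hook shape is determined by the entries \<open>bs\<close> of the first column below the first row.
\<close>

definition tab :: "'n list \<Rightarrow> 'n \<Rightarrow> nat" where
  "tab bs a = (if a \<in> set bs then Suc (THE k. k < length bs \<and> bs ! k = a) else 0)"

lemma tab_nth: "distinct bs \<Longrightarrow> k < length bs \<Longrightarrow> tab bs (bs ! k) = Suc k"
  by (auto simp: tab_def nth_eq_iff_index_eq)

lemma tab_notin [simp]: "a \<notin> set bs \<Longrightarrow> tab bs a = 0"
  by (simp add: tab_def)

lemma tab_inject:
  assumes "distinct bs" "distinct cs" "length bs = length cs"
  shows "tab bs = tab cs \<longleftrightarrow> bs = cs"
proof
  assume eq: "tab bs = tab cs"
  show "bs = cs"
  proof (rule nth_equalityI)
    fix k assume k: "k < length bs"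
    have "tab cs (bs ! k) = Suc k" using tab_nth[OF assms(1) k] eq by simp
    moreover from this have "bs ! k \<in> set cs" by (metis tab_notin nat.simps(3))
    then obtain l where "l < length cs" "bs ! k = cs ! l" by (metis in_set_conv_nth)
    ultimately show "bs ! k = cs ! k" using tab_nth[OF assms(2), of l] by simp
  qed (rule assms)
qed simp

lemma distinct_map_perm [simp]: "distinct (map ((\<langle>$\<rangle>) \<sigma>) bs) \<longleftrightarrow> distinct bs"
  by (auto simp: distinct_map inj_on_def apply_inj)

lemma perm_tabloid_tab:
  assumes "distinct bs"
  shows "perm_tabloid \<sigma> (tab bs) = tab (map ((\<langle>$\<rangle>) \<sigma>) bs)"
proof
  fix a
  show "perm_tabloid \<sigma> (tab bs) a = tab (map ((\<langle>$\<rangle>) \<sigma>) bs) a"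
  proof (cases "a \<in> set (map ((\<langle>$\<rangle>) \<sigma>) bs)")
    case True
    then obtain k where k: "k < length bs" "a = map ((\<langle>$\<rangle>) \<sigma>) bs ! k"
      by (metis in_set_conv_nth length_map)
    have "tab (map ((\<langle>$\<rangle>) \<sigma>) bs) a = Suc k"
      unfolding k(2) by (rule tab_nth) (use assms k in auto)
    with k assms show ?thesis by (simp add: perm_tabloid_def tab_nth)
  next
    case False
    then have "inverse \<sigma> \<langle>$\<rangle> a \<notin> set bs" by (auto simp: image_iff)
    with False show ?thesis by (simp add: perm_tabloid_def del: set_map)
  qed
qed

lemma perm_tabloid_inverse: "perm_tabloid \<sigma> r = s \<longleftrightarrow> r = perm_tabloid (inverse \<sigma>) s"
  by (auto simp: perm_tabloid_def fun_eq_iff) (metis inverse_perm_apply)+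

lemma lookup_perm_module: "lookup (perm_module \<sigma> v) r = lookup v (perm_tabloid (inverse \<sigma>) r)"
proof -
  have "lookup (perm_module \<sigma> v) r =
      (\<Sum>s\<in>keys v. if s = perm_tabloid (inverse \<sigma>) r then lookup v s else 0)"
    unfolding perm_module_def lookup_sum
    by (rule sum.cong) (auto simp: lookup_single when_def perm_tabloid_inverse)
  then show ?thesis by (simp add: in_keys_iff)
qed

text \<open>The coefficients of an element of the permutation module, as a function on lists.\<close>

definition tab_coeff :: "nat \<Rightarrow> (('n \<Rightarrow> nat) \<Rightarrow>\<^sub>0 'k::field) \<Rightarrow> 'n list \<Rightarrow> 'k" where
  "tab_coeff u v bs = (if distinct bs \<and> length bs = u then lookup v (tab bs) else 0)"

definition hook_tabs :: "nat \<Rightarrow> ('n \<Rightarrow> nat) set" where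
  "hook_tabs u = tab ` {bs. distinct bs \<and> length bs = u}"

lemma tab_coeff_perm:
  "tab_coeff u (perm_module \<sigma> v) bs = tab_coeff u v (map ((\<langle>$\<rangle>) (inverse \<sigma>)) bs)"
  by (simp add: tab_coeff_def lookup_perm_module perm_tabloid_tab)

text \<open>
  For a hook, the columns other than the first have one box, so that column permutations only move the
  entries of the first column.
\<close>

lemma first_column:
  fixes t :: "nat \<times> nat \<Rightarrow> 'n::finite"
  assumes t: "tableau (hook CARD('n) u) t" and u: "u < CARD('n)"
  defines "cs \<equiv> map (\<lambda>i. t (i, 0)) [0..<Suc u]"
  shows "distinct cs" "row_of (hook CARD('n) u) t = tab (tl cs)"
    "column_group (hook CARD('n) u) t = {\<pi>. (\<langle>$\<rangle>) \<pi> permutes set cs}"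
proof -
  let ?\<nu> = "hook CARD('n) u"
  have diagram: "(i, j) \<in> diagram ?\<nu> \<longleftrightarrow> (i = 0 \<and> j < CARD('n) - u) \<or> (1 \<le> i \<and> i \<le> u \<and> j = 0)" for i j
    by (cases i) (auto simp: diagram_def hook_def nth_replicate less_Suc_eq_le Suc_le_eq)
  have inj: "inj_on t (diagram ?\<nu>)" and surj: "t ` diagram ?\<nu> = UNIV"
    using t by (auto simp: tableau_def bij_betw_def)
  have col0: "(i, 0) \<in> diagram ?\<nu>" if "i \<le> u" for i using that u by (cases i) (auto simp: diagram)
  show "distinct cs"
    unfolding cs_def distinct_map
    by (auto intro!: inj_onI dest!: inj_onD[OF inj] simp: col0 less_Suc_eq_le)
  have inv: "inv_into (diagram ?\<nu>) t (t (i, j)) = (i, j)" if "(i, j) \<in> diagram ?\<nu>" for i j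
    using that by (rule inv_into_f_f[OF inj])
  have row: "row_of ?\<nu> t (t (i, j)) = i" and col: "col_of ?\<nu> t (t (i, j)) = j" if "(i, j) \<in> diagram ?\<nu>" for i j
    using inv[OF that] by (simp_all add: row_of_def col_of_def)
  have cases: "\<exists>i j. (i, j) \<in> diagram ?\<nu> \<and> a = t (i, j)" for a using surj by (metis UNIV_I imageE surj_pair)
  have set_cs: "t (i, j) \<in> set cs \<longleftrightarrow> j = 0" if "(i, j) \<in> diagram ?\<nu>" for i j
  proof
    assume "t (i, j) \<in> set cs"
    then obtain k where "k \<le> u" "t (i, j) = t (k, 0)" by (auto simp: cs_def less_Suc_eq_le simp del: upt_Suc)
    then have "(i, j) = (k, 0)" using that col0 by (intro inj_onD[OF inj])
    then show "j = 0" by simp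
  next
    assume "j = 0"
    with that have "i < Suc u" by (auto simp: diagram)
    with \<open>j = 0\<close> show "t (i, j) \<in> set cs" unfolding cs_def by (auto simp del: upt_Suc)
  qed
  have tl_cs: "tl cs = map (\<lambda>i. t (i, 0)) [Suc 0..<Suc u]" unfolding cs_def by (simp only: map_tl[symmetric] tl_upt)
  have dist: "distinct (tl cs)" using \<open>distinct cs\<close> by (rule distinct_tl)
  show "row_of ?\<nu> t = tab (tl cs)"
  proof
    fix a
    obtain i j where ij: "(i, j) \<in> diagram ?\<nu>" "a = t (i, j)" using cases by blast
    show "row_of ?\<nu> t a = tab (tl cs) a"
    proof (cases i)
      case 0
      have "t (0, j) \<notin> set (tl cs)"
      proof
        assume "t (0, j) \<in> set (tl cs)"
        then obtain k where "1 \<le> k" "k \<le> u" "t (0, j) = t (k, 0)"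
          by (auto simp: tl_cs less_Suc_eq_le simp del: upt_Suc)
        then have "(0, j) = (k, 0)" using ij 0 col0 by (intro inj_onD[OF inj]) auto
        with \<open>1 \<le> k\<close> show False by simp
      qed
      with 0 ij show ?thesis by (simp add: row)
    next
      case (Suc k)
      with ij have "k < u" "j = 0" by (auto simp: diagram)
      then have "a = tl cs ! k" "k < length (tl cs)" using Suc ij by (simp_all add: tl_cs nth_upt del: upt_Suc)
      then have "tab (tl cs) a = Suc k" using tab_nth[OF dist] by simp
      with Suc ij show ?thesis by (simp add: row)
    qed
  qed
  show "column_group ?\<nu> t = {\<pi>. (\<langle>$\<rangle>) \<pi> permutes set cs}"
  proof (intro equalityI subsetI)
    fix \<pi> assume \<pi>: "\<pi> \<in> column_group ?\<nu> t"
    have "\<pi> \<langle>$\<rangle> a = a" if "a \<notin> set cs" for a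
    proof -
      obtain i j where ij: "(i, j) \<in> diagram ?\<nu>" "a = t (i, j)" using cases by blast
      obtain i' j' where ij': "(i', j') \<in> diagram ?\<nu>" "\<pi> \<langle>$\<rangle> a = t (i', j')" using cases by blast
      have "j' = j" using \<pi> ij ij' col unfolding column_group_def by (metis (mono_tags, lifting) mem_Collect_eq)
      moreover have "j \<noteq> 0" using that set_cs[OF ij(1)] ij(2) by blast
      ultimately show ?thesis using ij ij' by (auto simp: diagram)
    qed
    then show "\<pi> \<in> {\<pi>. (\<langle>$\<rangle>) \<pi> permutes set cs}"
      using bij_apply[of \<pi>] by (auto simp: permutes_def bij_iff)
  next
    fix \<pi> assume "\<pi> \<in> {\<pi>. (\<langle>$\<rangle>) \<pi> permutes set cs}"
    then have \<pi>: "(\<langle>$\<rangle>) \<pi> permutes set cs" by simp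
    have "col_of ?\<nu> t (\<pi> \<langle>$\<rangle> a) = col_of ?\<nu> t a" for a
    proof (cases "a \<in> set cs")
      case True
      then have "\<pi> \<langle>$\<rangle> a \<in> set cs" using \<pi> by (simp add: permutes_in_image)
      have "col_of ?\<nu> t b = 0" if "b \<in> set cs" for b
      proof -
        obtain i j where "(i, j) \<in> diagram ?\<nu>" "b = t (i, j)" using cases by blast
        then show ?thesis using that set_cs col by metis
      qed
      with True \<open>\<pi> \<langle>$\<rangle> a \<in> set cs\<close> show ?thesis by simp
    next
      case False
      then show ?thesis using \<pi> by (simp add: permutes_not_in)
    qed
    then show "\<pi> \<in> column_group ?\<nu> t" by (simp add: column_group_def)
  qed
qed

lemma ex_first_column:
  fixes cs :: "'n::finite list"
  assumes cs: "distinct cs" "length cs = Suc u"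
  obtains t where "tableau (hook CARD('n) u) t" "map (\<lambda>i. t (i, 0)) [0..<Suc u] = cs"
proof -
  let ?es = "enum (- set cs)"
  let ?t = "\<lambda>(i, j). if j = 0 then cs ! i else ?es ! (j - 1)"
  have "card (set cs) \<le> CARD('n)" by (rule card_mono) auto
  then have u: "u < CARD('n)" using cs by (simp add: distinct_card)
  have len: "length ?es = CARD('n) - Suc u" using cs by (simp add: Compl_eq_Diff_UNIV card_Diff_subset distinct_card)
  have diagram: "(i, j) \<in> diagram (hook CARD('n) u) \<longleftrightarrow> (i = 0 \<and> j < CARD('n) - u) \<or> (1 \<le> i \<and> i \<le> u \<and> j = 0)" for i j
    by (cases i) (auto simp: diagram_def hook_def nth_replicate less_Suc_eq_le Suc_le_eq)
  have "inj_on ?t (diagram (hook CARD('n) u))"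
  proof (rule inj_onI, clarify)
    fix i j i' j'
    assume d: "(i, j) \<in> diagram (hook CARD('n) u)" "(i', j') \<in> diagram (hook CARD('n) u)"
      and eq: "(if j = 0 then cs ! i else ?es ! (j - 1)) = (if j' = 0 then cs ! i' else ?es ! (j' - 1))"
    have in_cs: "cs ! k \<in> set cs" if "k \<le> u" for k using that cs by (intro nth_mem) simp
    have in_es: "?es ! (k - 1) \<notin> set cs" if "k \<noteq> 0" "k < CARD('n) - u" for k
      using nth_mem[of "k - 1" ?es] that len by (simp add: enum)
    have bounds: "i \<le> u" "i' \<le> u" "j < CARD('n) - u" "j' < CARD('n) - u"
      using d u by (auto simp: diagram)
    consider "j = 0" "j' = 0" | "j \<noteq> 0" "j' \<noteq> 0" | "(j = 0) \<noteq> (j' = 0)" by blast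
    then show "i = i' \<and> j = j'"
    proof cases
      case 1
      then show ?thesis using eq bounds cs by (simp add: nth_eq_iff_index_eq)
    next
      case 2
      have "?es ! (j - 1) = ?es ! (j' - 1)" using 2 eq by simp
      moreover have "j - 1 < length ?es" "j' - 1 < length ?es" using 2 bounds unfolding len by linarith+
      ultimately have "j - 1 = j' - 1" using nth_eq_iff_index_eq[OF enum(2)] by metis
      moreover have "i = 0" "i' = 0" using 2 d by (simp_all add: diagram)
      ultimately show ?thesis using 2 by simp
    next
      case 3
      then show ?thesis
      proof (cases "j = 0")
        case True
        then have "cs ! i = ?es ! (j' - 1)" using 3 eq by simp
        then show ?thesis using in_cs[OF bounds(1)] in_es[of j'] 3 True bounds by simp
      next
        case False
        then have "cs ! i' = ?es ! (j - 1)" using 3 eq by simp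
        then show ?thesis using in_cs[OF bounds(2)] in_es[of j] 3 False bounds by simp
      qed
    qed
  qed
  moreover have "a \<in> ?t ` diagram (hook CARD('n) u)" for a
  proof (cases "a \<in> set cs")
    case True
    then obtain i where i: "i < Suc u" "a = cs ! i" using cs by (metis in_set_conv_nth)
    then show ?thesis using u by (intro image_eqI[of _ _ "(i, 0)"]) (auto simp: diagram)
  next
    case False
    then have "a \<in> set ?es" by (simp add: enum)
    then obtain k where "k < length ?es" "a = ?es ! k" by (metis in_set_conv_nth)
    then show ?thesis using len by (intro image_eqI[of _ _ "(0, Suc k)"]) (auto simp: diagram)
  qed
  ultimately have "tableau (hook CARD('n) u) ?t" by (auto simp: tableau_def bij_betw_def)
  moreover have "map (\<lambda>i. ?t (i, 0)) [0..<Suc u] = cs" using cs by (simp add: map_nth del: upt_Suc flip: cs(2))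
  ultimately show thesis by (rule that)
qed

lemma apply_permutes_bij:
  "bij_betw (\<langle>$\<rangle>) {\<pi> :: 'n::finite perm. (\<langle>$\<rangle>) \<pi> permutes S} {p. p permutes S}"
proof (rule bij_betw_imageI)
  show "inj_on (\<langle>$\<rangle>) {\<pi> :: 'n perm. (\<langle>$\<rangle>) \<pi> permutes S}"
    by (rule inj_onI) (auto intro: perm_eqI)
  show "(\<langle>$\<rangle>) ` {\<pi> :: 'n perm. (\<langle>$\<rangle>) \<pi> permutes S} = {p. p permutes S}"
  proof (intro equalityI subsetI)
    fix p :: "'n \<Rightarrow> 'n" assume "p \<in> {p. p permutes S}"
    moreover from this have "(\<langle>$\<rangle>) (Perm p) = p" by (intro Perm_inverse) (auto simp: permutes_bij)
    ultimately show "p \<in> (\<langle>$\<rangle>) ` {\<pi> :: 'n perm. (\<langle>$\<rangle>) \<pi> permutes S}"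
      by (intro image_eqI[of _ _ "Perm p"]) auto
  qed auto
qed

text \<open>
  A polytabloid forgets the entry in the corner of the diagram, and summing over the possible values of that
  entry is the boundary.
\<close>

lemma polytabloid_hook:
  fixes t :: "nat \<times> nat \<Rightarrow> 'n::finite"
  assumes t: "tableau (hook CARD('n) u) t" and u: "u < CARD('n)"
  defines "cs \<equiv> map (\<lambda>i. t (i, 0)) [0..<Suc u]"
  shows "keys (polytabloid (hook CARD('n) u) t :: ('n \<Rightarrow> nat) \<Rightarrow>\<^sub>0 'k::field_char_0) \<subseteq> hook_tabs u"
    "tab_coeff u (polytabloid (hook CARD('n) u) t :: ('n \<Rightarrow> nat) \<Rightarrow>\<^sub>0 'k) = boundary (wedge cs)"
proof -
  let ?P = "polytabloid (hook CARD('n) u) t :: ('n \<Rightarrow> nat) \<Rightarrow>\<^sub>0 'k"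
  note col = first_column[OF t u, folded cs_def]
  have len: "length cs = Suc u" by (simp add: cs_def)
  then obtain c cs' where cs: "cs = c # cs'" by (cases cs) auto
  have dist: "distinct cs'" "length cs' = u" using col(1) len cs by auto
  have "?P = (\<Sum>\<pi> | (\<langle>$\<rangle>) \<pi> permutes set cs.
      single (tab (map ((\<langle>$\<rangle>) \<pi>) cs')) (of_int (sign ((\<langle>$\<rangle>) \<pi>))))"
    by (simp add: polytabloid_def col(2,3) perm_tabloid_tab dist cs)
  also have "\<dots> = (\<Sum>p | p permutes set cs. single (tab (map p cs')) (of_int (sign p)))"
    by (rule sum.reindex_bij_betw[OF apply_permutes_bij])
  finally have P: "?P = (\<Sum>p | p permutes set cs. single (tab (map p cs')) (of_int (sign p)))" .
  have map_dist: "distinct (map p cs')" "length (map p cs') = u" if "p permutes set cs" for p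
    using that dist by (auto simp: distinct_map intro: permutes_inj_on)
  show "keys ?P \<subseteq> hook_tabs u"
  proof
    fix r assume "r \<in> keys ?P"
    then have "r \<in> (\<Union>p\<in>{p. p permutes set cs}. keys (single (tab (map p cs')) (of_int (sign p) :: 'k)))"
      unfolding P by (rule subsetD[OF keys_sum])
    then obtain p where "p permutes set cs" "r = tab (map p cs')" by (auto split: if_splits)
    then show "r \<in> hook_tabs u" using map_dist by (auto simp: hook_tabs_def)
  qed
  have wedge: "(wedge cs :: _ \<Rightarrow> 'k) \<in> alternating (Suc u)" using col(1) len by (rule wedge_alternating)
  show "tab_coeff u ?P = boundary (wedge cs)"
  proof
    fix bs
    show "tab_coeff u ?P bs = boundary (wedge cs) bs"
    proof (cases "distinct bs \<and> length bs = u")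
      case True
      have tab: "tab (map p cs') = tab bs \<longleftrightarrow> map p cs' = bs" if "p permutes set cs" for p
        using tab_inject[OF map_dist(1)[OF that], of bs] True map_dist(2)[OF that] by simp
      have "lookup ?P (tab bs) = (\<Sum>p | p permutes set cs. if map p cs' = bs then of_int (sign p) else 0)"
        unfolding P lookup_sum
        by (rule sum.cong) (simp_all add: lookup_single when_def tab)
      \<comment> \<open>Introduce the value \<open>b\<close> of the permutation at the corner entry \<open>c\<close>.\<close>
      also have "\<dots> = (\<Sum>p | p permutes set cs. \<Sum>b\<in>UNIV. if b = p c then (if map p cs' = bs then of_int (sign p) else 0) else 0)"
        by simp
      also have "\<dots> = (\<Sum>b\<in>UNIV. \<Sum>p | p permutes set cs. if map p cs = b # bs then of_int (sign p) else 0)"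
        by (subst sum.swap) (intro sum.cong refl, auto simp: cs)
      finally show ?thesis using True by (simp add: tab_coeff_def boundary_def wedge_def)
    next
      case False
      then show ?thesis
        using alternating_not_distinct[OF boundary_alternating[OF wedge], of bs]
          alternating_length[OF boundary_alternating[OF wedge], of bs]
        by (auto simp: tab_coeff_def)
    qed
  qed
qed

text \<open>The exterior power of the standard representation inside the permutation module.\<close>

definition hook_space :: "nat \<Rightarrow> (('n::finite \<Rightarrow> nat) \<Rightarrow>\<^sub>0 'k::field) set" where
  "hook_space u = {v. keys v \<subseteq> hook_tabs u \<and> tab_coeff u v \<in> alternating u \<and>
     (\<forall>bs. boundary (tab_coeff u v) bs = 0)}"

lemma tab_coeff_linear:
  "tab_coeff u 0 = (\<lambda>bs. 0)"
  "tab_coeff u (v - w) = (\<lambda>bs. tab_coeff u v bs - tab_coeff u w bs)"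
  "tab_coeff u (v + w) = (\<lambda>bs. tab_coeff u v bs + tab_coeff u w bs)"
  "tab_coeff u (pm_scale a v) = (\<lambda>bs. a * tab_coeff u v bs)"
  by (auto simp: tab_coeff_def lookup_add lookup_minus)

lemma hook_space_subspace: "pm.subspace (hook_space u)"
proof (rule pm.subspaceI)
  show "0 \<in> hook_space u"
    by (auto simp: hook_space_def boundary_def tab_coeff_linear alternating_def)
  show "v + w \<in> hook_space u" if vw: "v \<in> hook_space u" "w \<in> hook_space u" for v w :: "('n::finite \<Rightarrow> nat) \<Rightarrow>\<^sub>0 'k::field"
  proof -
    have "keys (v + w) \<subseteq> hook_tabs u"
      using vw Poly_Mapping.keys_add[of v w] unfolding hook_space_def by blast
    with vw show ?thesis
      by (auto simp: hook_space_def tab_coeff_linear boundary_def sum.distrib intro: alternating_add)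
  qed
  show "pm_scale a v \<in> hook_space u" if v: "v \<in> hook_space u" for a and v :: "('n::finite \<Rightarrow> nat) \<Rightarrow>\<^sub>0 'k::field"
  proof -
    have "keys (pm_scale a v) \<subseteq> hook_tabs u" using v by (auto simp: hook_space_def in_keys_iff)
    with v show ?thesis
      by (auto simp: hook_space_def tab_coeff_linear boundary_def intro: alternating_scale simp flip: sum_distrib_left)
  qed
qed

lemma hook_space_perm:
  assumes "v \<in> hook_space u"
  shows "perm_module \<sigma> v \<in> hook_space u"
proof -
  have "tab_coeff u (perm_module \<sigma> v) = (\<lambda>bs. tab_coeff u v (map ((\<langle>$\<rangle>) (inverse \<sigma>)) bs))"
    by (rule ext) (rule tab_coeff_perm)
  moreover have "keys (perm_module \<sigma> v) \<subseteq> hook_tabs u"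
  proof
    fix r assume "r \<in> keys (perm_module \<sigma> v)"
    then have "perm_tabloid (inverse \<sigma>) r \<in> hook_tabs u"
      using assms by (auto simp: hook_space_def in_keys_iff lookup_perm_module)
    then obtain bs where bs: "distinct bs" "length bs = u" "perm_tabloid (inverse \<sigma>) r = tab bs"
      by (auto simp: hook_tabs_def)
    then have "r = tab (map ((\<langle>$\<rangle>) \<sigma>) bs)"
      using perm_tabloid_inverse[of \<sigma> "tab bs" r] by (simp add: perm_tabloid_tab)
    with bs show "r \<in> hook_tabs u" by (auto simp: hook_tabs_def)
  qed
  ultimately show ?thesis
    using assms by (auto simp: hook_space_def boundary_act intro: alternating_act)
qed

lemma hook_space_eq_0:
  fixes v :: "('n::finite \<Rightarrow> nat) \<Rightarrow>\<^sub>0 'k::field_char_0"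
  assumes v: "v \<in> hook_space u" and X: "\<And>X. card X = u \<Longrightarrow> i0 \<notin> X \<Longrightarrow> tab_coeff u v (enum X) = 0"
  shows "v = 0"
proof (rule poly_mapping_eqI)
  fix r
  have 0: "tab_coeff u v bs = 0" for bs
    by (rule cycle_eq_0[of _ u i0]) (use v X in \<open>auto simp: hook_space_def\<close>)
  show "lookup v r = lookup 0 r"
  proof (cases "r \<in> hook_tabs u")
    case True
    then obtain bs where "distinct bs" "length bs = u" "r = tab bs" by (auto simp: hook_tabs_def)
    then show ?thesis using 0[of bs] by (simp add: tab_coeff_def)
  next
    case False
    then show ?thesis using v by (auto simp: hook_space_def in_keys_iff)
  qed
qed

text \<open>
  The basis behind \<open>hook_trace\<close> consists of polytabloids, those with \<open>i0\<close> in the corner and a chosen order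
  of \<open>X\<close> below it.
\<close>

lemma specht_hook_basis:
  fixes i0 :: "'n::finite"
  assumes u: "u < CARD('n)"
  obtains b :: "'n set \<Rightarrow> (('n \<Rightarrow> nat) \<Rightarrow>\<^sub>0 'k::field_char_0)"
  where "\<And>X. card X = u \<Longrightarrow> i0 \<notin> X \<Longrightarrow> b X \<in> polytabloid (hook CARD('n) u) ` {t. tableau (hook CARD('n) u) t}"
    "\<And>X. card X = u \<Longrightarrow> i0 \<notin> X \<Longrightarrow> tab_coeff u (b X) = boundary (wedge (i0 # enum X))"
proof -
  have "\<exists>b. b \<in> polytabloid (hook CARD('n) u) ` {t. tableau (hook CARD('n) u) t} \<and>
      tab_coeff u b = (boundary (wedge (i0 # enum X)) :: _ \<Rightarrow> 'k)" if X: "card X = u" "i0 \<notin> X" for X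
  proof -
    have "distinct (i0 # enum X)" "length (i0 # enum X) = Suc u" using X by (simp_all add: enum)
    then obtain t where t: "tableau (hook CARD('n) u) t" "map (\<lambda>i. t (i, 0)) [0..<Suc u] = i0 # enum X"
      by (rule ex_first_column)
    from polytabloid_hook(2)[OF t(1) u] t show ?thesis
      by (intro exI[of _ "polytabloid (hook CARD('n) u) t"]) auto
  qed
  then show thesis using that by metis
qed

text \<open>
  Polytabloids of hook shape are boundaries, hence annihilated by the boundary.  Conversely, a function
  annihilated by it is determined by its values at the sets without \<open>i0\<close>, and some polytabloids are dual to
  these values.
\<close>

lemma specht_hook_space:
  assumes u: "u < CARD('n::finite)"
  shows "rspace (specht (hook CARD('n) u) :: ('k::field_char_0, 'n perm, _) rep) = hook_space u"
proof -
  let ?T = "polytabloid (hook CARD('n) u) ` {t :: nat \<times> nat \<Rightarrow> 'n. tableau (hook CARD('n) u) t} :: (('n \<Rightarrow> nat) \<Rightarrow>\<^sub>0 'k) set"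
  have "pm.span ?T = hook_space u"
  proof
    have "?T \<subseteq> hook_space u"
    proof clarify
      fix t :: "nat \<times> nat \<Rightarrow> 'n" assume t: "tableau (hook CARD('n) u) t"
      have w: "wedge (map (\<lambda>i. t (i, 0)) [0..<Suc u]) \<in> (alternating (Suc u) :: ('n list \<Rightarrow> 'k) set)"
        by (rule wedge_alternating[OF first_column(1)[OF t u]]) simp
      show "polytabloid (hook CARD('n) u) t \<in> (hook_space u :: (('n \<Rightarrow> nat) \<Rightarrow>\<^sub>0 'k) set)"
        unfolding hook_space_def mem_Collect_eq polytabloid_hook(2)[OF t u]
        using polytabloid_hook(1)[OF t u] boundary_alternating[OF w] boundary_boundary[OF w] by blast
    qed
    then show "pm.span ?T \<subseteq> hook_space u" by (rule pm.span_minimal[OF _ hook_space_subspace])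
    obtain i0 :: 'n where True by simp
    obtain b :: "'n set \<Rightarrow> (('n \<Rightarrow> nat) \<Rightarrow>\<^sub>0 'k)"
      where b: "\<And>X. card X = u \<Longrightarrow> i0 \<notin> X \<Longrightarrow> b X \<in> ?T"
        "\<And>X. card X = u \<Longrightarrow> i0 \<notin> X \<Longrightarrow> tab_coeff u (b X) = boundary (wedge (i0 # enum X))"
      using specht_hook_basis[OF u, of i0] by blast
    show "hook_space u \<subseteq> pm.span ?T"
    proof
      fix v :: "('n \<Rightarrow> nat) \<Rightarrow>\<^sub>0 'k" assume v: "v \<in> hook_space u"
      let ?s = "\<Sum>X | card X = u \<and> i0 \<notin> X. pm_scale (tab_coeff u v (enum X)) (b X)"
      have s: "?s \<in> pm.span ?T" using b(1) by (intro pm.span_sum pm.span_scale pm.span_base) auto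
      have "v - ?s = 0"
      proof (rule hook_space_eq_0[of _ u i0])
        show "v - ?s \<in> hook_space u"
          using v s \<open>pm.span ?T \<subseteq> hook_space u\<close> by (intro pm.subspace_diff hook_space_subspace) auto
        fix X assume X: "card X = u" "i0 \<notin> X"
        have lin: "tab_coeff u (\<Sum>Y\<in>A. pm_scale (c Y) (b Y)) bs = (\<Sum>Y\<in>A. c Y * tab_coeff u (b Y) bs)" for A bs c
          by (induction A rule: infinite_finite_induct) (simp_all add: tab_coeff_linear)
        have "tab_coeff u ?s (enum X) = (\<Sum>Y | card Y = u \<and> i0 \<notin> Y. if Y = X then tab_coeff u v (enum Y) else 0)"
          unfolding lin by (rule sum.cong) (use X in \<open>auto simp: b(2) boundary_wedge_basis\<close>)
        also have "\<dots> = tab_coeff u v (enum X)" using X by simp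
        finally show "tab_coeff u (v - ?s) (enum X) = 0" by (simp only: tab_coeff_linear diff_self)
      qed
      with s show "v \<in> pm.span ?T" by simp
    qed
  qed
  then show ?thesis by (simp add: specht_def)
qed

lemma perm_module_add: "perm_module \<sigma> (v + w) = perm_module \<sigma> v + perm_module \<sigma> w"
  by (rule poly_mapping_eqI) (simp add: lookup_add lookup_perm_module)

lemma perm_module_scale: "perm_module \<sigma> (pm_scale a v) = pm_scale a (perm_module \<sigma> v)"
  by (rule poly_mapping_eqI) (simp add: lookup_perm_module)

lemma character_specht_hook:
  fixes i0 :: "'n::finite" and \<sigma> :: "'n perm"
  assumes u: "u < CARD('n)"
  shows "character (specht (hook CARD('n) u)) \<sigma> = (hook_trace i0 \<sigma> u :: 'k::field_char_0)"
proof -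
  let ?V = "specht (hook CARD('n) u) :: ('k, 'n perm, _) rep"
  let ?J = "{X. card X = u \<and> i0 \<notin> X}"
  let ?\<kappa> = "\<lambda>v X. if X \<in> ?J then tab_coeff u v (enum X) else (0 :: 'k)"
  note V = specht_hook_space[OF u, where 'k = 'k]
  have ops: "radd ?V = (+)" "rscale ?V = pm_scale" "ract ?V = perm_module" by (simp_all add: specht_def)
  obtain b :: "'n set \<Rightarrow> (('n \<Rightarrow> nat) \<Rightarrow>\<^sub>0 'k)"
    where b: "\<And>X. card X = u \<Longrightarrow> i0 \<notin> X \<Longrightarrow> b X \<in> polytabloid (hook CARD('n) u) ` {t. tableau (hook CARD('n) u) t}"
      "\<And>X. card X = u \<Longrightarrow> i0 \<notin> X \<Longrightarrow> tab_coeff u (b X) = boundary (wedge (i0 # enum X))"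
    using specht_hook_basis[OF u, of i0] by blast
  have lin: "linear_action ?V \<sigma>"
    unfolding linear_action_def V ops
    by (simp add: hook_space_perm perm_module_add perm_module_scale
        pm.subspace_add[OF hook_space_subspace] pm.subspace_scale[OF hook_space_subspace])
  have basis: "b X \<in> rspace ?V \<and> ?\<kappa> (b X) = unit_fun X" if "X \<in> ?J" for X
  proof
    show "b X \<in> rspace ?V" using b(1)[of X] that by (auto simp: specht_def intro: pm.span_base)
    show "?\<kappa> (b X) = unit_fun X" by (rule ext) (use that in \<open>simp add: b(2) boundary_wedge_basis\<close>)
  qed
  have "coords ?V ?J ?\<kappa>"
  proof (rule coordsI[OF _ _ lin, where b = b])
    show "0 \<in> rspace ?V" unfolding V by (rule pm.subspace_0[OF hook_space_subspace])
    fix v w assume vw: "v \<in> rspace ?V" "w \<in> rspace ?V" "\<forall>X\<in>?J. ?\<kappa> v X = ?\<kappa> w X"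
    have "v - w = 0"
    proof (rule hook_space_eq_0[of _ u i0])
      show "v - w \<in> hook_space u" using vw unfolding V by (intro pm.subspace_diff[OF hook_space_subspace])
      fix X assume "card X = u" "i0 \<notin> X"
      with vw(3) show "tab_coeff u (v - w) (enum X) = 0" by (auto simp: tab_coeff_def lookup_minus)
    qed
    then show "v = w" by simp
  qed (use basis in \<open>auto simp: ops tab_coeff_linear\<close>)
  from character_eq[OF lin this basis] have "character ?V \<sigma> = (\<Sum>X\<in>?J. ?\<kappa> (ract ?V \<sigma> (b X)) X)" .
  also have "\<dots> = hook_trace i0 \<sigma> u"
    unfolding hook_trace_def by (rule sum.cong) (simp_all add: ops tab_coeff_perm b(2))
  finally show ?thesis .
qed

section \<open>Invariant subsets and invariant exponents\<close>

definition stable_subsets :: "'a set \<Rightarrow> ('a \<Rightarrow> 'a) \<Rightarrow> 'a set set" where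
  "stable_subsets I p = {X. X \<subseteq> I \<and> p ` X = X}"

definition invariant_exponents :: "'a set \<Rightarrow> ('a \<Rightarrow> 'a) \<Rightarrow> nat \<Rightarrow> ('a \<Rightarrow> nat) set" where
  "invariant_exponents I p e = {\<alpha>. (\<forall>x. x \<notin> I \<longrightarrow> \<alpha> x = 0) \<and> (\<forall>x. \<alpha> (p x) = \<alpha> x) \<and> sum \<alpha> I = e}"

text \<open>
  The alternating sum of the characters of the exterior powers of a permutation representation: a
  basis vector of an exterior power meets the diagonal only if its set is stable, with the sign of the
  permutation on it.
\<close>

definition exterior_series :: "'a set \<Rightarrow> ('a \<Rightarrow> 'a) \<Rightarrow> 'k::field fps" where
  "exterior_series I p =
    (\<Sum>X\<in>stable_subsets I p. fps_const ((- 1) ^ card X * of_int (sign_on X p)) * fps_X ^ card X)"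

text \<open>
  The character of the polynomial ring: monomials are permuted, and the trace counts the fixed ones.
\<close>

definition symmetric_series :: "'a set \<Rightarrow> ('a \<Rightarrow> 'a) \<Rightarrow> 'k::field fps" where
  "symmetric_series I p = Abs_fps (\<lambda>e. of_nat (card (invariant_exponents I p e)))"

lemma cycle_reaches:
  assumes "distinct cs" "x \<in> set cs" "y \<in> set cs"
  shows "\<exists>n. (cycle_of_list cs ^^ n) x = y"
proof -
  obtain i j where ij: "i < length cs" "x = cs ! i" "j < length cs" "y = cs ! j"
    using assms by (metis in_set_conv_nth)
  let ?n = "j + length cs - i"
  have "(cycle_of_list cs ^^ ?n) x = rotate ?n cs ! i"
    using cyclic_rotation[OF assms(1), of ?n] ij by (metis nth_map)
  also have "\<dots> = cs ! ((?n + i) mod length cs)" using ij by (subst nth_rotate) (auto simp: add.commute)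
  also have "(?n + i) mod length cs = j" using ij by simp
  finally show ?thesis using ij by blast
qed

lemma sign_cycle:
  "distinct cs \<Longrightarrow> cs \<noteq> [] \<Longrightarrow> sign (cycle_of_list cs) = (- 1) ^ (length cs - 1)"
proof (induction cs rule: cycle_of_list.induct)
  case (1 i j cs)
  have "sign (cycle_of_list (i # j # cs)) = sign (Transposition.transpose i j) * sign (cycle_of_list (j # cs))"
    unfolding cycle_of_list.simps by (rule sign_compose[OF permutation_swap_id permutation_of_cycle])
  with 1 show ?case by (simp add: sign_swap_id del: cycle_of_list.simps)
qed auto

lemma finite_invariant_exponents: "finite I \<Longrightarrow> finite (invariant_exponents I p e)"
proof (rule finite_subset)
  assume "finite I"
  then show "finite {\<alpha>. (\<forall>x. (x \<in> I \<longrightarrow> \<alpha> x \<in> {..e}) \<and> (x \<notin> I \<longrightarrow> \<alpha> x = 0))}"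
    by (intro finite_set_of_finite_funs) auto
  show "invariant_exponents I p e \<subseteq> {\<alpha>. (\<forall>x. (x \<in> I \<longrightarrow> \<alpha> x \<in> {..e}) \<and> (x \<notin> I \<longrightarrow> \<alpha> x = 0))}"
    using \<open>finite I\<close> by (auto simp: invariant_exponents_def intro: member_le_sum)
qed

context
  fixes I :: "'a set" and p q :: "'a \<Rightarrow> 'a" and cs :: "'a list"
  assumes p: "p permutes I" and I: "finite I" and cs: "distinct cs" "cs \<noteq> []" "set cs \<inter> I = {}"
    and q: "q = cycle_of_list cs \<circ> p"
begin

private abbreviation "c \<equiv> cycle_of_list cs"

private lemma c_permutes: "c permutes set cs"
  by (rule cycle_permutes)

private lemma comp_values:
  "x \<in> set cs \<Longrightarrow> q x = c x" "x \<in> I \<Longrightarrow> q x = p x" "x \<notin> set cs \<union> I \<Longrightarrow> q x = x"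
proof -
  show "q x = c x" if "x \<in> set cs" unfolding q using that cs(3) p by (auto simp: permutes_not_in disjoint_iff)
  show "q x = p x" if "x \<in> I"
  proof -
    have "p x \<notin> set cs" using that cs(3) permutes_in_image[OF p, of x] by blast
    then show ?thesis unfolding q using c_permutes by (simp add: permutes_not_in)
  qed
  show "q x = x" if "x \<notin> set cs \<union> I" unfolding q using that p c_permutes by (simp add: permutes_not_in)
qed

private lemma funpow_closed: "(\<And>x. x \<in> Y \<Longrightarrow> c x \<in> Y) \<Longrightarrow> x \<in> Y \<Longrightarrow> (c ^^ n) x \<in> Y"
  by (induction n) auto

text \<open>A stable set contains all of a cycle or none of it.\<close>

lemma stable_subsets_cycle:
  "stable_subsets (set cs \<union> I) q = stable_subsets I p \<union> (\<union>) (set cs) ` stable_subsets I p"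
proof (intro equalityI subsetI)
  fix X assume X: "X \<in> stable_subsets (set cs \<union> I) q"
  have closed: "q x \<in> X" if "x \<in> X" for x using X that by (auto simp: stable_subsets_def)
  have "p x \<in> X \<inter> I" if "x \<in> X \<inter> I" for x
    using closed[of x] that p comp_values(2)[of x] by (auto simp: permutes_in_image)
  then have "p ` (X \<inter> I) = X \<inter> I"
    by (intro endo_inj_surj) (use I p in \<open>auto intro: permutes_inj_on\<close>)
  then have stable: "X \<inter> I \<in> stable_subsets I p" by (simp add: stable_subsets_def)
  have c_closed: "c x \<in> X \<inter> set cs" if "x \<in> X \<inter> set cs" for x
    using closed[of x] that comp_values(1)[of x] c_permutes by (auto simp: permutes_in_image)
  show "X \<in> stable_subsets I p \<union> (\<union>) (set cs) ` stable_subsets I p"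
  proof (cases "X \<inter> set cs = {}")
    case True
    then have "X \<inter> I = X" using X by (auto simp: stable_subsets_def)
    with stable show ?thesis by simp
  next
    case False
    then obtain x where x: "x \<in> X \<inter> set cs" by blast
    have "y \<in> X" if "y \<in> set cs" for y
      using cycle_reaches[OF cs(1), of x y] funpow_closed[of "X \<inter> set cs", OF c_closed x] x that by auto
    then have "X = set cs \<union> (X \<inter> I)" using X by (auto simp: stable_subsets_def)
    with stable show ?thesis by blast
  qed
next
  fix X assume "X \<in> stable_subsets I p \<union> (\<union>) (set cs) ` stable_subsets I p"
  then obtain Y where Y: "Y \<subseteq> I" "p ` Y = Y" "X = Y \<or> X = set cs \<union> Y" by (auto simp: stable_subsets_def)
  have "q ` Y = p ` Y" using Y(1) comp_values(2) by (intro image_cong) auto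
  moreover have "q ` set cs = c ` set cs" using comp_values(1) by (intro image_cong) auto
  moreover have "c ` set cs = set cs" using c_permutes by (rule permutes_image)
  ultimately show "X \<in> stable_subsets (set cs \<union> I) q"
    using Y by (auto simp: stable_subsets_def image_Un)
qed

text \<open>
  Adding a cycle of length \<open>l\<close> to a stable set multiplies its term by \<open>(-1)\<^sup>l (-1)\<^bsup>l-1\<^esup> t\<^sup>l = - t\<^sup>l\<close>.
\<close>

lemma exterior_series_cycle:
  "exterior_series (set cs \<union> I) q = (1 - fps_X ^ length cs) * (exterior_series I p :: 'k::field fps)"
proof -
  let ?S = "stable_subsets I p"
  let ?t = "\<lambda>q X. fps_const ((- 1) ^ card X * of_int (sign_on X q)) * fps_X ^ card X :: 'k fps"
  have fin: "finite ?S" using I by (auto simp: stable_subsets_def)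
  have sub: "X \<subseteq> I" if "X \<in> ?S" for X using that by (auto simp: stable_subsets_def)
  have finX: "finite X" if "X \<in> ?S" for X using sub[OF that] I finite_subset by blast
  have inj: "inj_on ((\<union>) (set cs)) ?S"
  proof (rule inj_onI)
    fix X Y assume "X \<in> ?S" "Y \<in> ?S" "set cs \<union> X = set cs \<union> Y"
    with sub[of X] sub[of Y] cs(3) show "X = Y" by blast
  qed
  have disj: "?S \<inter> (\<union>) (set cs) ` ?S = {}"
  proof -
    have "set cs \<union> Y \<notin> ?S" for Y using sub[of "set cs \<union> Y"] cs(2,3) by (cases cs) auto
    then show ?thesis by blast
  qed
  have small: "sign_on X q = sign_on X p" if "X \<in> ?S" for X
    using sub[OF that] comp_values(2) by (intro sign_on_cong refl) auto
  have big: "?t q (set cs \<union> X) = - (fps_X ^ length cs * ?t p X)" if X: "X \<in> ?S" for X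
  proof -
    have permX: "restrict_id p X permutes X"
      using X p by (intro permutes_restrict_id) (auto simp: stable_subsets_def bij_betw_def intro: permutes_inj_on)
    have "restrict_id q (set cs \<union> X) = c \<circ> restrict_id p X"
    proof
      fix x
      consider "x \<in> set cs" | "x \<in> X" | "x \<notin> set cs" "x \<notin> X" by blast
      then show "restrict_id q (set cs \<union> X) x = (c \<circ> restrict_id p X) x"
      proof cases
        case 1
        then have "x \<notin> X" using sub[OF X] cs(3) by blast
        with 1 show ?thesis using comp_values(1)[OF 1] by (simp add: restrict_id_def)
      next
        case 2
        then show ?thesis by (simp add: restrict_id_def q)
      next
        case 3
        then show ?thesis using c_permutes by (simp add: restrict_id_def permutes_not_in)
      qed
    qed
    then have "sign_on (set cs \<union> X) q = sign c * sign_on X p"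
      unfolding sign_on_def
      using permutes_imp_permutation[OF finX[OF X] permX] by (simp add: sign_compose permutation_of_cycle)
    also have "sign c = (- 1) ^ (length cs - 1)" using cs by (intro sign_cycle)
    finally have sign: "sign_on (set cs \<union> X) q = (- 1) ^ (length cs - 1) * sign_on X p" .
    have card: "card (set cs \<union> X) = length cs + card X"
      using sub[OF X] cs finX[OF X] by (subst card_Un_disjoint) (auto simp: distinct_card)
    obtain l where l: "length cs = Suc l" using cs(2) by (cases cs) auto
    show ?thesis by (simp add: card sign l power_add mult_ac flip: power_mult_distrib fps_const_neg)
  qed
  have "exterior_series (set cs \<union> I) q = (\<Sum>X\<in>?S. ?t q X) + (\<Sum>X\<in>(\<union>) (set cs) ` ?S. ?t q X)"
    unfolding exterior_series_def stable_subsets_cycle using fin disj by (intro sum.union_disjoint) auto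
  also have "(\<Sum>X\<in>(\<union>) (set cs) ` ?S. ?t q X) = (\<Sum>X\<in>?S. - (fps_X ^ length cs * ?t p X))"
    unfolding sum.reindex[OF inj] o_def[of "?t q"] by (rule sum.cong[OF refl big])
  also have "\<dots> = - (fps_X ^ length cs * exterior_series I p)"
    unfolding exterior_series_def sum_negf sum_distrib_left ..
  also have "(\<Sum>X\<in>?S. ?t q X) = exterior_series I p"
    unfolding exterior_series_def by (rule sum.cong) (simp_all add: small)
  finally show ?thesis unfolding left_diff_distrib by (simp only: mult_1_left diff_conv_add_uminus)
qed

text \<open>
  An invariant exponent is constant on a cycle.  Either this constant is zero, or one can be subtracted
  everywhere on the cycle.
\<close>

lemma invariant_exponents_cycle:
  fixes e :: nat
  defines "add \<equiv> \<lambda>\<alpha> x. \<alpha> x + (if x \<in> set cs then 1 else 0 :: nat)"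
  shows "invariant_exponents (set cs \<union> I) q e = invariant_exponents I p e \<union>
      (if length cs \<le> e then add ` invariant_exponents (set cs \<union> I) q (e - length cs) else {})"
    (is "?E e = _ \<union> ?B")
proof -
  have sum_cs: "sum \<alpha> (set cs \<union> I) = sum \<alpha> (set cs) + sum \<alpha> I" for \<alpha> :: "'a \<Rightarrow> nat"
    using I cs(3) by (intro sum.union_disjoint) auto
  have card_cs: "card (set cs) = length cs" using cs(1) by (rule distinct_card)
  have in_cs: "q x \<in> set cs \<longleftrightarrow> x \<in> set cs" for x
  proof (cases "x \<in> I")
    case True
    then have "p x \<in> I" using p by (simp add: permutes_in_image)
    then show ?thesis using True comp_values(2)[OF True] cs(3) by auto
  next
    case False
    then show ?thesis
      using comp_values(1)[of x] comp_values(3)[of x] permutes_in_image[OF c_permutes, of x]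
      by (cases "x \<in> set cs") auto
  qed
  show ?thesis
  proof (intro equalityI subsetI)
    fix \<alpha> assume \<alpha>: "\<alpha> \<in> ?E e"
    have inv: "\<alpha> (q x) = \<alpha> x" for x using \<alpha> by (simp add: invariant_exponents_def)
    have const: "\<alpha> x = \<alpha> y" if xy: "x \<in> set cs" "y \<in> set cs" for x y
    proof -
      obtain n where n: "(c ^^ n) x = y" using cycle_reaches[OF cs(1) xy] by blast
      have "(c ^^ n) x \<in> {z \<in> set cs. \<alpha> z = \<alpha> x}"
      proof (rule funpow_closed)
        fix z assume "z \<in> {z \<in> set cs. \<alpha> z = \<alpha> x}"
        then show "c z \<in> {z \<in> set cs. \<alpha> z = \<alpha> x}"
          using inv[of z] comp_values(1)[of z] c_permutes by (auto simp: permutes_in_image)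
      qed (use xy in auto)
      then show ?thesis using n by simp
    qed
    show "\<alpha> \<in> invariant_exponents I p e \<union> ?B"
    proof (cases "\<forall>x\<in>set cs. \<alpha> x = 0")
      case True
      then have "sum \<alpha> (set cs) = 0" by simp
      moreover have "\<alpha> (p x) = \<alpha> x" for x
        using inv[of x] comp_values(2)[of x] p by (cases "x \<in> I") (auto simp: permutes_not_in)
      ultimately show ?thesis using \<alpha> True sum_cs[of \<alpha>] by (auto simp: invariant_exponents_def)
    next
      case False
      let ?\<beta> = "\<lambda>x. \<alpha> x - (if x \<in> set cs then 1 else 0)"
      have pos: "\<alpha> x \<ge> 1" if "x \<in> set cs" for x using False const that by (metis less_one not_le)
      have add: "\<alpha> = add ?\<beta>" using pos by (auto simp: add_def fun_eq_iff)
      have "e = sum (add ?\<beta>) (set cs \<union> I)"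
        using \<alpha> unfolding add[symmetric] by (simp only: invariant_exponents_def mem_Collect_eq)
      also have "\<dots> = sum ?\<beta> (set cs \<union> I) + sum (\<lambda>x. if x \<in> set cs then 1 else 0) (set cs \<union> I)"
        unfolding add_def by (rule sum.distrib)
      also have "sum (\<lambda>x. if x \<in> set cs then 1 else 0 :: nat) (set cs \<union> I) = length cs"
        using cs(3) by (subst sum_cs) (auto simp: card_cs disjoint_iff intro!: sum.neutral)
      finally have e: "e = sum ?\<beta> (set cs \<union> I) + length cs" .
      have "?\<beta> \<in> ?E (e - length cs)"
        using \<alpha> e inv in_cs unfolding invariant_exponents_def by auto
      then have "add ?\<beta> \<in> ?B" using e by auto
      then show ?thesis unfolding add[symmetric] by blast
    qed
  next
    fix \<alpha> assume "\<alpha> \<in> invariant_exponents I p e \<union> ?B"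
    then consider "\<alpha> \<in> invariant_exponents I p e"
      | \<beta> where "length cs \<le> e" "\<beta> \<in> ?E (e - length cs)" "\<alpha> = add \<beta>"
      by (cases "length cs \<le> e") (simp_all only: if_True if_False Un_iff image_iff empty_iff, blast+)
    then show "\<alpha> \<in> ?E e"
    proof cases
      case 1
      then have z: "\<alpha> x = 0" if "x \<notin> I" for x using that by (auto simp: invariant_exponents_def)
      have "sum \<alpha> (set cs) = 0" using z cs(3) by (auto simp: disjoint_iff)
      moreover have "\<alpha> (q x) = \<alpha> x" for x
      proof (cases "x \<in> set cs")
        case True
        then show ?thesis using in_cs[of x] z cs(3) by (metis disjoint_iff)
      next
        case False
        have "\<alpha> (p x) = \<alpha> x" using 1 by (simp add: invariant_exponents_def)
        with False show ?thesis using comp_values(2,3)[of x] by (cases "x \<in> I") auto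
      qed
      ultimately show ?thesis using 1 sum_cs[of \<alpha>] by (auto simp: invariant_exponents_def)
    next
      case 2
      have "sum (\<lambda>x. if x \<in> set cs then 1 else 0 :: nat) (set cs \<union> I) = length cs"
        using cs(3) by (subst sum_cs) (auto simp: card_cs disjoint_iff intro!: sum.neutral)
      then have "sum \<alpha> (set cs \<union> I) = e"
        using 2 by (simp add: add_def sum.distrib invariant_exponents_def)
      moreover have "\<alpha> (q x) = \<alpha> x" for x
        using 2 in_cs[of x] unfolding add_def invariant_exponents_def by auto
      moreover have "\<alpha> x = 0" if "x \<notin> set cs \<union> I" for x
        using that 2 by (simp add: add_def invariant_exponents_def)
      ultimately show ?thesis unfolding invariant_exponents_def by blast
    qed
  qed
qed

lemma symmetric_series_cycle:
  "(1 - fps_X ^ length cs) * symmetric_series (set cs \<union> I) q = (symmetric_series I p :: 'k::field fps)"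
proof (rule fps_ext)
  fix e
  let ?E = "invariant_exponents (set cs \<union> I) q"
  let ?add = "\<lambda>\<alpha> x. \<alpha> x + (if x \<in> set cs then 1 else 0 :: nat)"
  let ?B = "if length cs \<le> e then ?add ` ?E (e - length cs) else {}"
  have fin: "finite (invariant_exponents I p e)" "finite ?B"
    using I by (auto intro: finite_invariant_exponents)
  have "\<alpha> \<notin> ?B" if "\<alpha> \<in> invariant_exponents I p e" for \<alpha>
  proof
    assume "\<alpha> \<in> ?B"
    moreover obtain x where "x \<in> set cs" using cs(2) by (cases cs) auto
    ultimately have "\<alpha> x \<noteq> 0" "x \<notin> I" using cs(3) by (auto split: if_splits)
    with that show False by (auto simp: invariant_exponents_def)
  qed
  then have "invariant_exponents I p e \<inter> ?B = {}" by blast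
  with fin have "card (?E e) = card (invariant_exponents I p e) + card ?B"
    unfolding invariant_exponents_cycle[of e] by (rule card_Un_disjoint)
  also have "card ?B = (if length cs \<le> e then card (?E (e - length cs)) else 0)"
    by (auto intro!: card_image inj_onI simp: fun_eq_iff)
  finally show "fps_nth ((1 - fps_X ^ length cs) * symmetric_series (set cs \<union> I) q) e =
      fps_nth (symmetric_series I p :: 'k fps) e"
    by (simp add: symmetric_series_def left_diff_distrib fps_X_power_mult_nth)
qed

end

text \<open>
  Each cycle of length \<open>l\<close> contributes \<open>1 - t\<^sup>l\<close> to the exterior and its inverse to the symmetric
  series, so induction over a cycle decomposition applies.
\<close>

lemma exterior_symmetric_series:
  assumes "p permutes I" "finite I"
  shows "exterior_series I p * symmetric_series I p = (1 :: 'k::field fps)"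
proof -
  have "q permutes I' \<and> finite I' \<and> exterior_series I' q * symmetric_series I' q = (1 :: 'k fps)"
    if "cycle_decomp I' q" for I' :: "'a set" and q
    using that
  proof (induction rule: cycle_decomp.induct)
    case empty
    have "stable_subsets {} id = {{} :: 'a set}" by (auto simp: stable_subsets_def)
    moreover have "symmetric_series {} (id :: 'a \<Rightarrow> 'a) = (1 :: 'k fps)"
    proof (rule fps_ext)
      fix e :: nat
      have "invariant_exponents {} (id :: 'a \<Rightarrow> 'a) e = (if e = 0 then {\<lambda>_. 0} else {})"
        by (auto simp: invariant_exponents_def)
      then show "fps_nth (symmetric_series {} (id :: 'a \<Rightarrow> 'a)) e = fps_nth (1 :: 'k fps) e"
        by (simp add: symmetric_series_def)
    qed
    moreover have "exterior_series {} (id :: 'a \<Rightarrow> 'a) = (1 :: 'k fps)"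
      unfolding exterior_series_def \<open>stable_subsets {} id = {{}}\<close> by simp
    ultimately show ?case by (simp only: permutes_id finite.emptyI mult_1_left simp_thms)
  next
    case (comp J q cs)
    then have q: "q permutes J" "finite J" "exterior_series J q * symmetric_series J q = (1 :: 'k fps)"
      and cs: "distinct cs" "set cs \<inter> J = {}" by auto
    have perm: "(cycle_of_list cs \<circ> q) permutes (set cs \<union> J)"
      using q(1) cycle_permutes[of cs] by (intro permutes_compose) (auto intro: permutes_subset)
    show ?case
    proof (cases "cs = []")
      case True
      with q show ?thesis by simp
    next
      case False
      note ext = exterior_series_cycle[OF q(1,2) cs(1) False cs(2) refl, where 'k = 'k]
      note sym = symmetric_series_cycle[OF q(1,2) cs(1) False cs(2) refl, where 'k = 'k]
      have "exterior_series (set cs \<union> J) (cycle_of_list cs \<circ> q) * symmetric_series (set cs \<union> J) (cycle_of_list cs \<circ> q) =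
          exterior_series J q * ((1 - fps_X ^ length cs) * symmetric_series (set cs \<union> J) (cycle_of_list cs \<circ> q) :: 'k fps)"
        unfolding ext by (simp only: mult_ac)
      also have "\<dots> = 1" unfolding sym by (rule q(3))
      finally show ?thesis using perm q(2) by (intro conjI) (assumption | simp only: finite_Un finite_set simp_thms)+
    qed
  qed
  then show ?thesis using cycle_decomposition[OF assms] by blast
qed

lemma wedge_enum_perm:
  fixes p :: "'n::finite \<Rightarrow> 'n"
  assumes p: "p permutes UNIV"
  shows "wedge (enum X) (map p (enum X)) = (if p ` X = X then of_int (sign_on X p) else (0 :: 'k::field))"
proof (cases "p ` X = X")
  case True
  then have perm: "restrict_id p X permutes set (enum X)"
    using p unfolding enum by (intro permutes_restrict_id) (auto simp: bij_betw_def intro: permutes_inj_on)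
  have eq: "map p (enum X) = map (restrict_id p X) (enum X)"
    by (rule map_cong) (simp_all add: enum restrict_id_def)
  have "wedge (enum X) (map p (enum X)) = (of_int (sign (restrict_id p X)) :: 'k)"
    unfolding eq by (rule wedge_map[OF perm])
  then show ?thesis using True by (simp add: sign_on_def)
next
  case False
  then show ?thesis by (simp add: wedge_set enum)
qed

text \<open>
  The telescoped form of \<open>hook_trace_step\<close>.  In degree \<open>n\<close> it needs that the top trace is
  zero.
\<close>

lemma hook_series:
  fixes i0 :: "'n::finite" and \<sigma> :: "'n perm"
  shows "(1 - fps_X) * (\<Sum>u<CARD('n). fps_const ((- 1) ^ u * hook_trace i0 \<sigma> u) * fps_X ^ u) =
    (exterior_series UNIV ((\<langle>$\<rangle>) (inverse \<sigma>)) :: 'k::field_char_0 fps)"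
proof (rule fps_ext)
  fix k
  let ?n = "CARD('n)" and ?p = "(\<langle>$\<rangle>) (inverse \<sigma>)"
  define H where "H = (\<Sum>u<?n. fps_const ((- 1) ^ u * hook_trace i0 \<sigma> u) * fps_X ^ u :: 'k fps)"
  define w where "w X = (wedge (enum X) (map ?p (enum X)) :: 'k)" for X
  have p: "?p permutes UNIV" by (rule bij_imp_permutes) simp_all
  have H: "fps_nth H u = (if u < ?n then (- 1) ^ u * hook_trace i0 \<sigma> u else 0)" for u
    by (simp add: H_def fps_sum_nth if_distrib[of "(*) _"] cong: if_cong)
  have R: "fps_nth (exterior_series UNIV ?p :: 'k fps) k = (\<Sum>X | card X = k. (- 1) ^ k * w X)"
  proof -
    have "fps_nth (exterior_series UNIV ?p :: 'k fps) k =
        (\<Sum>X\<in>stable_subsets UNIV ?p. if card X = k then (- 1) ^ k * w X else 0)"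
      unfolding exterior_series_def fps_sum_nth
      by (rule sum.cong) (auto simp: w_def wedge_enum_perm[OF p] stable_subsets_def)
    also have "\<dots> = (\<Sum>X\<in>UNIV. if card X = k then (- 1) ^ k * w X else 0)"
      by (rule sum.mono_neutral_left) (auto simp: w_def wedge_enum_perm[OF p] stable_subsets_def)
    also have "\<dots> = (\<Sum>X | card X = k. (- 1) ^ k * w X)" by (simp add: sum.If_cases)
    finally show ?thesis .
  qed
  have "fps_nth ((1 - fps_X) * H) k = fps_nth (exterior_series UNIV ?p) k"
  proof (cases k)
    case 0
    have empty: "{X :: 'n set. card X = 0} = {{}}" by auto
    have "w {} = 1" unfolding w_def wedge_enum_perm[OF p] by (simp add: sign_on_def restrict_id_def)
    moreover have "fps_nth (exterior_series UNIV ?p :: 'k fps) 0 = (\<Sum>X\<in>{{}}. (- 1) ^ 0 * w X)"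
      using R unfolding 0 empty .
    ultimately show ?thesis unfolding 0 by (simp add: left_diff_distrib H hook_trace_0)
  next
    case (Suc l)
    have "fps_nth ((1 - fps_X) * H) k = fps_nth H (Suc l) - fps_nth H l"
      by (simp add: left_diff_distrib Suc)
    also have "\<dots> = (- 1) ^ k * (\<Sum>X | card X = Suc l. w X)"
    proof (cases "l < ?n")
      case True
      have "fps_nth H (Suc l) = (- 1) ^ Suc l * hook_trace i0 \<sigma> (Suc l)"
      proof (cases "Suc l = ?n")
        case True
        then show ?thesis unfolding H using hook_trace_top[of i0 \<sigma>] by simp
      qed (use \<open>l < ?n\<close> in \<open>simp add: H\<close>)
      then have "fps_nth H (Suc l) - fps_nth H l = (- 1) ^ k * (hook_trace i0 \<sigma> (Suc l) + hook_trace i0 \<sigma> l)"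
        using True by (simp add: H Suc algebra_simps)
      also have "hook_trace i0 \<sigma> (Suc l) + hook_trace i0 \<sigma> l = (\<Sum>X | card X = Suc l. w X)"
        unfolding w_def by (rule hook_trace_step)
      finally show ?thesis .
    next
      case False
      then have "{X :: 'n set. card X = Suc l} = {}"
        using card_mono[of "UNIV :: 'n set"] by (auto simp: not_less) (metis Suc_n_not_le_n le_trans subset_UNIV finite)
      then show ?thesis using False by (simp add: H)
    qed
    finally show ?thesis unfolding R sum_distrib_left by (simp only: Suc)
  qed
  then show "fps_nth ((1 - fps_X) * (\<Sum>u<?n. fps_const ((- 1) ^ u * hook_trace i0 \<sigma> u) * fps_X ^ u)) k =
      fps_nth (exterior_series UNIV ?p :: 'k fps) k"
    unfolding H_def .
qed

section \<open>The symmetric algebra of the standard representation\<close>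

text \<open>
  The projection of the polynomial ring onto its quotient by the sum of the variables, with \<open>i0\<close> as the variable to be
  eliminated.  This quotient is the symmetric algebra of the standard representation, and the monomials
  without \<open>i0\<close> are a basis of it.
\<close>

definition kill_sum :: "'n::finite \<Rightarrow> ('n, 'k::field) mpoly \<Rightarrow> ('n, 'k) mpoly" where
  "kill_sum i0 = subst const (\<lambda>i. if i = i0 then - (\<Sum>l\<in>- {i0}. indet l) else indet i)"

text \<open>
  The matrix entries of \<open>\<sigma>\<close> on the quotient by the sum of the variables.
\<close>

definition std_coeff :: "'n::finite \<Rightarrow> 'n perm \<Rightarrow> ('n \<Rightarrow>\<^sub>0 nat) \<Rightarrow> ('n \<Rightarrow>\<^sub>0 nat) \<Rightarrow> 'k::field" where
  "std_coeff i0 \<sigma> \<gamma> \<alpha> = lookup (kill_sum i0 (perm_poly \<sigma> (single \<alpha> 1))) \<gamma>"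

definition std_exponents :: "'n \<Rightarrow> nat \<Rightarrow> ('n \<Rightarrow>\<^sub>0 nat) set" where
  "std_exponents i0 w = {\<alpha>. total_degree \<alpha> = w \<and> lookup \<alpha> i0 = 0}"

definition std_series :: "'n::finite \<Rightarrow> 'n perm \<Rightarrow> 'k::field fps" where
  "std_series i0 \<sigma> = Abs_fps (\<lambda>w. \<Sum>\<alpha>\<in>std_exponents i0 w. std_coeff i0 \<sigma> \<alpha> \<alpha>)"

lemma ring_hom_kill_sum [simp]: "ring_hom (kill_sum i0)"
  unfolding kill_sum_def by simp

definition average :: "('n::finite, 'k::field_char_0) mpoly" where
  "average = const (1 / of_nat CARD('n)) * (\<Sum>l\<in>UNIV. indet l)"

text \<open>
  The linear change of variables that turns the variable \<open>i0\<close> into the invariant average \<open>a\<close> and each other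
  \<open>x\<^sub>i\<close> into \<open>x\<^sub>i - a\<close>.  The polynomial ring becomes the polynomial ring in \<open>a\<close> over the symmetric algebra of the
  standard representation.
\<close>

definition split_average :: "'n::finite \<Rightarrow> ('n, 'k::field_char_0) mpoly \<Rightarrow> ('n, 'k) mpoly" where
  "split_average i0 = subst const (\<lambda>i. if i = i0 then average else indet i - average)"

definition merge_average :: "'n::finite \<Rightarrow> ('n, 'k::field_char_0) mpoly \<Rightarrow> ('n, 'k) mpoly" where
  "merge_average i0 = subst const (\<lambda>i. if i = i0 then indet i0 - (\<Sum>l\<in>- {i0}. indet l) else indet i + indet i0)"

lemma ring_hom_comp: "ring_hom f \<Longrightarrow> ring_hom g \<Longrightarrow> ring_hom (\<lambda>x. f (g x))"
  by (simp add: ring_hom_def)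

lemma sum_split: "(\<Sum>l\<in>UNIV. f l) = f i0 + (\<Sum>l\<in>- {i0}. f l)"
  for f :: "'n::finite \<Rightarrow> 'a::comm_monoid_add"
  by (subst sum.remove[of UNIV i0]) (auto simp: Compl_eq_Diff_UNIV)

lemma card_average: "of_nat CARD('n) * average = (\<Sum>l\<in>UNIV. indet l :: ('n::finite, 'k::field_char_0) mpoly)"
proof -
  have "of_nat CARD('n) * (const (1 / of_nat CARD('n)) :: ('n, 'k) mpoly) = 1"
    by (simp add: mult_single flip: single_of_nat)
  then show ?thesis unfolding average_def mult.assoc[symmetric] by (simp only: mult_1_left)
qed

lemma average_form: "average \<in> forms UNIV (Suc 0)"
  unfolding average_def by (intro forms_const_mult forms_sum forms_indet[unfolded One_nat_def]) auto

context
  fixes i0 :: "'n::finite"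
begin

private abbreviation \<theta> :: "('n, 'k::field_char_0) mpoly \<Rightarrow> ('n, 'k) mpoly" where
  "\<theta> \<equiv> split_average i0"

private abbreviation \<theta>' :: "('n, 'k::field_char_0) mpoly \<Rightarrow> ('n, 'k) mpoly" where
  "\<theta>' \<equiv> merge_average i0"

private lemma hom: "ring_hom \<theta>" "ring_hom \<theta>'"
  by (simp_all add: split_average_def merge_average_def)

private lemma card_split: "(of_nat CARD('n) :: 'a::comm_ring_1) = 1 + of_nat (card (- {i0}))"
  using sum_split[of "\<lambda>_. 1 :: 'a"] by simp

private lemma \<theta>_simps:
  "\<theta> (const c) = const c" "\<theta> (indet i0) = average" "i \<noteq> i0 \<Longrightarrow> \<theta> (indet i) = indet i - average"
  "\<theta>' (const c) = const c" "\<theta>' (indet i0) = indet i0 - (\<Sum>l\<in>- {i0}. indet l)"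
  "i \<noteq> i0 \<Longrightarrow> \<theta>' (indet i) = indet i + indet i0"
  by (simp_all add: split_average_def merge_average_def)

private lemma \<theta>'_average: "\<theta>' (average :: ('n, 'k::field_char_0) mpoly) = indet i0"
proof -
  have "\<theta>' (\<Sum>l\<in>UNIV. indet l :: ('n, 'k) mpoly) = \<theta>' (indet i0) + (\<Sum>l\<in>- {i0}. \<theta>' (indet l))"
    by (simp only: ring_homD(2,8)[OF hom(2)] sum_split[of _ i0])
  also have "(\<Sum>l\<in>- {i0}. \<theta>' (indet l)) = (\<Sum>l\<in>- {i0}. indet l + indet i0 :: ('n, 'k) mpoly)"
    by (rule sum.cong) (simp_all add: \<theta>_simps)
  also have "\<theta>' (indet i0) + \<dots> = of_nat CARD('n) * indet i0"
    unfolding card_split by (simp add: \<theta>_simps sum.distrib distrib_right)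
  finally have "\<theta>' (average :: ('n, 'k) mpoly) = const (1 / of_nat CARD('n)) * (of_nat CARD('n) * indet i0)"
    by (simp add: average_def ring_homD(3)[OF hom(2)] \<theta>_simps)
  also have "\<dots> = (const (1 / of_nat CARD('n)) * const (of_nat CARD('n))) * indet i0"
    by (simp add: mult.assoc)
  also have "\<dots> = indet i0" by (simp add: mult_single del: single_of_nat)
  finally show ?thesis .
qed

private lemma \<theta>'\<theta>: "\<theta>' (\<theta> p) = (p :: ('n, 'k::field_char_0) mpoly)"
proof -
  have "\<theta>' (if i = i0 then average else indet i - average) = (indet i :: ('n, 'k) mpoly)" for i
    by (simp add: \<theta>_simps \<theta>'_average ring_homD(6)[OF hom(2)])
  then show ?thesis
    unfolding split_average_def by (subst ring_hom_subst_commute[OF hom(2)]) (simp add: \<theta>_simps)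
qed

private lemma \<theta>\<theta>': "\<theta> (\<theta>' p) = (p :: ('n, 'k::field_char_0) mpoly)"
proof -
  have "\<theta> (indet i0 - (\<Sum>l\<in>- {i0}. indet l)) = (average - (\<Sum>l\<in>- {i0}. \<theta> (indet l)) :: ('n, 'k) mpoly)"
    by (simp add: ring_homD(6,8)[OF hom(1)] \<theta>_simps)
  also have "(\<Sum>l\<in>- {i0}. \<theta> (indet l)) = (\<Sum>l\<in>- {i0}. indet l - average :: ('n, 'k) mpoly)"
    by (rule sum.cong) (simp_all add: \<theta>_simps)
  also have "average - \<dots> = of_nat CARD('n) * average - (\<Sum>l\<in>- {i0}. indet l)"
    unfolding card_split by (simp add: sum_subtractf distrib_right)
  also have "\<dots> = indet i0" unfolding card_average sum_split[of _ i0] by simp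
  finally have "\<theta> (if i = i0 then indet i0 - (\<Sum>l\<in>- {i0}. indet l) else indet i + indet i0) = (indet i :: ('n, 'k) mpoly)" for i
    by (simp add: ring_homD(2)[OF hom(1)] \<theta>_simps)
  then show ?thesis
    unfolding merge_average_def by (subst ring_hom_subst_commute[OF hom(1)]) (simp add: \<theta>_simps)
qed

private lemma \<theta>_forms: "p \<in> forms UNIV e \<Longrightarrow> \<theta> p \<in> forms UNIV e"
  "p \<in> forms UNIV e \<Longrightarrow> \<theta>' p \<in> forms UNIV e"
  for p :: "('n, 'k::field_char_0) mpoly"
  unfolding split_average_def merge_average_def
  by (erule forms_subst_linear;
    auto intro!: average_form forms_diff forms_add forms_sum forms_indet[unfolded One_nat_def])+

private lemma \<theta>_scale: "\<theta> (pm_scale c p) = pm_scale c (\<theta> p)"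
  by (simp add: pm_scale_const ring_homD(3)[OF hom(1)] \<theta>_simps)

private lemma pm_scale_monomial: "pm_scale c (single \<mu> 1) = single (\<mu> :: 'n \<Rightarrow>\<^sub>0 nat) c"
  by (simp add: pm_scale_const mult_single)

private lemma \<theta>_basis:
  "basis_mod {0} (forms UNIV e) {\<mu> :: 'n \<Rightarrow>\<^sub>0 nat. total_degree \<mu> = e} (\<lambda>\<mu>. \<theta> (single \<mu> (1 :: 'k::field_char_0)))"
proof -
  let ?J = "{\<mu> :: 'n \<Rightarrow>\<^sub>0 nat. total_degree \<mu> = e}"
  have mono: "basis_mod {0} (forms UNIV e) ?J (\<lambda>\<mu>. single \<mu> (1 :: 'k))" by (rule basis_mod_monomials)
  have lin: "(\<Sum>\<mu>\<in>?J. pm_scale (c \<mu>) (\<theta> (single \<mu> 1))) = \<theta> (\<Sum>\<mu>\<in>?J. pm_scale (c \<mu>) (single \<mu> 1))"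
    for c :: "_ \<Rightarrow> 'k"
    by (simp add: ring_homD(3,8)[OF hom(1)] pm_scale_const \<theta>_simps)
  show ?thesis
    unfolding basis_mod_def lin
  proof (intro conjI ballI allI impI)
    fix p :: "('n, 'k) mpoly" assume "p \<in> forms UNIV e"
    then have "\<theta>' p \<in> forms UNIV e" by (rule \<theta>_forms(2))
    then obtain c where "\<theta>' p - (\<Sum>\<mu>\<in>?J. pm_scale (c \<mu>) (single \<mu> 1)) \<in> {0}"
      using mono unfolding basis_mod_def by blast
    then have "\<theta> (\<Sum>\<mu>\<in>?J. pm_scale (c \<mu>) (single \<mu> 1)) = \<theta> (\<theta>' p)" by simp
    then have "p - \<theta> (\<Sum>\<mu>\<in>?J. pm_scale (c \<mu>) (single \<mu> 1)) \<in> {0}" unfolding \<theta>\<theta>' by simp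
    then show "\<exists>c. p - \<theta> (\<Sum>\<mu>\<in>?J. pm_scale (c \<mu>) (single \<mu> 1)) \<in> {0}" by (intro exI)
  next
    fix c :: "_ \<Rightarrow> 'k" and \<mu> assume "\<theta> (\<Sum>\<mu>\<in>?J. pm_scale (c \<mu>) (single \<mu> 1)) \<in> {0}" and \<mu>: "\<mu> \<in> ?J"
    then have "\<theta>' (\<theta> (\<Sum>\<mu>\<in>?J. pm_scale (c \<mu>) (single \<mu> 1))) = 0"
      using ring_homD(4)[OF hom(2)] by simp
    then have "(\<Sum>\<mu>\<in>?J. pm_scale (c \<mu>) (single \<mu> (1 :: 'k))) \<in> {0}" unfolding \<theta>'\<theta> by simp
    from basis_mod_independent[OF mono this \<mu>] show "c \<mu> = 0" .
  qed (auto intro!: \<theta>_forms forms_single)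
qed

text \<open>
  In the new variables \<open>\<sigma>\<close> fixes the variable \<open>i0\<close> and acts on the others as on the quotient by the sum.
\<close>

private lemma conjugate_monomial:
  fixes \<nu> :: "'n \<Rightarrow>\<^sub>0 nat"
  assumes "lookup \<nu> i0 = 0"
  shows "\<theta>' (perm_poly \<sigma> (\<theta> (single (\<nu> + single i0 k) (1 :: 'k::field_char_0)))) =
    single (single i0 k) 1 * kill_sum i0 (perm_poly \<sigma> (single \<nu> 1))"
proof -
  let ?\<Phi> = "\<lambda>p :: ('n, 'k) mpoly. \<theta>' (perm_poly \<sigma> (\<theta> p))"
  have hom\<Phi>: "ring_hom ?\<Phi>" 
    by (rule ring_hom_comp[OF hom(2) ring_hom_comp[OF ring_hom_perm_poly hom(1)]])
  have hom\<Psi>: "ring_hom (\<lambda>p :: ('n, 'k) mpoly. kill_sum i0 (perm_poly \<sigma> p))"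
    by (rule ring_hom_comp[OF ring_hom_kill_sum ring_hom_perm_poly])
  have sum_perm: "(\<Sum>l\<in>UNIV. indet (\<sigma> \<langle>$\<rangle> l)) = (\<Sum>l\<in>UNIV. indet l :: ('n, 'k) mpoly)"
    by (rule sum.reindex_bij_betw) simp
  have avg: "perm_poly \<sigma> (average :: ('n, 'k) mpoly) = average"
    by (simp add: average_def ring_homD(3,8)[OF ring_hom_perm_poly] sum_perm)
  have i0: "?\<Phi> (indet i0) = indet i0" by (simp add: \<theta>_simps avg \<theta>'_average)
  have other: "?\<Phi> (indet i) = kill_sum i0 (perm_poly \<sigma> (indet i))" if "i \<noteq> i0" for i
  proof -
    have "?\<Phi> (indet i) = \<theta>' (indet (\<sigma> \<langle>$\<rangle> i)) - indet i0"
      using that by (simp add: ring_homD(6)[OF ring_hom_perm_poly] ring_homD(6)[OF hom(2)] avg \<theta>'_average \<theta>_simps)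
    then show ?thesis by (cases "\<sigma> \<langle>$\<rangle> i = i0") (simp_all add: kill_sum_def \<theta>_simps)
  qed
  have mono: "single \<mu> 1 = (monomial_at indet \<mu> :: ('n, 'k) mpoly)" for \<mu> by simp
  have "?\<Phi> (single (\<nu> + single i0 k) 1) = monomial_at (\<lambda>i. ?\<Phi> (indet i)) (\<nu> + single i0 k)"
    unfolding mono by (rule ring_hom_monomial_at[OF hom\<Phi>])
  also have "\<dots> = monomial_at (\<lambda>i. ?\<Phi> (indet i)) \<nu> * indet i0 ^ k"
    unfolding monomial_at_add monomial_at_single i0 ..
  also have "monomial_at (\<lambda>i. ?\<Phi> (indet i)) \<nu> = monomial_at (\<lambda>i. kill_sum i0 (perm_poly \<sigma> (indet i))) \<nu>"
    using assms by (intro monomial_at_cong other) (auto simp: in_keys_iff)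
  also have "\<dots> = kill_sum i0 (perm_poly \<sigma> (single \<nu> 1))"
    unfolding mono by (rule ring_hom_monomial_at[OF hom\<Psi>, symmetric])
  also have "indet i0 ^ k = (single (single i0 k) 1 :: ('n, 'k) mpoly)"
    by (simp flip: monomial_at_indet)
  finally show ?thesis by (simp only: mult.commute)
qed

text \<open>
  The basis \<open>a\<^sup>k y\<^sup>\<nu>\<close>, with \<open>\<nu>\<close> not involving \<open>i0\<close>, has diagonal entries that depend on \<open>\<nu>\<close> only.
\<close>

lemma character_std_series:
  "character (poly_ring_rep e :: ('k::field_char_0, 'n perm, ('n, 'k) mpoly) rep) \<sigma> =
    (\<Sum>k\<le>e. fps_nth (std_series i0 \<sigma>) (e - k))"
proof -
  let ?J = "{\<mu> :: 'n \<Rightarrow>\<^sub>0 nat. total_degree \<mu> = e}"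
  let ?a = "\<lambda>\<nu> \<mu>. lookup (\<theta>' (perm_poly \<sigma> (\<theta> (single \<mu> (1 :: 'k))))) \<nu>"
  have "character (poly_ring_rep e :: ('k, 'n perm, ('n, 'k) mpoly) rep) \<sigma> = (\<Sum>\<mu>\<in>?J. ?a \<mu> \<mu>)"
  proof (rule character_basis[OF presents_poly_ring \<theta>_basis, where a = ?a])
    fix \<mu> assume "\<mu> \<in> ?J"
    then have "\<theta>' (perm_poly \<sigma> (\<theta> (single \<mu> (1 :: 'k)))) \<in> forms UNIV e" (is "?q \<in> _")
      by (intro \<theta>_forms perm_poly_forms forms_single) auto
    then have keys: "keys ?q \<subseteq> ?J" by (auto simp: forms_def)
    have "(\<Sum>\<nu>\<in>?J. pm_scale (?a \<nu> \<mu>) (\<theta> (single \<nu> 1))) = \<theta> (\<Sum>\<nu>\<in>?J. single \<nu> (lookup ?q \<nu>))"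
      by (simp only: ring_homD(8)[OF hom(1)] \<theta>_scale[symmetric] pm_scale_monomial)
    also have "(\<Sum>\<nu>\<in>?J. single \<nu> (lookup ?q \<nu>)) = (\<Sum>\<nu>\<in>keys ?q. single \<nu> (lookup ?q \<nu>))"
      using keys by (intro sum.mono_neutral_right) (auto simp: in_keys_iff)
    also have "\<dots> = ?q" by (rule sum_monomials[symmetric])
    also have "\<theta> ?q = perm_poly \<sigma> (\<theta> (single \<mu> 1))" by (rule \<theta>\<theta>')
    finally show "perm_poly \<sigma> (\<theta> (single \<mu> 1)) - (\<Sum>\<nu>\<in>?J. pm_scale (?a \<nu> \<mu>) (\<theta> (single \<nu> 1))) \<in> {0}"
      by simp
  qed
  also have "\<dots> = (\<Sum>(k, \<nu>)\<in>Sigma {..e} (\<lambda>k. std_exponents i0 (e - k)). std_coeff i0 \<sigma> \<nu> \<nu>)"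
  proof (rule sum.reindex_bij_witness[of _ "\<lambda>(k, \<nu>). \<nu> + single i0 k" "\<lambda>\<mu>. (lookup \<mu> i0, \<mu> - single i0 (lookup \<mu> i0))"])
    fix \<mu> assume \<mu>: "\<mu> \<in> ?J"
    let ?k = "lookup \<mu> i0" and ?\<nu> = "\<mu> - single i0 (lookup \<mu> i0)"
    have eq: "?\<nu> + single i0 ?k = \<mu>"
      by (rule poly_mapping_eqI) (simp add: lookup_add lookup_minus lookup_single when_def)
    then show "(case (?k, ?\<nu>) of (k, \<nu>) \<Rightarrow> \<nu> + single i0 k) = \<mu>" by simp
    have eq': "single i0 ?k + ?\<nu> = \<mu>" by (subst add.commute) (rule eq)
    have \<nu>0: "lookup ?\<nu> i0 = 0" by (simp add: lookup_minus)
    have "total_degree ?\<nu> + ?k = e" using \<mu> arg_cong[OF eq, of total_degree] by simp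
    with \<nu>0 show "(?k, ?\<nu>) \<in> Sigma {..e} (\<lambda>k. std_exponents i0 (e - k))" by (auto simp: std_exponents_def)
    have "?a \<mu> \<mu> = ?a (single i0 ?k + ?\<nu>) (?\<nu> + single i0 ?k)"
      by (simp only: eq eq')
    also have "\<dots> = std_coeff i0 \<sigma> ?\<nu> ?\<nu>"
      unfolding conjugate_monomial[OF \<nu>0] lookup_monomial_mult std_coeff_def by simp
    finally show "(case (?k, ?\<nu>) of (k, \<nu>) \<Rightarrow> std_coeff i0 \<sigma> \<nu> \<nu>) = ?a \<mu> \<mu>" by simp
  next
    fix x assume "x \<in> Sigma {..e} (\<lambda>k. std_exponents i0 (e - k))"
    then obtain k \<nu> where x: "x = (k, \<nu>)" "k \<le> e" "total_degree \<nu> = e - k" "lookup \<nu> i0 = 0"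
      by (auto simp: std_exponents_def)
    then show "(case x of (k, \<nu>) \<Rightarrow> \<nu> + single i0 k) \<in> ?J" by simp
    show "(lookup (case x of (k, \<nu>) \<Rightarrow> \<nu> + single i0 k) i0,
        (case x of (k, \<nu>) \<Rightarrow> \<nu> + single i0 k) - single i0 (lookup (case x of (k, \<nu>) \<Rightarrow> \<nu> + single i0 k) i0)) = x"
      using x by (simp add: lookup_add)
  qed
  also have "\<dots> = (\<Sum>k\<le>e. fps_nth (std_series i0 \<sigma>) (e - k))"
    by (subst sum.Sigma[symmetric])
      (auto simp: std_series_def intro: finite_subset[OF _ finite_exponents] simp: std_exponents_def)
  finally show ?thesis .
qed

end

section \<open>The adic filtration\<close>

text \<open>Reduces to multiples of the homogeneous generators.\<close>

lemma homogeneous_ideal_hcomp: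
  assumes "homogeneous_ideal I" "p \<in> I"
  shows "hcomp e p \<in> I"
proof -
  obtain G where G: "\<And>p. p \<in> G \<Longrightarrow> \<exists>e. homogeneous e p" "I = ideal_gen G"
    using assms(1) by (auto simp: homogeneous_ideal_def)
  have I: "is_ideal I" unfolding G(2) by (rule regular_module.subspace_span)
  have "p \<in> ideal_gen G" using assms(2) G(2) by simp
  then have "hcomp e p \<in> I"
  proof (induction rule: regular_module.span_induct_alt)
    case base
    show ?case using ideal_0[OF I] by simp
  next
    case (step c g y)
    then obtain d where d: "g \<in> forms UNIV d" using G(1) by (auto simp: homogeneous_forms)
    have "g \<in> I" unfolding G(2) using step(1) by (rule regular_module.span_base)
    then have "hcomp e (c * g) \<in> I"
      using ideal_mult[OF I] ideal_0[OF I] by (simp add: hcomp_mult_form[OF d])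
    then show ?case using step(2) by (simp add: hcomp_add ideal_add[OF I])
  qed
  then show ?thesis .
qed

lemma span_image_coefficients:
  assumes "finite J" "J' \<subseteq> J" "x \<in> pm.span (b ` J')"
  shows "\<exists>c. x = (\<Sum>j\<in>J. pm_scale (c j) (b j)) \<and> (\<forall>j. j \<notin> J' \<longrightarrow> c j = 0)"
  using assms(3)
proof (induction rule: pm.span_induct_alt)
  case base
  show ?case by (rule exI[of _ "\<lambda>_. 0"]) simp
next
  case (step a y z)
  then obtain c i where c: "z = (\<Sum>j\<in>J. pm_scale (c j) (b j))" "\<forall>j. j \<notin> J' \<longrightarrow> c j = 0"
    and i: "i \<in> J'" "y = b i" by auto
  have "(\<Sum>j\<in>J. pm_scale (if j = i then a else 0) (b j)) = (\<Sum>j\<in>J. if j = i then pm_scale a (b j) else 0)"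
    by (rule sum.cong) auto
  also have "\<dots> = pm_scale a y" using i assms(1,2) by auto
  finally have "pm_scale a y + z = (\<Sum>j\<in>J. pm_scale (c j + (if j = i then a else 0)) (b j))"
    by (simp add: c(1) pm.scale_left_distrib sum.distrib add.commute)
  then show ?case using c(2) i(1) by (intro exI[of _ "\<lambda>j. c j + (if j = i then a else 0)"]) auto
qed

lemma pm_scale_mult: "pm_scale (a * b) (p * q) = pm_scale a p * pm_scale b q"
  for p q :: "('i \<Rightarrow>\<^sub>0 nat) \<Rightarrow>\<^sub>0 'k::field"
  unfolding pm_scale_const ring_homD(3)[OF ring_hom_const] by (simp only: mult_ac)

text \<open>
  Here \<open>g\<close> is a quasi-regular system of homogeneous generators of positive degrees \<open>D\<close>, and the
  monomials with exponents in \<open>K e\<close> form a basis of the quotient by \<open>I\<close> in degree \<open>e\<close>.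
\<close>

locale weighted_generators =
  fixes I :: "('n::finite, 'k::field) mpoly set" and g :: "'i \<Rightarrow> ('n, 'k) mpoly"
    and D :: "'i \<Rightarrow> nat" and S :: "'i set" and K :: "nat \<Rightarrow> ('n \<Rightarrow>\<^sub>0 nat) set"
  assumes I: "is_ideal I" and Ig: "I = ideal_gen (g ` S)" and S: "finite S"
    and g: "\<And>v. v \<in> S \<Longrightarrow> g v \<in> forms UNIV (D v)" and D: "\<And>v. v \<in> S \<Longrightarrow> 0 < D v"
    and homog: "\<And>p e. p \<in> I \<Longrightarrow> hcomp e p \<in> I"
    and qr: "\<And>P j. P \<in> forms S j \<Longrightarrow> eval g P = 0 \<Longrightarrow> P \<in> coeffs_in I"
    and K: "\<And>e. K e \<subseteq> {\<mu>. total_degree \<mu> = e}"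
    and basis_K: "\<And>e. basis_mod I (forms UNIV e) (K e) (\<lambda>\<mu>. single \<mu> 1)"
begin

definition weight :: "('i \<Rightarrow>\<^sub>0 nat) \<Rightarrow> nat" where
  "weight \<alpha> = (\<Sum>i\<in>keys \<alpha>. D i * lookup \<alpha> i)"

definition exps :: "nat \<Rightarrow> ('i \<Rightarrow>\<^sub>0 nat) set" where
  "exps w = {\<alpha>. keys \<alpha> \<subseteq> S \<and> weight \<alpha> = w}"

definition index :: "nat \<Rightarrow> (('n \<Rightarrow>\<^sub>0 nat) \<times> ('i \<Rightarrow>\<^sub>0 nat)) set" where
  "index e = {(\<mu>, \<alpha>). keys \<alpha> \<subseteq> S \<and> weight \<alpha> \<le> e \<and> \<mu> \<in> K (e - weight \<alpha>)}"

text \<open>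
  The elements \<open>x\<^sup>\<mu> g\<^sup>\<alpha>\<close> of the basis to be; those with \<open>(\<mu>, \<alpha>) \<in> index e\<close> have degree \<open>e\<close>.
\<close>

definition member :: "('n \<Rightarrow>\<^sub>0 nat) \<times> ('i \<Rightarrow>\<^sub>0 nat) \<Rightarrow> ('n, 'k) mpoly" where
  "member = (\<lambda>(\<mu>, \<alpha>). single \<mu> 1 * monomial_at g \<alpha>)"

text \<open>
  The degree \<open>e\<close> part of the \<open>j\<close>-th power of \<open>I\<close>, in terms of the basis.
\<close>

definition level :: "nat \<Rightarrow> nat \<Rightarrow> ('n, 'k) mpoly set" where
  "level e j = pm.span (member ` {(\<mu>, \<alpha>) \<in> index e. j \<le> total_degree \<alpha>})"

lemma weight_superset: "finite A \<Longrightarrow> keys \<alpha> \<subseteq> A \<Longrightarrow> weight \<alpha> = (\<Sum>i\<in>A. D i * lookup \<alpha> i)"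
  unfolding weight_def by (rule sum.mono_neutral_left) (auto simp: in_keys_iff)

lemma weight_add: "weight (\<alpha> + \<beta>) = weight \<alpha> + weight \<beta>"
  by (simp add: weight_superset[of "keys \<alpha> \<union> keys \<beta>"] keys_add_nat lookup_add sum.distrib distrib_left)

lemma weight_0 [simp]: "weight 0 = 0"
  by (simp add: weight_def)

lemma weight_single: "weight (single v 1) = D v"
  by (simp add: weight_def)

lemma monomial_form: "keys \<alpha> \<subseteq> S \<Longrightarrow> monomial_at g \<alpha> \<in> forms UNIV (weight \<alpha>)"
  unfolding weight_def by (rule forms_monomial_at) (use g in blast)

lemma finite_exps: "finite {\<alpha>. keys \<alpha> \<subseteq> S \<and> weight \<alpha> \<le> w}"
proof (rule finite_imageD)
  have "lookup \<alpha> v \<le> w" if "keys \<alpha> \<subseteq> S" "weight \<alpha> \<le> w" "v \<in> S" for \<alpha> v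
  proof -
    have "lookup \<alpha> v \<le> D v * lookup \<alpha> v" using D[OF that(3)] by simp
    also have "\<dots> \<le> (\<Sum>i\<in>S. D i * lookup \<alpha> i)" by (rule member_le_sum[OF that(3)]) (use S in auto)
    also have "\<dots> \<le> w" using weight_superset[OF S that(1)] that(2) by simp
    finally show ?thesis .
  qed
  then have "lookup ` {\<alpha>. keys \<alpha> \<subseteq> S \<and> weight \<alpha> \<le> w}
      \<subseteq> {f. \<forall>x. (x \<in> S \<longrightarrow> f x \<in> {..w}) \<and> (x \<notin> S \<longrightarrow> f x = 0)}"
    by (auto simp: in_keys_iff)
  then show "finite (lookup ` {\<alpha>. keys \<alpha> \<subseteq> S \<and> weight \<alpha> \<le> w})"
    by (rule finite_subset) (rule finite_set_of_finite_funs, use S in auto)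
  show "inj_on lookup {\<alpha>. keys \<alpha> \<subseteq> S \<and> weight \<alpha> \<le> w}"
    by (rule inj_onI, rule poly_mapping_eqI) simp
qed

lemma finite_K: "finite (K e)"
  by (rule finite_subset[OF K finite_exponents])

lemma index_Sigma: "index e = prod.swap ` Sigma {\<alpha>. keys \<alpha> \<subseteq> S \<and> weight \<alpha> \<le> e} (\<lambda>\<alpha>. K (e - weight \<alpha>))"
  by (force simp: index_def)

lemma finite_index: "finite (index e)"
  unfolding index_Sigma by (intro finite_imageI finite_SigmaI finite_exps finite_K)

lemma member_form: "j \<in> index e \<Longrightarrow> member j \<in> forms UNIV e"
proof -
  assume "j \<in> index e"
  then obtain \<mu> \<alpha> where j: "j = (\<mu>, \<alpha>)" "keys \<alpha> \<subseteq> S" "weight \<alpha> \<le> e" "\<mu> \<in> K (e - weight \<alpha>)"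
    by (auto simp: index_def)
  have "single \<mu> 1 \<in> (forms UNIV (e - weight \<alpha>) :: ('n, 'k) mpoly set)"
    using j(4) K by (intro forms_single) auto
  from forms_mult[OF this monomial_form[OF j(2)]] j(3) show ?thesis by (simp add: j(1) member_def)
qed

lemma level_0: "level e 0 = pm.span (member ` index e)"
  by (simp add: level_def)

lemma level_antimono: "j \<le> j' \<Longrightarrow> level e j' \<subseteq> level e j"
  unfolding level_def by (rule pm.span_mono) auto

lemma level_mult:
  assumes "p \<in> level e j" "keys \<beta> \<subseteq> S"
  shows "p * monomial_at g \<beta> \<in> level (e + weight \<beta>) (j + total_degree \<beta>)"
  using assms(1) unfolding level_def
proof (induction rule: pm.span_induct_alt)
  case base
  show ?case by (simp add: pm.span_zero)
next
  case (step a x y)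
  then obtain \<mu> \<alpha> where x: "(\<mu>, \<alpha>) \<in> index e" "j \<le> total_degree \<alpha>" "x = member (\<mu>, \<alpha>)" by auto
  have "(\<mu>, \<alpha> + \<beta>) \<in> index (e + weight \<beta>)"
    using x(1) assms(2) by (auto simp: index_def keys_add_nat weight_add)
  moreover have "x * monomial_at g \<beta> = member (\<mu>, \<alpha> + \<beta>)"
    by (simp add: x(3) member_def monomial_at_add mult.assoc)
  ultimately have "x * monomial_at g \<beta> \<in> pm.span (member ` {(\<mu>, \<alpha>) \<in> index (e + weight \<beta>). j + total_degree \<beta> \<le> total_degree \<alpha>})"
    using x(2) by (intro pm.span_base) auto
  moreover have "(pm_scale a x + y) * monomial_at g \<beta> = pm_scale a (x * monomial_at g \<beta>) + y * monomial_at g \<beta>"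
    by (simp add: pm_scale_const distrib_right mult.assoc)
  ultimately show ?case using step(2) by (simp add: pm.span_add pm.span_scale)
qed

lemma ideal_form_decomposition:
  assumes "p \<in> I" "p \<in> forms UNIV e"
  shows "\<exists>q. p = (\<Sum>v\<in>S. if D v \<le> e then q v * g v else 0) \<and> (\<forall>v. q v \<in> forms UNIV (e - D v))"
proof -
  obtain q where q: "p = (\<Sum>v\<in>S. q v * g v)"
    using ideal_gen_image[OF S, of p g] assms(1) Ig by blast
  have "p = hcomp e p" using hcomp_form[OF assms(2), of e] by simp
  also have "\<dots> = (\<Sum>v\<in>S. if D v \<le> e then hcomp (e - D v) (q v) * g v else 0)"
    unfolding q hcomp_sum by (rule sum.cong[OF refl hcomp_mult_form[OF g]])
  finally show ?thesis by (intro exI[of _ "\<lambda>v. hcomp (e - D v) (q v)"] conjI) simp_all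
qed

text \<open>
  Both claims at once by induction on the degree: an element of \<open>I\<close> is a combination of the \<open>g v\<close> with
  coefficients of smaller degree, because \<open>D v\<close> is positive, and any form is a combination of monomials from \<open>K e\<close> modulo \<open>I\<close>.
\<close>

lemma forms_level: "(p \<in> forms UNIV e \<longrightarrow> p \<in> level e 0) \<and> (p \<in> I \<inter> forms UNIV e \<longrightarrow> p \<in> level e 1)"
proof (induction e arbitrary: p rule: less_induct)
  case (less e)
  have ideal: "p \<in> level e 1" if p: "p \<in> I" "p \<in> forms UNIV e" for p
  proof -
    obtain q where q: "p = (\<Sum>v\<in>S. if D v \<le> e then q v * g v else 0)"
      "\<And>v. q v \<in> forms UNIV (e - D v)"
      using ideal_form_decomposition[OF p] by blast
    have "(if D v \<le> e then q v * g v else 0) \<in> level e 1" if v: "v \<in> S" for v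
    proof (cases "D v \<le> e")
      case True
      with D[OF v] have "e - D v < e" by simp
      with less q(2) have "q v \<in> level (e - D v) 0" by blast
      from level_mult[OF this, of "single v 1"] v True show ?thesis by (simp add: weight_single[unfolded One_nat_def])
    qed (simp add: level_def pm.span_zero)
    then show ?thesis unfolding q(1) level_def by (rule pm.span_sum)
  qed
  have "p \<in> level e 0" if p: "p \<in> forms UNIV e" for p
  proof -
    obtain c where c: "p - (\<Sum>\<mu>\<in>K e. pm_scale (c \<mu>) (single \<mu> 1)) \<in> I"
      using basis_K[of e] p unfolding basis_mod_def by blast
    let ?s = "\<Sum>\<mu>\<in>K e. pm_scale (c \<mu>) (single \<mu> 1) :: ('n, 'k) mpoly"
    have "single \<mu> 1 \<in> level e 0" if "\<mu> \<in> K e" for \<mu>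
      unfolding level_0 by (rule pm.span_base, rule image_eqI[of _ _ "(\<mu>, 0)"]) (use that in \<open>auto simp: member_def index_def\<close>)
    then have s: "?s \<in> level e 0" unfolding level_def by (intro pm.span_sum pm.span_scale)
    have "?s \<in> forms UNIV e"
      unfolding pm_scale_const using K by (intro forms_sum forms_const_mult forms_single) auto
    then have "p - ?s \<in> level e 1" using c p by (intro ideal forms_diff)
    then have "p - ?s \<in> level e 0" using level_antimono[of 0 1 e] by auto
    from pm.span_add[OF this[unfolded level_0] s[unfolded level_0]] show ?thesis by (simp add: level_0)
  qed
  with ideal show ?case by blast
qed

text \<open>
  Independence is shown for the coefficients with \<open>total_degree \<alpha> = l\<close>, by induction on \<open>l\<close>.  A relation is
  a polynomial \<open>F\<close> in the generators that vanishes at \<open>g\<close>.  Once its parts of degree less than \<open>l\<close> are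
  zero, the parts of degree greater than \<open>l\<close> can be lowered to degree \<open>l\<close> with coefficients in \<open>I\<close>, so by
  quasi-regularity the part of degree \<open>l\<close> has coefficients in \<open>I\<close>.  Modulo \<open>I\<close> these are
  combinations of the monomials from \<open>K\<close>.
\<close>

lemma basis_index: "basis_mod {0} (forms UNIV e) (index e) member"
  unfolding basis_mod_def
proof (intro conjI ballI allI impI)
  show "finite (index e)" by (rule finite_index)
  show "member ` index e \<subseteq> forms UNIV e" using member_form by blast
  fix p :: "('n, 'k) mpoly" assume "p \<in> forms UNIV e"
  then have "p \<in> pm.span (member ` index e)" using forms_level level_0 by blast
  then obtain c where "p = (\<Sum>j\<in>index e. pm_scale (c j) (member j))"
    using span_image_coefficients[OF finite_index subset_refl] by blast
  then show "\<exists>c. p - (\<Sum>j\<in>index e. pm_scale (c j) (member j)) \<in> {0}" by (intro exI[of _ c]) simp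
next
  fix c :: "('n \<Rightarrow>\<^sub>0 nat) \<times> ('i \<Rightarrow>\<^sub>0 nat) \<Rightarrow> 'k" and j
  assume zero: "(\<Sum>j\<in>index e. pm_scale (c j) (member j)) \<in> {0}" and j: "j \<in> index e"
  let ?A = "{\<alpha>. keys \<alpha> \<subseteq> S \<and> weight \<alpha> \<le> e}"
  define coef where "coef \<alpha> = (\<Sum>\<mu>\<in>K (e - weight \<alpha>). pm_scale (c (\<mu>, \<alpha>)) (single \<mu> 1))" for \<alpha>
  define F where "F = (\<Sum>\<alpha>\<in>?A. single \<alpha> (coef \<alpha>))"
  have F: "lookup F \<alpha> = (if \<alpha> \<in> ?A then coef \<alpha> else 0)" for \<alpha>
    using finite_exps[of e] by (simp add: F_def lookup_sum lookup_single when_def)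
  have "eval g F = (\<Sum>\<alpha>\<in>?A. coef \<alpha> * monomial_at g \<alpha>)"
    by (simp add: F_def ring_homD(8)[OF ring_hom_subst[OF ring_hom_id(1)]] subst_single)
  also have "\<dots> = (\<Sum>\<alpha>\<in>?A. \<Sum>\<mu>\<in>K (e - weight \<alpha>). pm_scale (c (\<mu>, \<alpha>)) (member (\<mu>, \<alpha>)))"
    by (simp add: coef_def sum_distrib_right pm_scale_const member_def mult.assoc)
  also have "\<dots> = (\<Sum>j\<in>index e. pm_scale (c j) (member j))"
    unfolding index_Sigma
    by (subst sum.reindex) (auto simp: finite_exps finite_K sum.Sigma intro!: sum.cong inj_onI)
  finally have F0: "eval g F = 0" using zero by simp
  have "\<forall>\<mu> \<alpha>. (\<mu>, \<alpha>) \<in> index e \<longrightarrow> total_degree \<alpha> = l \<longrightarrow> c (\<mu>, \<alpha>) = 0" for l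
  proof (induction l rule: less_induct)
    case (less l)
    have keys_F: "keys \<alpha> \<subseteq> S \<and> l \<le> total_degree \<alpha>" if "\<alpha> \<in> keys F" for \<alpha>
    proof -
      from that have \<alpha>: "\<alpha> \<in> ?A" "coef \<alpha> \<noteq> 0" by (auto simp: in_keys_iff F split: if_splits)
      have "l \<le> total_degree \<alpha>"
      proof (rule ccontr)
        assume "\<not> l \<le> total_degree \<alpha>"
        then have lt: "total_degree \<alpha> < l" by simp
        have "c (\<mu>, \<alpha>) = 0" if "\<mu> \<in> K (e - weight \<alpha>)" for \<mu>
        proof -
          have "(\<mu>, \<alpha>) \<in> index e" using that \<alpha>(1) by (auto simp: index_def)
          with less.IH[OF lt] show ?thesis by simp
        qed
        then show False using \<alpha>(2) by (simp add: coef_def)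
      qed
      with \<alpha>(1) show ?thesis by simp
    qed
    have Fl: "hcomp l F \<in> forms S l"
      unfolding forms_def
    proof (intro CollectI ballI)
      fix \<alpha> assume "\<alpha> \<in> keys (hcomp l F)"
      then have "\<alpha> \<in> keys F" "total_degree \<alpha> = l" by (auto simp: in_keys_iff split: if_splits)
      with keys_F show "keys \<alpha> \<subseteq> S \<and> total_degree \<alpha> = l" by blast
    qed
    have "keys \<alpha> \<subseteq> S \<and> l < total_degree \<alpha>" if "\<alpha> \<in> keys (F - hcomp l F)" for \<alpha>
    proof -
      have "\<alpha> \<in> keys F" "total_degree \<alpha> \<noteq> l"
        using that by (auto simp: in_keys_iff lookup_minus split: if_splits)
      with keys_F[of \<alpha>] show ?thesis by simp
    qed
    moreover have gI: "g v \<in> I" if "v \<in> S" for v unfolding Ig using that by (intro regular_module.span_base) auto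
    ultimately obtain Q where Q: "Q \<in> forms S l" "Q \<in> coeffs_in I" "eval g Q = eval g (F - hcomp l F)"
      using lower_degree[OF I, of S g "F - hcomp l F" l] by blast
    have "eval g (hcomp l F + Q) = 0"
      using F0 Q(3) by (simp add: subst_add ring_homD(6)[OF ring_hom_subst[OF ring_hom_id(1)]])
    with qr forms_add[OF Fl Q(1)] have "hcomp l F + Q \<in> coeffs_in I" by blast
    from ideal_diff[OF ideal_coeffs_in[OF I] this Q(2)] have hI: "hcomp l F \<in> coeffs_in I" by simp
    show ?case
    proof (intro allI impI)
      fix \<mu> \<alpha> assume \<mu>: "(\<mu>, \<alpha>) \<in> index e" and l: "total_degree \<alpha> = l"
      then have \<alpha>: "\<alpha> \<in> ?A" "\<mu> \<in> K (e - weight \<alpha>)" by (auto simp: index_def)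
      have "lookup (hcomp l F) \<alpha> \<in> I" using hI by (auto simp: coeffs_in_def)
      then have "coef \<alpha> \<in> I" using \<alpha>(1) l by (simp add: F)
      from basis_mod_independent[OF basis_K, of "\<lambda>\<mu>. c (\<mu>, \<alpha>)", OF this[unfolded coef_def] \<alpha>(2)]
      show "c (\<mu>, \<alpha>) = 0" .
    qed
  qed
  then show "c j = 0" using j by (cases j) blast
qed

text \<open>
  The image of \<open>x\<^sup>\<mu> g\<^sup>\<alpha>\<close> is \<open>(A + r) \<sigma>(g\<^sup>\<alpha>)\<close>, where \<open>A\<close> is the reduction of \<open>\<sigma> x\<^sup>\<mu>\<close> modulo \<open>I\<close> and \<open>r \<in> I\<close>.  The first
  summand has the product of the entries for \<open>R/I\<close> and for the generators on the diagonal.  The second is a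
  combination of basis elements whose degree in \<open>g\<close> exceeds that of \<open>\<alpha>\<close>, and these do not meet the diagonal.
\<close>

lemma trace_factorization:
  assumes stable: "perm_stable I"
    and N: "\<And>\<alpha>. keys \<alpha> \<subseteq> S \<Longrightarrow> perm_poly \<sigma> (monomial_at g \<alpha>) =
      (\<Sum>\<gamma> | keys \<gamma> \<subseteq> S \<and> weight \<gamma> = weight \<alpha> \<and> total_degree \<gamma> = total_degree \<alpha>.
        pm_scale (N \<gamma> \<alpha>) (monomial_at g \<gamma>))"
  shows "character (poly_ring_rep e :: ('k, 'n perm, ('n, 'k) mpoly) rep) \<sigma> =
    (\<Sum>w = 0..e. (\<Sum>\<alpha>\<in>exps w. N \<alpha> \<alpha>) * character (quotient_rep UNIV I (e - w)) \<sigma>)"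
proof -
  let ?\<Gamma> = "\<lambda>\<alpha>. {\<gamma>. keys \<gamma> \<subseteq> S \<and> weight \<gamma> = weight \<alpha> \<and> total_degree \<gamma> = total_degree \<alpha>}"
  have fin\<Gamma>: "finite (?\<Gamma> \<alpha>)" for \<alpha> by (rule finite_subset[OF _ finite_exps[of "weight \<alpha>"]]) auto
  have ex_a: "\<exists>a. perm_poly \<sigma> (single \<mu> 1) - (\<Sum>i\<in>K q. pm_scale (a i) (single i 1)) \<in> I" if "\<mu> \<in> K q" for q \<mu>
  proof -
    have "perm_poly \<sigma> (single \<mu> 1) \<in> (forms UNIV q :: ('n, 'k) mpoly set)"
      using that K by (intro perm_poly_forms forms_single) auto
    then show ?thesis using basis_K[of q] unfolding basis_mod_def by blast
  qed
  define a where "a q i \<mu> = (SOME a. perm_poly \<sigma> (single \<mu> 1) - (\<Sum>i\<in>K q. pm_scale (a i) (single i 1)) \<in> I) i"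
    for q i \<mu>
  have a: "perm_poly \<sigma> (single \<mu> 1) - (\<Sum>i\<in>K q. pm_scale (a q i \<mu>) (single i 1)) \<in> I"
    if "\<mu> \<in> K q" for q \<mu>
    unfolding a_def by (rule someI_ex[OF ex_a[OF that]])
  have quotient: "character (quotient_rep UNIV I q) \<sigma> = (\<Sum>\<mu>\<in>K q. a q \<mu> \<mu>)" for q
  proof (rule character_basis[where b = "\<lambda>\<mu>. single \<mu> 1" and a = "a q"])
    show "presents (quotient_rep UNIV I q) \<sigma> (UNIV \<inter> forms UNIV q) I (perm_poly \<sigma>) (\<lambda>p. p +o I)"
      by (rule presents_quotient) (use stable in \<open>auto simp: I perm_stable_def\<close>)
    show "basis_mod I (UNIV \<inter> forms UNIV q) (K q) (\<lambda>\<mu>. single \<mu> 1)" using basis_K[of q] by simp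
  qed (rule a)
  \<comment> \<open>The entries of \<open>A \<sigma>(g\<^sup>\<alpha>)\<close>.\<close>
  define main where "main j i = (case j of (\<mu>, \<alpha>) \<Rightarrow> case i of (\<nu>, \<gamma>) \<Rightarrow>
      if \<gamma> \<in> ?\<Gamma> \<alpha> then a (e - weight \<alpha>) \<nu> \<mu> * N \<gamma> \<alpha> else 0)" for j i
  have ex_d: "\<exists>d. perm_poly \<sigma> (member j) = (\<Sum>i\<in>index e. pm_scale (main j i + d i) (member i)) \<and> d j = 0"
    if "j \<in> index e" for j
  proof -
    obtain \<mu> \<alpha> where j: "j = (\<mu>, \<alpha>)" by (cases j)
    let ?q = "e - weight \<alpha>"
    from that have \<mu>: "keys \<alpha> \<subseteq> S" "weight \<alpha> \<le> e" "\<mu> \<in> K ?q" by (auto simp: j index_def)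
    define A where "A = (\<Sum>i\<in>K ?q. pm_scale (a ?q i \<mu>) (single i 1) :: ('n, 'k) mpoly)"
    define r where "r = perm_poly \<sigma> (single \<mu> 1) - A"
    have "r \<in> I" unfolding r_def A_def by (rule a[OF \<mu>(3)])
    moreover have "r \<in> forms UNIV ?q" unfolding r_def A_def pm_scale_const
      using \<mu>(3) K by (intro forms_diff perm_poly_forms forms_sum forms_const_mult forms_single) auto
    ultimately have r: "r \<in> level ?q 1" using forms_level by blast
    have "r * monomial_at g \<gamma> \<in> level e (Suc (total_degree \<alpha>))" if "\<gamma> \<in> ?\<Gamma> \<alpha>" for \<gamma>
      using level_mult[OF r, of \<gamma>] that \<mu>(2) by simp
    then have "(\<Sum>\<gamma>\<in>?\<Gamma> \<alpha>. pm_scale (N \<gamma> \<alpha>) (r * monomial_at g \<gamma>)) \<in> level e (Suc (total_degree \<alpha>))"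
      unfolding level_def by (intro pm.span_sum pm.span_scale)
    then obtain d where d: "(\<Sum>\<gamma>\<in>?\<Gamma> \<alpha>. pm_scale (N \<gamma> \<alpha>) (r * monomial_at g \<gamma>)) = (\<Sum>i\<in>index e. pm_scale (d i) (member i))"
      "\<And>i. i \<notin> {(\<mu>, \<gamma>) \<in> index e. Suc (total_degree \<alpha>) \<le> total_degree \<gamma>} \<Longrightarrow> d i = 0"
      unfolding level_def using span_image_coefficients[OF finite_index[of e], of "{(\<mu>, \<gamma>) \<in> index e. Suc (total_degree \<alpha>) \<le> total_degree \<gamma>}"]
      by blast
    have "(\<Sum>i\<in>index e. pm_scale (main j i) (member i)) =
        (\<Sum>(\<nu>, \<gamma>)\<in>K ?q \<times> ?\<Gamma> \<alpha>. pm_scale (a ?q \<nu> \<mu> * N \<gamma> \<alpha>) (single \<nu> 1 * monomial_at g \<gamma>))"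
    proof (rule sum.mono_neutral_cong_right[OF finite_index])
      show "K ?q \<times> ?\<Gamma> \<alpha> \<subseteq> index e" using \<mu>(2) by (auto simp: index_def)
      show "\<forall>i\<in>index e - K ?q \<times> ?\<Gamma> \<alpha>. pm_scale (main j i) (member i) = 0"
      proof
        fix i assume i: "i \<in> index e - K ?q \<times> ?\<Gamma> \<alpha>"
        obtain \<nu> \<gamma> where i': "i = (\<nu>, \<gamma>)" by (cases i)
        have "\<gamma> \<notin> ?\<Gamma> \<alpha>" using i by (auto simp: i' index_def)
        then have "main j i = 0" by (simp only: main_def j i' prod.case if_False)
        then show "pm_scale (main j i) (member i) = 0" by simp
      qed
    qed (auto simp: main_def j member_def)
    also have "\<dots> = A * perm_poly \<sigma> (monomial_at g \<alpha>)"
      unfolding N[OF \<mu>(1)] A_def sum_product sum.cartesian_product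
      by (rule sum.cong) (auto simp: pm_scale_mult)
    finally have main: "(\<Sum>i\<in>index e. pm_scale (main j i) (member i)) = A * perm_poly \<sigma> (monomial_at g \<alpha>)" .
    have "perm_poly \<sigma> (member j) = (A + r) * perm_poly \<sigma> (monomial_at g \<alpha>)"
      by (simp add: j member_def r_def ring_homD(3)[OF ring_hom_perm_poly])
    also have "r * perm_poly \<sigma> (monomial_at g \<alpha>) = (\<Sum>\<gamma>\<in>?\<Gamma> \<alpha>. pm_scale (N \<gamma> \<alpha>) (r * monomial_at g \<gamma>))"
      unfolding N[OF \<mu>(1)] by (simp add: sum_distrib_left pm_scale_const mult_ac)
    then have "(A + r) * perm_poly \<sigma> (monomial_at g \<alpha>) = (\<Sum>i\<in>index e. pm_scale (main j i + d i) (member i))"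
      by (simp add: distrib_right main d(1) pm.scale_left_distrib sum.distrib)
    finally show ?thesis using d(2)[of j] by (intro exI[of _ d]) (auto simp: j)
  qed
  \<comment> \<open>The entries of \<open>r \<sigma>(g\<^sup>\<alpha>)\<close>; the one at \<open>j\<close> itself is zero.\<close>
  define d where "d j = (SOME d. perm_poly \<sigma> (member j) = (\<Sum>i\<in>index e. pm_scale (main j i + d i) (member i)) \<and> d j = 0)"
    for j
  have d: "perm_poly \<sigma> (member j) = (\<Sum>i\<in>index e. pm_scale (main j i + d j i) (member i))" "d j j = 0"
    if "j \<in> index e" for j
    using someI_ex[OF ex_d[OF that]] unfolding d_def by (rule conjunct1, rule conjunct2)
  have "character (poly_ring_rep e :: ('k, 'n perm, ('n, 'k) mpoly) rep) \<sigma> = (\<Sum>j\<in>index e. main j j + d j j)"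
    by (rule character_basis[OF presents_poly_ring basis_index, where a = "\<lambda>i j. main j i + d j i"])
      (simp add: d(1))
  also have "\<dots> = (\<Sum>j\<in>index e. main j j)" by (simp add: d(2))
  also have "\<dots> = (\<Sum>\<alpha> | keys \<alpha> \<subseteq> S \<and> weight \<alpha> \<le> e. \<Sum>\<mu>\<in>K (e - weight \<alpha>). main (\<mu>, \<alpha>) (\<mu>, \<alpha>))"
    unfolding index_Sigma
    by (subst sum.reindex) (auto simp: finite_exps finite_K sum.Sigma intro!: sum.cong inj_onI)
  also have "\<dots> = (\<Sum>\<alpha> | keys \<alpha> \<subseteq> S \<and> weight \<alpha> \<le> e. N \<alpha> \<alpha> * character (quotient_rep UNIV I (e - weight \<alpha>)) \<sigma>)"
    by (rule sum.cong) (simp_all add: main_def quotient sum_distrib_left mult.commute)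
  also have "\<dots> = (\<Sum>w\<in>{0..e}. \<Sum>\<alpha>\<in>{\<alpha> \<in> {\<alpha>. keys \<alpha> \<subseteq> S \<and> weight \<alpha> \<le> e}. weight \<alpha> = w}.
      N \<alpha> \<alpha> * character (quotient_rep UNIV I (e - weight \<alpha>)) \<sigma>)"
    by (rule sum.group[symmetric]) (auto simp: finite_exps)
  also have "\<dots> = (\<Sum>w = 0..e. (\<Sum>\<alpha>\<in>exps w. N \<alpha> \<alpha>) * character (quotient_rep UNIV I (e - w)) \<sigma>)"
    unfolding sum_distrib_right by (intro sum.cong refl) (auto simp: exps_def)
  finally show ?thesis .
qed

end

section \<open>Equivariant minimal generators\<close>

lemma var_indet: "var i = indet i"
  by (simp add: var_def indet_def)

lemma hcomp_0_const: "hcomp 0 p = const (lookup p 0)"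
  by (rule poly_mapping_eqI) (auto simp: lookup_single when_def)

lemma ideal_max_ideal: "is_ideal max_ideal"
  unfolding max_ideal_def by (rule regular_module.subspace_span)

lemma max_ideal_iff: "p \<in> max_ideal \<longleftrightarrow> lookup p 0 = 0"
proof
  assume "p \<in> max_ideal"
  then have "hcomp 0 p = 0" unfolding max_ideal_def
  proof (induction rule: regular_module.span_induct_alt)
    case (step c x y)
    then have "x \<in> forms UNIV (Suc 0)" by (auto simp: var_indet intro: forms_indet[unfolded One_nat_def])
    with step(2) show ?case by (simp add: hcomp_add hcomp_mult_form)
  qed simp
  then show "lookup p 0 = 0" by (metis hcomp_0_const lookup_single_eq lookup_zero)
next
  assume p: "lookup p 0 = 0"
  have "p = (\<Sum>\<mu>\<in>keys p. single \<mu> (lookup p \<mu>))" by (rule sum_monomials)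
  also have "\<dots> \<in> max_ideal"
  proof (intro ideal_sum ideal_max_ideal)
    fix \<mu> assume "\<mu> \<in> keys p"
    then have "\<mu> \<noteq> 0" using p by (auto simp: in_keys_iff)
    then obtain i where "i \<in> keys \<mu>" by (metis ex_in_conv keys_eq_empty)
    then obtain \<nu> where \<nu>: "\<mu> = \<nu> + single i 1" by (rule remove_indeterminate)
    have "single \<mu> (lookup p \<mu>) = single \<nu> (lookup p \<mu>) * var i"
      unfolding \<nu> var_def mult_single by simp
    also have "\<dots> \<in> max_ideal"
      by (intro ideal_mult ideal_max_ideal) (auto simp: max_ideal_def intro: regular_module.span_base)
    finally show "single \<mu> (lookup p \<mu>) \<in> max_ideal" .
  qed
  finally show "p \<in> max_ideal" .
qed

lemma perm_stable_max_ideal: "p \<in> max_ideal \<Longrightarrow> perm_poly \<sigma> p \<in> max_ideal"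
  unfolding max_ideal_def
proof (induction rule: regular_module.span_induct_alt)
  case base
  then show ?case by (simp add: ring_homD(4)[OF ring_hom_perm_poly] regular_module.span_zero)
next
  case (step c x y)
  then obtain i where "x = indet i" by (auto simp: var_indet)
  then have "perm_poly \<sigma> x = var (\<sigma> \<langle>$\<rangle> i)" by (simp add: var_indet)
  then have "perm_poly \<sigma> c * perm_poly \<sigma> x \<in> ideal_gen (range var)"
    by (intro regular_module.span_scale regular_module.span_base) auto
  with step(2) show ?case
    by (simp add: ring_homD(2,3)[OF ring_hom_perm_poly] regular_module.span_add)
qed

lemma ideal_ideal_prod: "is_ideal (ideal_prod A B)"
  unfolding ideal_prod_def by (rule regular_module.subspace_span)

lemma ideal_prodI: "a \<in> A \<Longrightarrow> b \<in> B \<Longrightarrow> a * b \<in> ideal_prod A B"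
  unfolding ideal_prod_def by (rule regular_module.span_base) auto

lemma perm_stable_max_prod:
  assumes "perm_stable I"
  shows "perm_stable (ideal_prod max_ideal I)"
  unfolding perm_stable_def
proof (intro allI ballI)
  fix \<sigma> p assume "p \<in> ideal_prod max_ideal I"
  then show "perm_poly \<sigma> p \<in> ideal_prod max_ideal I"
    unfolding ideal_prod_def
  proof (induction rule: regular_module.span_induct_alt)
    case base
    then show ?case by (simp add: ring_homD(4)[OF ring_hom_perm_poly] regular_module.span_zero)
  next
    case (step c x y)
    then obtain a b where "x = a * b" "a \<in> max_ideal" "b \<in> I" by auto
    then have "perm_poly \<sigma> x \<in> {a * b |a b. a \<in> max_ideal \<and> b \<in> I}"
      using assms perm_stable_max_ideal
      unfolding \<open>x = a * b\<close> ring_homD(3)[OF ring_hom_perm_poly] perm_stable_def by blast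
    then have "perm_poly \<sigma> c * perm_poly \<sigma> x \<in> ideal_gen {a * b |a b. a \<in> max_ideal \<and> b \<in> I}"
      by (intro regular_module.span_scale regular_module.span_base)
    with step(2) show ?case
      by (simp add: ring_homD(2,3)[OF ring_hom_perm_poly] regular_module.span_add)
  qed
qed

lemma max_prod_decomposition:
  fixes I :: "('n::finite, 'k::field) mpoly set"
  assumes I: "is_ideal I" and p: "p \<in> ideal_prod max_ideal I"
  shows "\<exists>q. (\<forall>i. q i \<in> I) \<and> p = (\<Sum>i\<in>UNIV. q i * indet i)"
  using p unfolding ideal_prod_def
proof (induction rule: regular_module.span_induct_alt)
  case base
  show ?case by (rule exI[of _ "\<lambda>_. 0"]) (simp add: ideal_0[OF I])
next
  case (step c x y)
  then obtain q where q: "\<forall>i. q i \<in> I" "y = (\<Sum>i\<in>UNIV. q i * indet i)" by blast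
  from step obtain a b where ab: "x = a * b" "a \<in> max_ideal" "b \<in> I" by auto
  then obtain r where r: "a = (\<Sum>i\<in>UNIV. r i * indet i)"
    using ideal_gen_image[of UNIV a var] by (auto simp: max_ideal_def var_indet)
  have "c * x + y = (\<Sum>i\<in>UNIV. (c * r i * b + q i) * indet i)"
    unfolding ab(1) r q(2) distrib_right sum.distrib
    by (simp add: sum_distrib_left sum_distrib_right mult_ac)
  then show ?case
    using q(1) ab(3) by (intro exI[of _ "\<lambda>i. c * r i * b + q i"] conjI allI ideal_add ideal_mult I) auto
qed

lemma max_prod_hcomp:
  fixes I :: "('n::finite, 'k::field) mpoly set"
  assumes I: "is_ideal I" and homog: "\<And>p e. p \<in> I \<Longrightarrow> hcomp e p \<in> I"
    and p: "p \<in> ideal_prod max_ideal I"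
  shows "\<exists>q. (\<forall>i. q i \<in> I \<inter> forms UNIV (e - 1)) \<and> hcomp e p = (if e = 0 then 0 else (\<Sum>i\<in>UNIV. q i * indet i))"
proof -
  obtain q where q: "\<And>i. q i \<in> I" "p = (\<Sum>i\<in>UNIV. q i * indet i)"
    using max_prod_decomposition[OF I p] by blast
  have "hcomp e p = (if e = 0 then 0 else (\<Sum>i\<in>UNIV. hcomp (e - 1) (q i) * indet i))"
    by (auto simp: q(2) hcomp_sum hcomp_mult_form[OF forms_indet])
  then show ?thesis using q(1) homog by (intro exI[of _ "\<lambda>i. hcomp (e - 1) (q i)"]) auto
qed

text \<open>
  Products of variables with homogeneous components of elements of \<open>I\<close> are again in the product ideal.
\<close>

lemma max_prod_homog:
  fixes I :: "('n::finite, 'k::field) mpoly set"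
  assumes I: "is_ideal I" and homog: "\<And>p e. p \<in> I \<Longrightarrow> hcomp e p \<in> I"
    and p: "p \<in> ideal_prod max_ideal I"
  shows "hcomp e p \<in> ideal_prod max_ideal I"
proof -
  obtain q where q: "\<And>i. q i \<in> I" "hcomp e p = (if e = 0 then 0 else (\<Sum>i\<in>UNIV. q i * indet i))"
    using max_prod_hcomp[OF I homog p, of e] by blast
  have "q i * indet i \<in> ideal_prod max_ideal I" for i
  proof -
    have "indet i \<in> (max_ideal :: ('n, 'k) mpoly set)"
      by (auto simp: max_ideal_def simp flip: var_indet intro: regular_module.span_base)
    from ideal_prodI[OF this q(1)[of i]] show ?thesis by (simp add: mult.commute)
  qed
  then have "(\<Sum>i\<in>UNIV. q i * indet i) \<in> ideal_prod max_ideal I"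
    by (intro ideal_sum ideal_ideal_prod)
  then show ?thesis using q(2) by (simp add: ideal_0[OF ideal_ideal_prod])
qed

text \<open>
  The projection of a basis vector of the permutation representation to the standard representation.  Unlike
  a basis, these \<open>n\<close> vectors are permuted by the group.
\<close>

definition zvec :: "'n::finite \<Rightarrow> (('n \<Rightarrow> nat) \<Rightarrow>\<^sub>0 'k::field_char_0)" where
  "zvec i = single (tab [i]) 1 - (\<Sum>l\<in>UNIV. single (tab [l]) (1 / of_nat CARD('n)))"

lemma tab_eq_iff [simp]: "tab [i] = tab [j] \<longleftrightarrow> i = j"
  using tab_inject[of "[i]" "[j]"] by simp

lemma lookup_zvec: "lookup (zvec i) (tab [j]) = (if i = j then 1 else 0) - 1 / of_nat CARD('n)"
  for i :: "'n::finite"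
  by (simp add: zvec_def lookup_minus lookup_sum lookup_single when_def)

lemma hook_tabs_1: "hook_tabs 1 = range (\<lambda>i. tab [i])"
  by (auto simp: hook_tabs_def length_Suc_conv)

lemma hook_space_1:
  "v \<in> hook_space 1 \<longleftrightarrow> keys v \<subseteq> range (\<lambda>i. tab [i]) \<and> (\<Sum>i\<in>UNIV. lookup v (tab [i])) = 0"
  for v :: "('n::finite \<Rightarrow> nat) \<Rightarrow>\<^sub>0 'k::field"
proof -
  have "tab_coeff 1 v (xs @ a # b # ys) = - tab_coeff 1 v (xs @ b # a # ys)" for xs ys a b
    by (simp add: tab_coeff_def)
  then have "tab_coeff 1 v \<in> alternating 1"
    by (intro alternatingI) (simp_all add: tab_coeff_def)
  moreover have "(\<forall>bs. boundary (tab_coeff 1 v) bs = 0) \<longleftrightarrow> boundary (tab_coeff 1 v) [] = 0"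
  proof (intro iffI allI)
    fix bs :: "'n list" assume "boundary (tab_coeff 1 v) [] = 0"
    then show "boundary (tab_coeff 1 v) bs = 0"
      by (cases bs) (simp_all add: boundary_def tab_coeff_def)
  qed blast
  ultimately show ?thesis
    by (simp add: hook_space_def hook_tabs_1[unfolded One_nat_def] boundary_def tab_coeff_def)
qed

lemma zvec_in: "(zvec i :: ('n::finite \<Rightarrow> nat) \<Rightarrow>\<^sub>0 'k::field_char_0) \<in> hook_space 1"
proof -
  have "keys (zvec i :: ('n \<Rightarrow> nat) \<Rightarrow>\<^sub>0 'k) \<subseteq> range (\<lambda>i. tab [i])"
  proof
    fix r :: "'n \<Rightarrow> nat" assume r: "r \<in> keys (zvec i :: ('n \<Rightarrow> nat) \<Rightarrow>\<^sub>0 'k)"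
    show "r \<in> range (\<lambda>i. tab [i])"
    proof (rule ccontr)
      assume "r \<notin> range (\<lambda>i. tab [i])"
      then have "tab [l] \<noteq> r" for l by blast
      then have "lookup (zvec i) r = (0 :: 'k)" by (simp add: zvec_def lookup_minus lookup_sum lookup_single)
      with r show False by (simp add: in_keys_iff)
    qed
  qed
  then show ?thesis unfolding hook_space_1 by (simp add: lookup_zvec sum_subtractf)
qed

lemma zvec_sum: "(\<Sum>i\<in>UNIV. zvec i :: ('n::finite \<Rightarrow> nat) \<Rightarrow>\<^sub>0 'k::field_char_0) = 0"
proof -
  have "(\<Sum>i\<in>(UNIV :: 'n set). single r (1 / of_nat CARD('n))) = single r (1 :: 'k)" for r :: "'n \<Rightarrow> nat"
    by (rule poly_mapping_eqI) (simp only: lookup_sum lookup_single, simp add: when_def)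
  moreover have "(\<Sum>i\<in>(UNIV :: 'n set). \<Sum>l\<in>(UNIV :: 'n set). single (tab [l]) (1 / of_nat CARD('n))) =
      (\<Sum>l\<in>UNIV. \<Sum>i\<in>(UNIV :: 'n set). single (tab [l]) (1 / of_nat CARD('n) :: 'k))"
    by (rule sum.swap)
  ultimately show ?thesis unfolding zvec_def sum_subtractf by (simp only: diff_self)
qed

lemma zvec_perm: "perm_module \<sigma> (zvec i) = zvec (\<sigma> \<langle>$\<rangle> i)"
proof (rule poly_mapping_eqI)
  fix r
  have "tab [l] = perm_tabloid (inverse \<sigma>) r \<longleftrightarrow> tab [\<sigma> \<langle>$\<rangle> l] = r" for l
    using perm_tabloid_inverse[of \<sigma> "tab [l]" r] by (auto simp: perm_tabloid_tab)
  then have "lookup (perm_module \<sigma> (zvec i)) r =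
      (1 when tab [\<sigma> \<langle>$\<rangle> i] = r) - (\<Sum>l\<in>UNIV. 1 / of_nat CARD('a) when tab [\<sigma> \<langle>$\<rangle> l] = r)"
    by (simp add: lookup_perm_module zvec_def lookup_minus lookup_sum lookup_single)
  also have "(\<Sum>l\<in>UNIV. 1 / of_nat CARD('a) when tab [\<sigma> \<langle>$\<rangle> l] = r) = (\<Sum>l\<in>UNIV. 1 / of_nat CARD('a) when tab [l] = r)"
    by (rule sum.reindex_bij_betw) simp
  finally show "lookup (perm_module \<sigma> (zvec i)) r = lookup (zvec (\<sigma> \<langle>$\<rangle> i)) r"
    by (simp add: zvec_def lookup_minus lookup_sum lookup_single)
qed

lemma zvec_span:
  fixes v :: "('n::finite \<Rightarrow> nat) \<Rightarrow>\<^sub>0 'k::field_char_0"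
  assumes "v \<in> hook_space 1"
  shows "v = (\<Sum>i\<in>UNIV. pm_scale (lookup v (tab [i])) (zvec i))"
proof (rule poly_mapping_eqI)
  fix r
  have sum0: "(\<Sum>i\<in>UNIV. lookup v (tab [i])) = 0" using assms unfolding hook_space_1 by simp
  have in_space: "(\<Sum>i\<in>UNIV. pm_scale (lookup v (tab [i])) (zvec i)) \<in> hook_space 1"
    by (intro pm.subspace_sum pm.subspace_scale hook_space_subspace zvec_in)
  show "lookup v r = lookup (\<Sum>i\<in>UNIV. pm_scale (lookup v (tab [i])) (zvec i)) r"
  proof (cases "r \<in> range (\<lambda>i. tab [i])")
    case True
    then obtain j where r: "r = tab [j]" by blast
    have "lookup (\<Sum>i\<in>UNIV. pm_scale (lookup v (tab [i])) (zvec i)) r =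
        (\<Sum>i\<in>UNIV. (if i = j then lookup v (tab [i]) else 0) - lookup v (tab [i]) * (1 / of_nat CARD('n)))"
      unfolding r lookup_sum by (rule sum.cong) (auto simp: lookup_zvec algebra_simps)
    also have "\<dots> = lookup v r - (\<Sum>i\<in>UNIV. lookup v (tab [i])) * (1 / of_nat CARD('n))"
      by (simp add: sum_subtractf r sum_divide_distrib)
    finally show ?thesis using sum0 by simp
  next
    case False
    then have "r \<notin> keys v" "r \<notin> keys (\<Sum>i\<in>UNIV. pm_scale (lookup v (tab [i])) (zvec i))"
      using assms in_space unfolding hook_space_1 by blast+
    then show ?thesis by (simp add: in_keys_iff)
  qed
qed

lemma zvec_independent:
  fixes i0 :: "'n::finite" and a :: "'n \<Rightarrow> 'k::field_char_0"
  assumes zero: "(\<Sum>i\<in>- {i0}. pm_scale (a i) (zvec i)) = 0" and i: "i \<noteq> i0"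
  shows "a i = 0"
proof -
  have "lookup (\<Sum>i\<in>- {i0}. pm_scale (a i) (zvec i)) (tab [j]) =
      (\<Sum>i\<in>- {i0}. if i = j then a i else 0) - (\<Sum>i\<in>- {i0}. a i) * (1 / of_nat CARD('n))" for j
    unfolding lookup_sum sum_distrib_right sum_subtractf[symmetric]
    by (rule sum.cong) (auto simp: lookup_zvec algebra_simps)
  then have eq: "(\<Sum>i\<in>- {i0}. if i = j then a i else 0) = (\<Sum>i\<in>- {i0}. a i) * (1 / of_nat CARD('n))" for j
    using zero by simp
  from eq[of i0] have "(\<Sum>i\<in>- {i0}. a i) * (1 / of_nat CARD('n)) = 0" by simp
  with eq[of i] i show ?thesis by simp
qed

section \<open>Generators of the ideal\<close>

lemma finite_perms: "finite (UNIV :: 'n::finite perm set)"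
proof -
  have "{\<pi> :: 'n perm. (\<langle>$\<rangle>) \<pi> permutes UNIV} = UNIV" by (auto intro: bij_imp_permutes)
  then show ?thesis
    using bij_betw_finite[OF apply_permutes_bij[of "UNIV :: 'n set"]] by (simp add: finite_permutations)
qed

text \<open>
  The maps \<open>\<psi> e\<close> and \<open>\<omega> e\<close> are the components of the isomorphism from the degree \<open>e\<close> part of
  \<open>I/mI\<close>, composed with the projection from \<open>I\<close>.
\<close>

locale minimal_generators_iso =
  fixes I :: "('n::finite, 'k::field_char_0) mpoly set" and d m :: nat and c :: "nat \<Rightarrow> nat"
    and \<psi> :: "nat \<Rightarrow> ('n, 'k) mpoly \<Rightarrow> (('n \<Rightarrow> nat) \<Rightarrow>\<^sub>0 'k)"
    and \<omega> :: "nat \<Rightarrow> ('n, 'k) mpoly \<Rightarrow> nat \<Rightarrow> 'k"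
  assumes I: "is_ideal I" and stable: "perm_stable I"
    and homog: "\<And>p e. p \<in> I \<Longrightarrow> hcomp e p \<in> I"
    and \<psi>_add: "\<And>e p q. p \<in> I \<inter> forms UNIV e \<Longrightarrow> q \<in> I \<inter> forms UNIV e \<Longrightarrow> \<psi> e (p + q) = \<psi> e p + \<psi> e q"
    and \<omega>_add: "\<And>e p q j. p \<in> I \<inter> forms UNIV e \<Longrightarrow> q \<in> I \<inter> forms UNIV e \<Longrightarrow> j \<in> {1..m} \<Longrightarrow>
      \<omega> e (p + q) j = \<omega> e p j + \<omega> e q j"
    and \<psi>_scale: "\<And>e a p. p \<in> I \<inter> forms UNIV e \<Longrightarrow> \<psi> e (pm_scale a p) = pm_scale a (\<psi> e p)"
    and \<omega>_scale: "\<And>e a p j. p \<in> I \<inter> forms UNIV e \<Longrightarrow> j \<in> {1..m} \<Longrightarrow> \<omega> e (pm_scale a p) j = a * \<omega> e p j"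
    and \<psi>_perm: "\<And>e \<sigma> p. p \<in> I \<inter> forms UNIV e \<Longrightarrow> \<psi> e (perm_poly \<sigma> p) = perm_module \<sigma> (\<psi> e p)"
    and \<omega>_perm: "\<And>e \<sigma> p j. p \<in> I \<inter> forms UNIV e \<Longrightarrow> j \<in> {1..m} \<Longrightarrow> \<omega> e (perm_poly \<sigma> p) j = \<omega> e p j"
    and kernel: "\<And>e p. p \<in> I \<inter> forms UNIV e \<Longrightarrow>
      p \<in> ideal_prod max_ideal I \<longleftrightarrow> \<psi> e p = 0 \<and> (\<forall>j\<in>{1..m}. \<omega> e p j = 0)"
    and \<psi>_range: "\<And>e p. p \<in> I \<inter> forms UNIV e \<Longrightarrow> \<psi> e p \<in> (if e = d then hook_space 1 else {0})"
    and \<omega>_range: "\<And>e p j. p \<in> I \<inter> forms UNIV e \<Longrightarrow> j \<in> {1..m} \<Longrightarrow> e \<noteq> c j \<Longrightarrow> \<omega> e p j = 0"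
    and onto: "\<And>e z w. z \<in> (if e = d then hook_space 1 else {0}) \<Longrightarrow> \<forall>j\<in>{1..m}. e \<noteq> c j \<longrightarrow> w j = 0 \<Longrightarrow>
      \<exists>p\<in>I \<inter> forms UNIV e. \<psi> e p = z \<and> (\<forall>j\<in>{1..m}. \<omega> e p j = w j)"
begin

abbreviation "M \<equiv> ideal_prod max_ideal I"
abbreviation "part e \<equiv> I \<inter> forms UNIV e"

lemma part_subspace: "pm.subspace (part e)"
  by (intro pm.subspace_inter ideal_subspace I forms_subspace)

lemma part_perm: "p \<in> part e \<Longrightarrow> perm_poly \<sigma> p \<in> part e"
  using stable by (auto simp: perm_stable_def perm_poly_forms)

lemma \<psi>_0: "\<psi> e 0 = 0" and \<omega>_0: "j \<in> {1..m} \<Longrightarrow> \<omega> e 0 j = 0"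
  using \<psi>_scale[of 0 e 0] \<omega>_scale[of 0 e j 0] ideal_0[OF I] by simp_all

lemma \<psi>_sum: "(\<And>i. i \<in> A \<Longrightarrow> f i \<in> part e) \<Longrightarrow> \<psi> e (\<Sum>i\<in>A. f i) = (\<Sum>i\<in>A. \<psi> e (f i))"
proof (induction A rule: infinite_finite_induct)
  case (insert i A)
  then have "(\<Sum>i\<in>A. f i) \<in> part e" by (intro pm.subspace_sum[OF part_subspace]) auto
  with insert show ?case using \<psi>_add[of "f i" e "\<Sum>i\<in>A. f i"] by simp
qed (simp_all add: \<psi>_0)

lemma \<omega>_sum: "(\<And>i. i \<in> A \<Longrightarrow> f i \<in> part e) \<Longrightarrow> j \<in> {1..m} \<Longrightarrow> \<omega> e (\<Sum>i\<in>A. f i) j = (\<Sum>i\<in>A. \<omega> e (f i) j)"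
proof (induction A rule: infinite_finite_induct)
  case (insert i A)
  then have "(\<Sum>i\<in>A. f i) \<in> part e" by (intro pm.subspace_sum[OF part_subspace]) auto
  with insert show ?case using \<omega>_add[of "f i" e "\<Sum>i\<in>A. f i" j] by simp
qed (simp_all add: \<omega>_0)

lemma \<psi>_diff: "p \<in> part e \<Longrightarrow> q \<in> part e \<Longrightarrow> \<psi> e (p - q) = \<psi> e p - \<psi> e q"
  using \<psi>_add[of "p - q" e q] pm.subspace_diff[OF part_subspace, of p e q] by simp

lemma \<omega>_diff: "p \<in> part e \<Longrightarrow> q \<in> part e \<Longrightarrow> j \<in> {1..m} \<Longrightarrow> \<omega> e (p - q) j = \<omega> e p j - \<omega> e q j"
  using \<omega>_add[of "p - q" e q j] pm.subspace_diff[OF part_subspace, of p e q] by simp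

text \<open>
  Reynolds averaging for a family \<open>p\<close> whose images are permuted by \<open>act\<close>: the family
  \<open>q i = 1/n! \<Sum>\<^bsub>\<tau>\<^esub> \<tau> (p (\<tau>\<^sup>-\<^sup>1 i))\<close> is permuted by \<open>act\<close> itself and has the same images.
\<close>

lemma perm_average:
  fixes p :: "'x \<Rightarrow> ('n, 'k) mpoly" and act :: "'n perm \<Rightarrow> 'x \<Rightarrow> 'x"
  assumes act: "\<And>x. act 1 x = x" "\<And>\<sigma> \<tau> x. act (\<sigma> * \<tau>) x = act \<sigma> (act \<tau> x)"
    and p: "\<And>i. p i \<in> part e"
    and \<psi>: "\<And>\<tau> i. perm_module \<tau> (\<psi> e (p i)) = \<psi> e (p (act \<tau> i))"
    and \<omega>: "\<And>\<tau> i j. j \<in> {1..m} \<Longrightarrow> \<omega> e (p i) j = \<omega> e (p (act \<tau> i)) j"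
  shows "\<exists>q. \<forall>i. q i \<in> part e \<and> (\<forall>\<sigma>. perm_poly \<sigma> (q i) = q (act \<sigma> i)) \<and> \<psi> e (q i) = \<psi> e (p i) \<and>
    (\<forall>j\<in>{1..m}. \<omega> e (q i) j = \<omega> e (p i) j)"
proof -
  have inverse_act: "act (inverse \<sigma>) (act \<sigma> x) = x" "act \<sigma> (act (inverse \<sigma>) x) = x" for \<sigma> x
    by (simp_all add: act(1) flip: act(2))
  define r where "r = (1 / of_nat (card (UNIV :: 'n perm set)) :: 'k)"
  have r: "of_nat (card (UNIV :: 'n perm set)) * r = 1"
    using finite_perms[where 'n = 'n] by (simp add: r_def card_gt_0_iff)
  define q where "q i = (\<Sum>\<tau>\<in>UNIV. pm_scale r (perm_poly \<tau> (p (act (inverse \<tau>) i))))" for i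
  have summand: "pm_scale r (perm_poly \<tau> (p (act (inverse \<tau>) i))) \<in> part e" for \<tau> i
    by (intro pm.subspace_scale[OF part_subspace] part_perm p)
  have const_sum: "(\<Sum>\<tau>\<in>(UNIV :: 'n perm set). pm_scale r v) = v" for v :: "('n \<Rightarrow> nat) \<Rightarrow>\<^sub>0 'k"
    by (rule poly_mapping_eqI) (simp only: lookup_sum lookup_pm_scale, simp add: r mult.assoc[symmetric])
  show ?thesis
  proof (intro exI[of _ q] allI conjI ballI)
    fix i
    show "q i \<in> part e" unfolding q_def by (intro pm.subspace_sum[OF part_subspace] summand)
    show "perm_poly \<sigma> (q i) = q (act \<sigma> i)" for \<sigma>
    proof -
      have "perm_poly \<sigma> (q i) = (\<Sum>\<tau>\<in>UNIV. pm_scale r (perm_poly (\<sigma> * \<tau>) (p (act (inverse (\<sigma> * \<tau>)) (act \<sigma> i)))))"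
        by (simp add: q_def ring_homD(8)[OF ring_hom_perm_poly] perm_poly_pm_scale perm_poly_times
            act(2) inverse_act)
      also have "\<dots> = q (act \<sigma> i)" unfolding q_def
        by (rule sum.reindex_bij_witness[of _ "\<lambda>\<tau>. inverse \<sigma> * \<tau>" "\<lambda>\<tau>. \<sigma> * \<tau>"])
          (simp_all add: mult.assoc[symmetric])
      finally show ?thesis .
    qed
    have "\<psi> e (q i) = (\<Sum>\<tau>\<in>(UNIV :: 'n perm set). pm_scale r (\<psi> e (p i)))"
      unfolding q_def by (subst \<psi>_sum[OF summand], rule sum.cong)
        (simp_all add: \<psi>_scale[OF part_perm[OF p]] \<psi>_perm[OF p] \<psi> inverse_act)
    then show "\<psi> e (q i) = \<psi> e (p i)" by (simp only: const_sum)
    fix j assume j: "j \<in> {1..m}"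
    have "\<omega> e (p (act (inverse \<tau>) i)) j = \<omega> e (p i) j" for \<tau> using \<omega>[OF j, of i "inverse \<tau>"] by simp
    then have "\<omega> e (q i) j = (\<Sum>\<tau>\<in>(UNIV :: 'n perm set). r * \<omega> e (p i) j)"
      unfolding q_def by (subst \<omega>_sum[OF summand j], intro sum.cong refl)
        (simp add: \<omega>_scale[OF part_perm[OF p] j] \<omega>_perm[OF p j])
    then show "\<omega> e (q i) j = \<omega> e (p i) j" by (simp add: r mult.assoc[symmetric])
  qed
qed

text \<open>
  Lift the \<open>zvec i\<close> equivariantly, then subtract the average of the lifts; it is invariant and maps to
  zero.
\<close>

lemma ex_standard_generators:
  "\<exists>gs. (\<forall>i. gs i \<in> part d \<and> \<psi> d (gs i) = zvec i \<and> (\<forall>j\<in>{1..m}. \<omega> d (gs i) j = 0) \<and>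
    (\<forall>\<sigma>. perm_poly \<sigma> (gs i) = gs (\<sigma> \<langle>$\<rangle> i))) \<and> (\<Sum>i\<in>UNIV. gs i) = 0"
proof -
  have "\<exists>p\<in>part d. \<psi> d p = zvec i \<and> (\<forall>j\<in>{1..m}. \<omega> d p j = 0)" for i
    by (rule onto) (simp_all add: zvec_in[unfolded One_nat_def])
  then obtain p where p: "\<And>i. p i \<in> part d" "\<And>i. \<psi> d (p i) = zvec i" "\<And>i j. j \<in> {1..m} \<Longrightarrow> \<omega> d (p i) j = 0"
    by metis
  have "perm_module \<tau> (\<psi> d (p i)) = \<psi> d (p (\<tau> \<langle>$\<rangle> i))" for \<tau> i by (simp add: p(2) zvec_perm)
  moreover have "\<omega> d (p i) j = \<omega> d (p (\<tau> \<langle>$\<rangle> i)) j" if "j \<in> {1..m}" for \<tau> i j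
    by (simp only: p(3)[OF that])
  ultimately obtain q where "\<forall>i. q i \<in> part d \<and> (\<forall>\<sigma>. perm_poly \<sigma> (q i) = q (\<sigma> \<langle>$\<rangle> i)) \<and>
      \<psi> d (q i) = \<psi> d (p i) \<and> (\<forall>j\<in>{1..m}. \<omega> d (q i) j = \<omega> d (p i) j)"
    using perm_average[of "(\<langle>$\<rangle>)" p d] p(1) apply_times by (auto simp: apply_sequence)
  then have q: "\<And>i. q i \<in> part d" "\<And>i \<sigma>. perm_poly \<sigma> (q i) = q (\<sigma> \<langle>$\<rangle> i)" "\<And>i. \<psi> d (q i) = zvec i"
    "\<And>i j. j \<in> {1..m} \<Longrightarrow> \<omega> d (q i) j = 0"
    using p by auto
  define s where "s = pm_scale (1 / of_nat CARD('n)) (\<Sum>l\<in>UNIV. q l)"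
  have s: "s \<in> part d" unfolding s_def
    by (intro pm.subspace_scale[OF part_subspace] pm.subspace_sum[OF part_subspace] q)
  have sum_part: "(\<Sum>l\<in>UNIV. q l) \<in> part d" by (intro pm.subspace_sum[OF part_subspace] q)
  have s\<psi>: "\<psi> d s = 0"
    unfolding s_def \<psi>_scale[OF sum_part] \<psi>_sum[OF q(1)] q(3) zvec_sum by simp
  have s\<omega>: "\<omega> d s j = 0" if "j \<in> {1..m}" for j
    unfolding s_def \<omega>_scale[OF sum_part that] \<omega>_sum[OF q(1) that] q(4)[OF that] by simp
  have "(\<Sum>i\<in>UNIV. q (\<sigma> \<langle>$\<rangle> i)) = (\<Sum>i\<in>UNIV. q i)" for \<sigma> by (rule sum.reindex_bij_betw) simp
  then have s_perm: "perm_poly \<sigma> s = s" for \<sigma>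
    by (simp add: s_def perm_poly_pm_scale ring_homD(8)[OF ring_hom_perm_poly] q(2))
  have "(\<Sum>i\<in>(UNIV :: 'n set). s) = (\<Sum>l\<in>UNIV. q l)"
    by (rule poly_mapping_eqI) (simp only: lookup_sum s_def lookup_pm_scale, simp)
  then have "(\<Sum>i\<in>UNIV. q i - s) = 0" by (simp only: sum_subtractf diff_self)
  moreover have "q i - s \<in> part d \<and> \<psi> d (q i - s) = zvec i \<and> (\<forall>j\<in>{1..m}. \<omega> d (q i - s) j = 0) \<and>
      (\<forall>\<sigma>. perm_poly \<sigma> (q i - s) = q (\<sigma> \<langle>$\<rangle> i) - s)" for i
    using pm.subspace_diff[OF part_subspace q(1) s, of i]
    by (simp add: \<psi>_diff[OF q(1) s] \<omega>_diff[OF q(1) s] q s\<psi> s\<omega> ring_homD(6)[OF ring_hom_perm_poly] s_perm)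
  ultimately show ?thesis by (intro exI[of _ "\<lambda>i. q i - s"]) blast
qed

lemma ex_trivial_generator:
  assumes j: "j \<in> {1..m}"
  shows "\<exists>h\<in>part (c j). \<psi> (c j) h = 0 \<and> (\<forall>l\<in>{1..m}. \<omega> (c j) h l = (if l = j then 1 else 0)) \<and>
    (\<forall>\<sigma>. perm_poly \<sigma> h = h)"
proof -
  have "(0 :: ('n \<Rightarrow> nat) \<Rightarrow>\<^sub>0 'k) \<in> (if c j = d then hook_space 1 else {0})"
    by (simp add: pm.subspace_0[OF hook_space_subspace])
  then have "\<exists>p\<in>part (c j). \<psi> (c j) p = 0 \<and> (\<forall>l\<in>{1..m}. \<omega> (c j) p l = (if l = j then 1 else 0))"
    by (rule onto) auto
  then obtain p where p: "p \<in> part (c j)" "\<psi> (c j) p = 0" "\<forall>l\<in>{1..m}. \<omega> (c j) p l = (if l = j then 1 else 0)"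
    by blast
  have "perm_module \<tau> (0 :: ('n \<Rightarrow> nat) \<Rightarrow>\<^sub>0 'k) = 0" for \<tau>
    by (rule poly_mapping_eqI) (simp add: lookup_perm_module)
  then obtain q :: "unit \<Rightarrow> ('n, 'k) mpoly" where "\<forall>i. q i \<in> part (c j) \<and> (\<forall>\<sigma>. perm_poly \<sigma> (q i) = q i) \<and>
      \<psi> (c j) (q i) = \<psi> (c j) p \<and> (\<forall>l\<in>{1..m}. \<omega> (c j) (q i) l = \<omega> (c j) p l)"
    using perm_average[of "\<lambda>_ x. x" "\<lambda>_ :: unit. p" "c j"] p by auto
  then show ?thesis using p by (intro bexI[of _ "q ()"]) auto
qed

text \<open>
  That the lifts generate \<open>I\<close> is Nakayama's lemma in graded form, by induction on the degree.  Independence modulo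
  \<open>M\<close> can be tested in each degree separately.
\<close>

lemma ex_equivariant_generators:
  fixes i0 :: 'n
  defines "S \<equiv> Inl ` (- {i0}) \<union> Inr ` {1..m}"
  shows "\<exists>gs hs. (\<forall>i. gs i \<in> forms UNIV d \<and> (\<forall>\<sigma>. perm_poly \<sigma> (gs i) = gs (\<sigma> \<langle>$\<rangle> i))) \<and> (\<Sum>i\<in>UNIV. gs i) = 0 \<and>
    (\<forall>j\<in>{1..m}. hs j \<in> forms UNIV (c j) \<and> (\<forall>\<sigma>. perm_poly \<sigma> (hs j) = hs j)) \<and>
    I = ideal_gen (case_sum gs hs ` S) \<and>
    (\<forall>a. (\<Sum>v\<in>S. pm_scale (a v) (case_sum gs hs v)) \<in> M \<longrightarrow> (\<forall>v\<in>S. a v = 0))"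
proof -
  obtain gs where gs: "\<And>i. gs i \<in> part d" "\<And>i. \<psi> d (gs i) = zvec i" "\<And>i j. j \<in> {1..m} \<Longrightarrow> \<omega> d (gs i) j = 0"
    "\<And>i \<sigma>. perm_poly \<sigma> (gs i) = gs (\<sigma> \<langle>$\<rangle> i)" "(\<Sum>i\<in>UNIV. gs i) = 0"
    using ex_standard_generators by blast
  obtain hs where hs: "\<And>j. j \<in> {1..m} \<Longrightarrow> hs j \<in> part (c j) \<and> \<psi> (c j) (hs j) = 0 \<and>
      (\<forall>l\<in>{1..m}. \<omega> (c j) (hs j) l = (if l = j then 1 else 0)) \<and> (\<forall>\<sigma>. perm_poly \<sigma> (hs j) = hs j)"
    using bchoice[of "{1..m}" "\<lambda>j h. h \<in> part (c j) \<and> \<psi> (c j) h = 0 \<and>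
      (\<forall>l\<in>{1..m}. \<omega> (c j) h l = (if l = j then 1 else 0)) \<and> (\<forall>\<sigma>. perm_poly \<sigma> h = h)"] ex_trivial_generator
    by blast
  let ?g = "case_sum gs hs" and ?J = "ideal_gen (case_sum gs hs ` S)"
  have J: "is_ideal ?J" by (rule regular_module.subspace_span)
  have gJ: "?g v \<in> ?J" if "v \<in> S" for v using that by (intro regular_module.span_base imageI)
  have hsJ: "hs j \<in> ?J" if "j \<in> {1..m}" for j using gJ[of "Inr j"] that by (simp add: S_def)
  have gsJ: "gs i \<in> ?J" for i
  proof (cases "i = i0")
    case True
    have "gs i0 = - (\<Sum>l\<in>- {i0}. gs l)" using gs(5) unfolding sum_split[of _ i0] by (simp add: eq_neg_iff_add_eq_0)
    moreover have "(\<Sum>l\<in>- {i0}. gs l) \<in> ?J" using gJ[of "Inl _"] by (intro ideal_sum J) (auto simp: S_def)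
    ultimately show ?thesis using True ideal_uminus[OF J] by simp
  qed (use gJ[of "Inl i"] in \<open>simp add: S_def\<close>)
  have part_sub: "p \<in> ?J" if "p \<in> part e" for p e
    using that
  proof (induction e arbitrary: p rule: less_induct)
    case (less e)
    let ?s1 = "if e = d then \<Sum>i\<in>UNIV. pm_scale (lookup (\<psi> e p) (tab [i])) (gs i) else 0"
    let ?s2 = "\<Sum>j\<in>{1..m}. if c j = e then pm_scale (\<omega> e p j) (hs j) else 0"
    have s1: "?s1 \<in> part e"
    proof (cases "e = d")
      case True
      have "(\<Sum>i\<in>UNIV. pm_scale (lookup (\<psi> e p) (tab [i])) (gs i)) \<in> part d"
        by (intro pm.subspace_sum[OF part_subspace] pm.subspace_scale[OF part_subspace] gs(1))
      with True show ?thesis by simp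
    next
      case False
      with pm.subspace_0[OF part_subspace, of e] show ?thesis by simp
    qed
    have s2_part: "(if c j = e then pm_scale (\<omega> e p j) (hs j) else 0) \<in> part e" if "j \<in> {1..m}" for j
      using hs[OF that] pm.subspace_scale[OF part_subspace] pm.subspace_0[OF part_subspace] by auto
    then have s2: "?s2 \<in> part e" by (intro pm.subspace_sum[OF part_subspace])
    have \<psi>1: "\<psi> e ?s1 = \<psi> e p"
    proof (cases "e = d")
      case True
      have "\<psi> d (\<Sum>i\<in>UNIV. pm_scale (lookup (\<psi> d p) (tab [i])) (gs i)) =
          (\<Sum>i\<in>UNIV. pm_scale (lookup (\<psi> d p) (tab [i])) (zvec i))"
        by (subst \<psi>_sum[OF pm.subspace_scale[OF part_subspace gs(1)]]) (simp add: \<psi>_scale[OF gs(1)] gs(2))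
      also have "\<dots> = \<psi> d p" using zvec_span[of "\<psi> d p"] \<psi>_range[OF less.prems] True by simp
      finally show ?thesis using True by simp
    qed (use \<psi>_range[OF less.prems] in \<open>simp add: \<psi>_0\<close>)
    have \<omega>1: "\<omega> e ?s1 j = 0" if "j \<in> {1..m}" for j
    proof (cases "e = d")
      case True
      have "\<omega> d (\<Sum>i\<in>UNIV. pm_scale (lookup (\<psi> d p) (tab [i])) (gs i)) j = 0"
        by (subst \<omega>_sum[OF pm.subspace_scale[OF part_subspace gs(1)] that]) (simp add: \<omega>_scale[OF gs(1) that] gs(3)[OF that])
      with True show ?thesis by simp
    qed (simp add: \<omega>_0[OF that])
    have \<psi>2: "\<psi> e ?s2 = 0"
    proof -
      have "\<psi> e ?s2 = (\<Sum>j\<in>{1..m}. \<psi> e (if c j = e then pm_scale (\<omega> e p j) (hs j) else 0))"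
        by (rule \<psi>_sum[OF s2_part])
      also have "\<dots> = 0"
      proof (rule sum.neutral, rule ballI)
        fix j assume j: "j \<in> {1..m}"
        then show "\<psi> e (if c j = e then pm_scale (\<omega> e p j) (hs j) else 0) = 0"
          using hs[OF j] \<psi>_scale[of "hs j" "c j"] by (auto simp: \<psi>_0)
      qed
      finally show ?thesis .
    qed
    have \<omega>2: "\<omega> e ?s2 l = \<omega> e p l" if l: "l \<in> {1..m}" for l
    proof -
      have "\<omega> e ?s2 l = (\<Sum>j\<in>{1..m}. \<omega> e (if c j = e then pm_scale (\<omega> e p j) (hs j) else 0) l)"
        by (rule \<omega>_sum[OF s2_part l])
      also have "\<dots> = (\<Sum>j\<in>{1..m}. if j = l then \<omega> e p l else 0)"
      proof (rule sum.cong[OF refl])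
        fix j assume j: "j \<in> {1..m}"
        show "\<omega> e (if c j = e then pm_scale (\<omega> e p j) (hs j) else 0) l = (if j = l then \<omega> e p l else 0)"
        proof (cases "c j = e")
          case True
          then have "hs j \<in> part e" "\<omega> e (hs j) l = (if l = j then 1 else 0)" using hs[OF j] l by auto
          then show ?thesis using True \<omega>_scale[of "hs j" e l "\<omega> e p j"] l by auto
        next
          case False
          then show ?thesis using \<omega>_0[OF l] \<omega>_range[OF less.prems l] by auto
        qed
      qed
      also have "\<dots> = \<omega> e p l" using l by simp
      finally show ?thesis .
    qed
    let ?r = "p - (?s1 + ?s2)"
    have s: "?s1 + ?s2 \<in> part e" by (rule pm.subspace_add[OF part_subspace s1 s2])
    have r: "?r \<in> part e" by (rule pm.subspace_diff[OF part_subspace less.prems s])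
    have "\<psi> e ?r = 0" unfolding \<psi>_diff[OF less.prems s] \<psi>_add[OF s1 s2] \<psi>1 \<psi>2 by simp
    moreover have "\<omega> e ?r j = 0" if "j \<in> {1..m}" for j
      unfolding \<omega>_diff[OF less.prems s that] \<omega>_add[OF s1 s2 that] \<omega>1[OF that] \<omega>2[OF that] by simp
    ultimately have "?r \<in> M" using kernel[OF r] by blast
    from max_prod_hcomp[OF I homog this, of e] obtain q where q: "\<And>i. q i \<in> part (e - 1)"
      "hcomp e ?r = (if e = 0 then 0 else (\<Sum>i\<in>UNIV. q i * indet i))" by blast
    have "hcomp e ?r = ?r" using r hcomp_form[of ?r e e] by simp
    moreover have "hcomp e ?r \<in> ?J"
    proof (cases "e = 0")
      case True
      then show ?thesis using q(2) by (simp add: ideal_0[OF J])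
    next
      case False
      then have "q i \<in> ?J" for i using less.IH[of "e - 1" "q i"] q(1) by simp
      then have "(\<Sum>i\<in>UNIV. q i * indet i) \<in> ?J" by (intro ideal_sum ideal_mult_right J)
      then show ?thesis using q(2) False by simp
    qed
    ultimately have "?r \<in> ?J" by simp
    moreover have "?s1 \<in> ?J" using gsJ by (auto simp: pm_scale_const ideal_0[OF J] intro!: ideal_sum ideal_mult J)
    moreover have "?s2 \<in> ?J" using hsJ by (auto simp: pm_scale_const ideal_0[OF J] intro!: ideal_sum ideal_mult J)
    ultimately have "?r + (?s1 + ?s2) \<in> ?J" by (intro ideal_add J)
    then show ?case by simp
  qed
  have gens: "I = ?J"
  proof
    show "?J \<subseteq> I"
      using gs(1) hs by (intro regular_module.span_minimal I) (auto simp: S_def)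
    show "I \<subseteq> ?J"
    proof
      fix p assume p: "p \<in> I"
      obtain N where N: "\<forall>\<mu>\<in>keys p. total_degree \<mu> < N" using ex_degree_bound by blast
      have "hcomp e p \<in> ?J" for e using part_sub[of "hcomp e p" e] homog[OF p] by simp
      then have "(\<Sum>e<N. hcomp e p) \<in> ?J" by (intro ideal_sum J)
      then show "p \<in> ?J" using sum_hcomp[of p N] N by simp
    qed
  qed
  have indep: "a v = 0" if zero: "(\<Sum>v\<in>S. pm_scale (a v) (?g v)) \<in> M" and v: "v \<in> S" for a v
  proof -
    have S: "finite S" by (simp add: S_def)
    define D where "D = case_sum (\<lambda>_ :: 'n. d) c"
    have g_part: "?g v \<in> part (D v)" if "v \<in> S" for v using that gs(1) hs by (auto simp: S_def D_def)
    let ?t = "\<lambda>e v. if D v = e then pm_scale (a v) (?g v) else 0"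
    have t_part: "?t e v \<in> part e" if "v \<in> S" for e v
      using g_part[OF that] pm.subspace_scale[OF part_subspace] pm.subspace_0[OF part_subspace] by auto
    have "hcomp e (\<Sum>v\<in>S. pm_scale (a v) (?g v)) = (\<Sum>v\<in>S. ?t e v)" for e
      unfolding hcomp_sum
    proof (rule sum.cong[OF refl])
      fix v assume "v \<in> S"
      then have "pm_scale (a v) (?g v) \<in> forms UNIV (D v)"
        using g_part unfolding pm_scale_const by (intro forms_const_mult) auto
      from hcomp_form[OF this, of e] show "hcomp e (pm_scale (a v) (?g v)) = ?t e v" by simp
    qed
    with max_prod_homog[OF I homog zero] have "(\<Sum>v\<in>S. ?t e v) \<in> M" for e by simp
    moreover have "(\<Sum>v\<in>S. ?t e v) \<in> part e" for e by (intro pm.subspace_sum[OF part_subspace] t_part)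
    ultimately have ker: "\<psi> e (\<Sum>v\<in>S. ?t e v) = 0" "j \<in> {1..m} \<Longrightarrow> \<omega> e (\<Sum>v\<in>S. ?t e v) j = 0" for e j
      using kernel by blast+
    have sum_S: "(\<Sum>v\<in>S. f v) = (\<Sum>i\<in>- {i0}. f (Inl i)) + (\<Sum>j\<in>{1..m}. f (Inr j))" for f :: "_ \<Rightarrow> 'z::comm_monoid_add"
      unfolding S_def by (subst sum.union_disjoint) (auto simp: sum.reindex)
    show ?thesis
    proof (cases v)
      case (Inl i)
      with v have i: "i \<noteq> i0" by (auto simp: S_def)
      have "0 = (\<Sum>v\<in>S. \<psi> d (?t d v))" using ker(1)[of d] \<psi>_sum[OF t_part, of S "\<lambda>v. v" d] by simp
      also have "\<dots> = (\<Sum>v\<in>S. case v of Inl i \<Rightarrow> pm_scale (a v) (zvec i) | Inr j \<Rightarrow> 0)"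
      proof (rule sum.cong[OF refl])
        fix v assume v: "v \<in> S"
        show "\<psi> d (?t d v) = (case v of Inl i \<Rightarrow> pm_scale (a v) (zvec i) | Inr j \<Rightarrow> 0)"
        proof (cases v)
          case (Inl i)
          then show ?thesis by (simp add: D_def \<psi>_scale[OF gs(1)] gs(2))
        next
          case (Inr j)
          with v hs have "hs j \<in> part (c j)" "\<psi> (c j) (hs j) = 0" by (auto simp: S_def)
          with \<psi>_scale[of "hs j" "c j" "a v"] show ?thesis by (auto simp: Inr D_def \<psi>_0)
        qed
      qed
      also have "\<dots> = (\<Sum>i\<in>- {i0}. pm_scale (a (Inl i)) (zvec i))" by (simp add: sum_S)
      finally show ?thesis using zvec_independent[of "\<lambda>i. a (Inl i)" i0 i] i Inl by simp
    next
      case (Inr j)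
      with v have j: "j \<in> {1..m}" by (auto simp: S_def)
      have "0 = (\<Sum>v\<in>S. \<omega> (c j) (?t (c j) v) j)" using ker(2)[OF j, of "c j"] \<omega>_sum[OF t_part j, of S "\<lambda>v. v" "c j"] by simp
      also have "\<dots> = (\<Sum>v\<in>S. if v = Inr j then a v else 0)"
      proof (rule sum.cong[OF refl])
        fix v assume v: "v \<in> S"
        show "\<omega> (c j) (?t (c j) v) j = (if v = Inr j then a v else 0)"
        proof (cases v)
          case (Inl i)
          then show ?thesis using \<omega>_scale[OF gs(1) j, of "a v" i] gs(3)[OF j, of i] by (auto simp: D_def \<omega>_0[OF j])
        next
          case (Inr l)
          with v hs have "hs l \<in> part (c l)" "\<omega> (c l) (hs l) j = (if j = l then 1 else 0)" using j by (auto simp: S_def)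
          with \<omega>_scale[of "hs l" "c l" j "a v"] j show ?thesis by (auto simp: Inr D_def \<omega>_0[OF j])
        qed
      qed
      also have "\<dots> = a (Inr j)" using S v Inr by simp
      finally show ?thesis using Inr by simp
    qed
  qed
  show ?thesis
  proof (intro exI conjI)
    show "I = ?J" by (rule gens)
    show "\<forall>a. (\<Sum>v\<in>S. pm_scale (a v) (?g v)) \<in> M \<longrightarrow> (\<forall>v\<in>S. a v = 0)" using indep by blast
  qed (use gs hs in auto)
qed

end

text \<open>Unfolds the isomorphism of the hypothesis in each degree.\<close>

lemma ex_minimal_generators_iso:
  fixes I :: "('n::finite, 'k::field_char_0) mpoly set"
  assumes n: "CARD('n) \<ge> 2" and I: "is_ideal I" and stable: "perm_stable I"
    and homog: "\<And>p e. p \<in> I \<Longrightarrow> hcomp e p \<in> I"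
    and iso: "graded_iso (quotient_rep I (ideal_prod max_ideal I))
           (graded_sum (in_degree d (specht [CARD('n) - 1, 1]))
              (graded_Sum {1..m} (\<lambda>i. in_degree (c i) trivial_rep)))"
  shows "\<exists>\<psi> \<omega>. minimal_generators_iso I d m c \<psi> \<omega>"
proof -
  let ?M = "ideal_prod max_ideal I" and ?Q = "quotient_rep I (ideal_prod max_ideal I)"
  define W :: "('k, 'n perm, (('n \<Rightarrow> nat) \<Rightarrow>\<^sub>0 'k) \<times> (nat \<Rightarrow> 'k)) graded_rep" where
    "W = graded_sum (in_degree d (specht [CARD('n) - 1, 1]))
      (graded_Sum {1..m} (\<lambda>i. in_degree (c i) trivial_rep))"
  have hook: "[CARD('n) - 1, 1] = hook CARD('n) 1" by (simp add: hook_def)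
  have specht: "rspace (specht [CARD('n) - 1, 1] :: ('k, 'n perm, _) rep) = hook_space 1"
    unfolding hook by (rule specht_hook_space) (use n in simp)
  have W_space: "rspace (W e) = (if e = d then hook_space 1 else {0}) \<times> (\<Pi>\<^sub>E i\<in>{1..m}. if e = c i then UNIV else {0})" for e
  proof -
    have "rspace (in_degree d (specht [CARD('n) - 1, 1] :: ('k, 'n perm, _) rep) e) = (if e = d then hook_space 1 else {0})"
      unfolding in_degree_def using specht by (simp add: specht_def)
    moreover have "rspace (in_degree (c i) (trivial_rep :: ('k, 'n perm, 'k) rep) e) = (if e = c i then UNIV else {0})" for i
      by (simp add: in_degree_def trivial_rep_def)
    ultimately show ?thesis
      by (simp add: W_def graded_sum_def rep_sum_def graded_Sum_def rep_Sum_def)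
  qed
  have W_ops: "radd (W e) = (\<lambda>x y. (fst x + fst y, \<lambda>i\<in>{1..m}. snd x i + snd y i))"
    "rscale (W e) = (\<lambda>a x. (pm_scale a (fst x), \<lambda>i\<in>{1..m}. a * snd x i))"
    "ract (W e) = (\<lambda>\<sigma> x. (perm_module \<sigma> (fst x), \<lambda>i\<in>{1..m}. snd x i))" for e
    by (simp_all add: W_def graded_sum_def rep_sum_def graded_Sum_def rep_Sum_def in_degree_def specht_def trivial_rep_def
        if_distrib[of radd] if_distrib[of rscale] if_distrib[of ract] fun_eq_iff)
  have "\<forall>e. \<exists>\<phi>. bij_betw \<phi> (rspace (?Q e)) (rspace (W e)) \<and>
     (\<forall>x\<in>rspace (?Q e). \<forall>y\<in>rspace (?Q e). \<phi> (radd (?Q e) x y) = radd (W e) (\<phi> x) (\<phi> y)) \<and>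
     (\<forall>a. \<forall>x\<in>rspace (?Q e). \<phi> (rscale (?Q e) a x) = rscale (W e) a (\<phi> x)) \<and>
     (\<forall>g. \<forall>x\<in>rspace (?Q e). \<phi> (ract (?Q e) g x) = ract (W e) g (\<phi> x))"
    using iso unfolding W_def graded_iso_def rep_iso_def .
  from choice[OF this] obtain \<phi> where \<phi>: "\<And>e. bij_betw (\<phi> e) (rspace (?Q e)) (rspace (W e))"
     "\<And>e x y. x \<in> rspace (?Q e) \<Longrightarrow> y \<in> rspace (?Q e) \<Longrightarrow> \<phi> e (radd (?Q e) x y) = radd (W e) (\<phi> e x) (\<phi> e y)"
     "\<And>e a x. x \<in> rspace (?Q e) \<Longrightarrow> \<phi> e (rscale (?Q e) a x) = rscale (W e) a (\<phi> e x)"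
     "\<And>e g x. x \<in> rspace (?Q e) \<Longrightarrow> \<phi> e (ract (?Q e) g x) = ract (W e) g (\<phi> e x)"
    by blast
  define f where "f e p = \<phi> e (p +o ?M)" for e p
  note pres = presents_quotient[OF I stable ideal_ideal_prod perm_stable_max_prod[OF stable]]
  have Q: "p +o ?M \<in> rspace (?Q e)" if "p \<in> I \<inter> forms UNIV e" for p e
    using pres[of e 1] that by (auto simp: presents_def)
  have f_add: "f e (p + q) = radd (W e) (f e p) (f e q)" if "p \<in> I \<inter> forms UNIV e" "q \<in> I \<inter> forms UNIV e" for e p q
  proof -
    have "(p + q) +o ?M = radd (?Q e) (p +o ?M) (q +o ?M)" using pres[of e 1] that unfolding presents_def by blast
    then show ?thesis using \<phi>(2)[OF Q[OF that(1)] Q[OF that(2)]] by (simp add: f_def)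
  qed
  have f_scale: "f e (pm_scale a p) = rscale (W e) a (f e p)" if "p \<in> I \<inter> forms UNIV e" for e a p
  proof -
    have "pm_scale a p +o ?M = rscale (?Q e) a (p +o ?M)" using pres[of e 1] that unfolding presents_def by blast
    then show ?thesis using \<phi>(3)[OF Q[OF that]] by (simp add: f_def)
  qed
  have f_perm: "f e (perm_poly \<sigma> p) = ract (W e) \<sigma> (f e p)" if "p \<in> I \<inter> forms UNIV e" for e \<sigma> p
  proof -
    have "perm_poly \<sigma> p +o ?M = ract (?Q e) \<sigma> (p +o ?M)" using pres[of e \<sigma>] that unfolding presents_def by blast
    then show ?thesis using \<phi>(4)[OF Q[OF that]] by (simp add: f_def)
  qed
  have f_range: "f e p \<in> rspace (W e)" if "p \<in> I \<inter> forms UNIV e" for e p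
    using bij_betwE[OF \<phi>(1)] Q[OF that] by (simp add: f_def)
  have zero: "(0 :: ('n, 'k) mpoly) \<in> I \<inter> forms UNIV e" for e using ideal_0[OF I] by simp
  have f_0: "f e 0 = (0, \<lambda>i\<in>{1..m}. 0)" for e
    using f_scale[OF zero, of e 0] by (simp add: W_ops)
  have f_kernel: "p \<in> ?M \<longleftrightarrow> f e p = (0, \<lambda>i\<in>{1..m}. 0)" if p: "p \<in> I \<inter> forms UNIV e" for e p
  proof -
    have "p \<in> ?M \<longleftrightarrow> p +o ?M = 0 +o ?M" using coset_eq_iff[OF ideal_ideal_prod, of p max_ideal I 0] by simp
    also have "\<dots> \<longleftrightarrow> f e p = f e 0"
      unfolding f_def using inj_on_eq_iff[OF bij_betw_imp_inj_on[OF \<phi>(1)] Q[OF p] Q[OF zero]] by simp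
    finally show ?thesis by (simp add: f_0)
  qed
  have "minimal_generators_iso I d m c (\<lambda>e p. fst (f e p)) (\<lambda>e p. snd (f e p))"
  proof
    show "p \<in> ?M \<longleftrightarrow> fst (f e p) = 0 \<and> (\<forall>j\<in>{1..m}. snd (f e p) j = 0)" if p: "p \<in> I \<inter> forms UNIV e" for e p
    proof -
      have "snd (f e p) = (\<lambda>i\<in>{1..m}. 0) \<longleftrightarrow> (\<forall>j\<in>{1..m}. snd (f e p) j = 0)"
      proof
        assume "\<forall>j\<in>{1..m}. snd (f e p) j = 0"
        then show "snd (f e p) = (\<lambda>i\<in>{1..m}. 0)"
          using f_range[OF p] by (intro PiE_ext[where k = "{1..m}"]) (auto simp: W_space)
      qed simp
      then show ?thesis using f_kernel[OF p] by (simp add: prod_eq_iff)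
    qed
    show "\<exists>p\<in>I \<inter> forms UNIV e. fst (f e p) = z \<and> (\<forall>j\<in>{1..m}. snd (f e p) j = w j)"
      if "z \<in> (if e = d then hook_space 1 else {0})" "\<forall>j\<in>{1..m}. e \<noteq> c j \<longrightarrow> w j = 0" for e z w
    proof -
      have "(z, restrict w {1..m}) \<in> rspace (W e)" using that by (auto simp: W_space)
      then have "(z, restrict w {1..m}) \<in> \<phi> e ` rspace (?Q e)" using bij_betw_imp_surj_on[OF \<phi>(1)] by simp
      moreover have "rspace (?Q e) = (\<lambda>p. p +o ?M) ` (I \<inter> forms UNIV e)" using pres[of e 1] by (simp add: presents_def)
      ultimately obtain p where p: "p \<in> I \<inter> forms UNIV e" "f e p = (z, restrict w {1..m})" by (auto simp: f_def)
      then show ?thesis by (intro bexI[of _ p]) auto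
    qed
    show "fst (f e p) \<in> (if e = d then hook_space 1 else {0})" if "p \<in> I \<inter> forms UNIV e" for e p
      using f_range[OF that] by (auto simp: W_space)
    show "snd (f e p) j = 0" if "p \<in> I \<inter> forms UNIV e" "j \<in> {1..m}" "e \<noteq> c j" for e p j
      using f_range[OF that(1)] that(2,3) by (auto simp: W_space dest!: PiE_mem[of _ _ _ j])
  qed (use I stable homog in \<open>simp_all add: f_add f_scale f_perm W_ops\<close>)
  then show ?thesis by blast
qed

section \<open>Exponents in two families of indeterminates\<close>

definition left_part :: "('a + 'b \<Rightarrow>\<^sub>0 nat) \<Rightarrow> 'a \<Rightarrow>\<^sub>0 nat" where
  "left_part = Poly_Mapping.map_key Inl"

definition right_part :: "('a + 'b \<Rightarrow>\<^sub>0 nat) \<Rightarrow> 'b \<Rightarrow>\<^sub>0 nat" where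
  "right_part = Poly_Mapping.map_key Inr"

definition join_parts :: "('a \<Rightarrow>\<^sub>0 nat) \<Rightarrow> ('b \<Rightarrow>\<^sub>0 nat) \<Rightarrow> 'a + 'b \<Rightarrow>\<^sub>0 nat" where
  "join_parts \<beta> \<delta> = Abs_poly_mapping (case_sum (lookup \<beta>) (lookup \<delta>))"

lemma lookup_parts [simp]:
  "lookup (left_part \<alpha>) i = lookup \<alpha> (Inl i)" "lookup (right_part \<alpha>) j = lookup \<alpha> (Inr j)"
  by (simp_all add: left_part_def right_part_def map_key.rep_eq)

lemma lookup_join_parts [simp]: "lookup (join_parts \<beta> \<delta>) = case_sum (lookup \<beta>) (lookup \<delta>)"
proof -
  have "{x. case_sum (lookup \<beta>) (lookup \<delta>) x \<noteq> 0} \<subseteq> Inl ` keys \<beta> \<union> Inr ` keys \<delta>"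
  proof
    fix x assume "x \<in> {x. case_sum (lookup \<beta>) (lookup \<delta>) x \<noteq> 0}"
    then show "x \<in> Inl ` keys \<beta> \<union> Inr ` keys \<delta>" by (cases x) (simp_all add: in_keys_iff)
  qed
  then have "finite {x. case_sum (lookup \<beta>) (lookup \<delta>) x \<noteq> 0}" by (rule finite_subset) simp
  then show ?thesis by (simp add: join_parts_def)
qed

lemma join_parts_inverse [simp]: "join_parts (left_part \<alpha>) (right_part \<alpha>) = \<alpha>"
  by (rule poly_mapping_eqI) (simp split: sum.split)

lemma parts_join [simp]: "left_part (join_parts \<beta> \<delta>) = \<beta>" "right_part (join_parts \<beta> \<delta>) = \<delta>"
  by (rule poly_mapping_eqI, simp)+

lemma keys_parts: "keys \<alpha> = Inl ` keys (left_part \<alpha>) \<union> Inr ` keys (right_part \<alpha>)"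
proof (rule set_eqI)
  fix x show "x \<in> keys \<alpha> \<longleftrightarrow> x \<in> Inl ` keys (left_part \<alpha>) \<union> Inr ` keys (right_part \<alpha>)"
    by (cases x) (auto simp: in_keys_iff)
qed

lemma sum_keys_parts:
  "(\<Sum>x\<in>keys \<alpha>. f x) = (\<Sum>i\<in>keys (left_part \<alpha>). f (Inl i)) + (\<Sum>j\<in>keys (right_part \<alpha>). f (Inr j))"
  for f :: "_ \<Rightarrow> 'z::comm_monoid_add"
  unfolding keys_parts[of \<alpha>] by (subst sum.union_disjoint) (auto simp: sum.reindex)

lemma prod_keys_parts:
  "(\<Prod>x\<in>keys \<alpha>. f x) = (\<Prod>i\<in>keys (left_part \<alpha>). f (Inl i)) * (\<Prod>j\<in>keys (right_part \<alpha>). f (Inr j))"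
  for f :: "_ \<Rightarrow> 'z::comm_monoid_mult"
  unfolding keys_parts[of \<alpha>] by (subst prod.union_disjoint) (auto simp: prod.reindex)

lemma monomial_at_parts:
  "monomial_at (case_sum x y) \<alpha> = monomial_at x (left_part \<alpha>) * monomial_at y (right_part \<alpha>)"
  by (simp add: monomial_at_def prod_keys_parts)

lemma total_degree_parts: "total_degree \<alpha> = total_degree (left_part \<alpha>) + total_degree (right_part \<alpha>)"
  by (simp add: total_degree_def sum_keys_parts)

definition trivial_exponents :: "nat \<Rightarrow> (nat \<Rightarrow> nat) \<Rightarrow> nat \<Rightarrow> (nat \<Rightarrow>\<^sub>0 nat) set" where
  "trivial_exponents m c l = {\<delta>. keys \<delta> \<subseteq> {1..m} \<and> (\<Sum>j\<in>keys \<delta>. c j * lookup \<delta> j) = l}"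

text \<open>
  The Hilbert series of the polynomial ring with one generator in each of the degrees \<open>c 1, \<dots>, c m\<close>.
\<close>

definition trivial_series :: "nat \<Rightarrow> (nat \<Rightarrow> nat) \<Rightarrow> 'k::field fps" where
  "trivial_series m c = Abs_fps (\<lambda>l. of_nat (card (trivial_exponents m c l)))"

lemma weighted_sum_superset:
  "finite A \<Longrightarrow> keys \<delta> \<subseteq> A \<Longrightarrow> (\<Sum>j\<in>keys \<delta>. c j * lookup \<delta> j) = (\<Sum>j\<in>A. c j * lookup \<delta> j)"
  for c :: "'b \<Rightarrow> nat"
  by (rule sum.mono_neutral_left) (auto simp: in_keys_iff)

text \<open>Either the last indeterminate does not occur, or it can be removed once.\<close>

lemma trivial_exponents_Suc:
  fixes c :: "nat \<Rightarrow> nat"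
  shows "trivial_exponents (Suc m) c l = trivial_exponents m c l \<union>
    (if c (Suc m) \<le> l then (\<lambda>\<delta>. \<delta> + single (Suc m) 1) ` trivial_exponents (Suc m) c (l - c (Suc m)) else {})"
    (is "_ = _ \<union> ?B")
proof -
  have weight: "(\<Sum>j\<in>keys (\<delta> + single (Suc m) 1). c j * lookup (\<delta> + single (Suc m) 1) j) =
      (\<Sum>j\<in>keys \<delta>. c j * lookup \<delta> j) + c (Suc m)" for \<delta>
  proof -
    let ?A = "keys \<delta> \<union> {Suc m}"
    have "(\<Sum>j\<in>keys (\<delta> + single (Suc m) 1). c j * lookup (\<delta> + single (Suc m) 1) j) =
        (\<Sum>j\<in>?A. c j * lookup (\<delta> + single (Suc m) 1) j)"
      by (rule weighted_sum_superset) (auto simp: keys_add_nat)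
    also have "\<dots> = (\<Sum>j\<in>?A. c j * lookup \<delta> j) + (\<Sum>j\<in>?A. if j = Suc m then c j else 0)"
      by (subst sum.distrib[symmetric], rule sum.cong) (auto simp: lookup_add lookup_single when_def distrib_left)
    also have "(\<Sum>j\<in>?A. c j * lookup \<delta> j) = (\<Sum>j\<in>keys \<delta>. c j * lookup \<delta> j)"
      by (rule weighted_sum_superset[symmetric]) auto
    finally show ?thesis by simp
  qed
  show ?thesis
  proof (intro equalityI subsetI)
    fix \<delta> assume \<delta>: "\<delta> \<in> trivial_exponents (Suc m) c l"
    show "\<delta> \<in> trivial_exponents m c l \<union> ?B"
    proof (cases "Suc m \<in> keys \<delta>")
      case True
      then obtain \<nu> where \<nu>: "\<delta> = \<nu> + single (Suc m) 1" by (rule remove_indeterminate)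
      then have "keys \<nu> \<subseteq> {1..Suc m}" "(\<Sum>j\<in>keys \<nu>. c j * lookup \<nu> j) + c (Suc m) = l"
        using \<delta> weight[of \<nu>] unfolding trivial_exponents_def by (auto simp: keys_add_nat)
      then have "c (Suc m) \<le> l" "\<nu> \<in> trivial_exponents (Suc m) c (l - c (Suc m))"
        by (auto simp: trivial_exponents_def)
      then show ?thesis using \<nu> by simp
    next
      case False
      then have "keys \<delta> \<subseteq> {1..m}" using \<delta> by (force simp: trivial_exponents_def le_Suc_eq)
      then show ?thesis using \<delta> by (simp add: trivial_exponents_def)
    qed
  next
    fix \<delta> assume "\<delta> \<in> trivial_exponents m c l \<union> ?B"
    then consider "\<delta> \<in> trivial_exponents m c l"
      | \<nu> where "c (Suc m) \<le> l" "\<nu> \<in> trivial_exponents (Suc m) c (l - c (Suc m))" "\<delta> = \<nu> + single (Suc m) 1"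
      by (cases "c (Suc m) \<le> l") (simp_all only: if_True if_False Un_iff image_iff empty_iff, blast+)
    then show "\<delta> \<in> trivial_exponents (Suc m) c l"
    proof cases
      case 1
      then show ?thesis by (auto simp: trivial_exponents_def)
    next
      case 2
      then have "keys \<delta> \<subseteq> {1..Suc m}" by (auto simp: trivial_exponents_def keys_add_nat)
      moreover have "(\<Sum>j\<in>keys \<delta>. c j * lookup \<delta> j) = l"
        using 2 weight[of \<nu>] by (simp add: trivial_exponents_def)
      ultimately show ?thesis by (simp add: trivial_exponents_def)
    qed
  qed
qed

lemma trivial_exponents_0: "trivial_exponents 0 c l = (if l = 0 then {0} else {})"
  by (auto simp: trivial_exponents_def)

lemma finite_trivial_exponents:
  assumes "\<And>j. j \<in> {1..m} \<Longrightarrow> 0 < c j"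
  shows "finite (trivial_exponents m c l)"
  using assms
proof (induction m arbitrary: l)
  case 0
  then show ?case by (simp add: trivial_exponents_0)
next
  case (Suc m)
  have fin: "finite (trivial_exponents m c l)" for l using Suc by simp
  show ?case
  proof (induction l rule: less_induct)
    case (less l)
    have "0 < c (Suc m)" using Suc.prems[of "Suc m"] by simp
    then show ?case
      unfolding trivial_exponents_Suc[of m c l] using fin less.IH[of "l - c (Suc m)"] by auto
  qed
qed

lemma trivial_series_inverse:
  assumes "\<And>j. j \<in> {1..m} \<Longrightarrow> 0 < c j"
  shows "trivial_series m c * (\<Prod>j = 1..m. 1 - fps_X ^ c j) = (1 :: 'k::field fps)"
  using assms
proof (induction m)
  case 0
  show ?case
    by (rule fps_ext) (simp add: trivial_series_def trivial_exponents_0)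
next
  case (Suc m)
  have step: "(1 - fps_X ^ c (Suc m)) * trivial_series (Suc m) c = (trivial_series m c :: 'k fps)"
  proof (rule fps_ext)
    fix l
    let ?E = "trivial_exponents (Suc m) c"
    let ?B = "if c (Suc m) \<le> l then (\<lambda>\<delta>. \<delta> + single (Suc m) 1) ` ?E (l - c (Suc m)) else {}"
    have fin: "finite (trivial_exponents m c l)" "finite ?B"
      using Suc.prems finite_trivial_exponents[of "Suc m" c] finite_trivial_exponents[of m c] by auto
    have "\<delta> \<notin> ?B" if "\<delta> \<in> trivial_exponents m c l" for \<delta>
    proof
      assume "\<delta> \<in> ?B"
      then have "Suc m \<in> keys \<delta>" by (auto simp: keys_add_nat split: if_splits)
      with that show False by (auto simp: trivial_exponents_def)
    qed
    then have "trivial_exponents m c l \<inter> ?B = {}" by blast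
    with fin have "card (?E l) = card (trivial_exponents m c l) + card ?B"
      unfolding trivial_exponents_Suc[of m c l] by (rule card_Un_disjoint)
    also have "card ?B = (if c (Suc m) \<le> l then card (?E (l - c (Suc m))) else 0)"
      by (auto intro!: card_image inj_onI)
    finally show "fps_nth ((1 - fps_X ^ c (Suc m)) * trivial_series (Suc m) c) l = fps_nth (trivial_series m c :: 'k fps) l"
      by (simp add: trivial_series_def left_diff_distrib fps_X_power_mult_nth)
  qed
  have "trivial_series (Suc m) c * (\<Prod>j = 1..Suc m. 1 - fps_X ^ c j) =
      ((1 - fps_X ^ c (Suc m)) * trivial_series (Suc m) c) * (\<Prod>j = 1..m. 1 - fps_X ^ c j :: 'k fps)"
    by (simp add: prod.nat_ivl_Suc' mult_ac)
  also have "\<dots> = 1" unfolding step using Suc by simp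
  finally show ?case .
qed

section \<open>Monomials in the standard generators\<close>

text \<open>Elements with sum zero factor through the quotient by the sum of the variables.\<close>

lemma subst_kill_sum:
  fixes gs :: "'n::finite \<Rightarrow> ('n, 'k::field) mpoly"
  assumes "(\<Sum>i\<in>UNIV. gs i) = 0"
  shows "subst const gs (kill_sum i0 q) = subst const gs q"
proof -
  have "subst const gs (if i = i0 then - (\<Sum>l\<in>- {i0}. indet l) else indet i) = gs i" for i
    using assms
    by (auto simp: sum_split[of _ i0] ring_homD(5,8)[OF ring_hom_subst[OF ring_hom_const]] add_eq_0_iff2)
  then show ?thesis
    unfolding kill_sum_def by (subst ring_hom_subst_commute) simp_all
qed

text \<open>
  The action on products of the \<open>gs i\<close> has the matrix of the symmetric algebra of the standard
  representation.
\<close>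

lemma std_action:
  fixes gs :: "'n::finite \<Rightarrow> ('n, 'k::field_char_0) mpoly"
  assumes perm: "\<And>i. perm_poly \<sigma> (gs i) = gs (\<sigma> \<langle>$\<rangle> i)" and sum: "(\<Sum>i\<in>UNIV. gs i) = 0"
  shows "perm_poly \<sigma> (monomial_at gs \<beta>) =
    (\<Sum>\<gamma>\<in>std_exponents i0 (total_degree \<beta>). pm_scale (std_coeff i0 \<sigma> \<gamma> \<beta>) (monomial_at gs \<gamma>))"
proof -
  let ?q = "perm_poly \<sigma> (single \<beta> 1) :: ('n, 'k) mpoly"
  have "?q \<in> forms UNIV (total_degree \<beta>)" by (intro perm_poly_forms forms_single) auto
  then have "kill_sum i0 ?q \<in> forms (- {i0}) (total_degree \<beta>)"
    unfolding kill_sum_def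
    by (rule forms_subst_linear)
      (auto simp del: One_nat_def intro!: forms_uminus forms_sum forms_indet)
  then have keys: "keys (kill_sum i0 ?q) \<subseteq> std_exponents i0 (total_degree \<beta>)"
    by (auto simp: forms_def std_exponents_def in_keys_iff)
  have fin: "finite (std_exponents i0 (total_degree \<beta>))"
    by (rule finite_subset[OF _ finite_exponents[of "total_degree \<beta>"]]) (auto simp: std_exponents_def)
  have "perm_poly \<sigma> (monomial_at gs \<beta>) = monomial_at (\<lambda>i. gs (\<sigma> \<langle>$\<rangle> i)) \<beta>"
    by (simp add: ring_hom_monomial_at[OF ring_hom_perm_poly] perm)
  also have "\<dots> = subst const gs ?q"
    by (simp add: perm_poly_monomial subst_single monomial_at_perm)
  also have "\<dots> = subst const gs (kill_sum i0 ?q)" by (simp only: subst_kill_sum[OF sum])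
  also have "\<dots> = (\<Sum>\<gamma>\<in>std_exponents i0 (total_degree \<beta>).
      const (lookup (kill_sum i0 ?q) \<gamma>) * monomial_at gs \<gamma>)"
    by (rule subst_superset[OF ring_hom_const fin keys])
  finally show ?thesis by (simp only: pm_scale_const std_coeff_def)
qed

section \<open>The series of the standard representation\<close>

lemma fps_compose_power_nth:
  fixes a :: "'k::field fps"
  assumes "0 < d"
  shows "fps_nth (a oo fps_X ^ d) n = (if d dvd n then fps_nth a (n div d) else 0)"
proof -
  have "fps_nth (a oo fps_X ^ d) n = (\<Sum>i = 0..n. if n = d * i then fps_nth a i else 0)"
    by (simp add: fps_compose_nth flip: power_mult) (rule sum.cong, auto)
  also have "\<dots> = (if d dvd n then fps_nth a (n div d) else 0)"
  proof (cases "d dvd n")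
    case True
    then obtain k where k: "n = d * k" by auto
    have "(\<Sum>i = 0..n. if n = d * i then fps_nth a i else 0) = (\<Sum>i = 0..n. if i = k then fps_nth a i else 0)"
      using assms by (intro sum.cong) (auto simp: k)
    also have "\<dots> = fps_nth a k" using assms by (simp add: k)
    finally show ?thesis using True assms by (simp add: k)
  qed (auto intro!: sum.neutral)
  finally show ?thesis .
qed

lemma fps_compose_power_mult_nth:
  fixes a b :: "'k::field fps"
  assumes d: "0 < d"
  shows "fps_nth ((a oo fps_X ^ d) * b) w = (\<Sum>k | d * k \<le> w. fps_nth a k * fps_nth b (w - d * k))"
proof -
  have "fps_nth ((a oo fps_X ^ d) * b) w =
      (\<Sum>i = 0..w. if d dvd i then fps_nth a (i div d) * fps_nth b (w - i) else 0)"
    unfolding fps_mult_nth fps_compose_power_nth[OF d] by (rule sum.cong) auto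
  also have "\<dots> = (\<Sum>i | i \<le> w \<and> d dvd i. fps_nth a (i div d) * fps_nth b (w - i))"
    by (rule sum.mono_neutral_cong_right) auto
  also have "\<dots> = (\<Sum>k | d * k \<le> w. fps_nth a k * fps_nth b (w - d * k))"
    by (rule sum.reindex_bij_witness[of _ "\<lambda>k. d * k" "\<lambda>i. i div d"]) (use d in auto)
  finally show ?thesis .
qed

lemma character_symmetric_series:
  "Abs_fps (\<lambda>e. character (poly_ring_rep e :: ('k::field, 'n::finite perm, ('n, 'k) mpoly) rep) \<sigma>) =
    symmetric_series UNIV ((\<langle>$\<rangle>) (inverse \<sigma>))"
proof (rule fps_ext)
  fix e
  have "bij_betw lookup {\<mu> :: 'n \<Rightarrow>\<^sub>0 nat. total_degree \<mu> = e \<and> perm_exponent \<sigma> \<mu> = \<mu>}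
      (invariant_exponents UNIV ((\<langle>$\<rangle>) (inverse \<sigma>)) e)"
  proof (rule bij_betw_byWitness[where f' = Abs_poly_mapping])
    show "Abs_poly_mapping ` invariant_exponents UNIV ((\<langle>$\<rangle>) (inverse \<sigma>)) e \<subseteq>
        {\<mu> :: 'n \<Rightarrow>\<^sub>0 nat. total_degree \<mu> = e \<and> perm_exponent \<sigma> \<mu> = \<mu>}"
      by (auto simp: invariant_exponents_def total_degree_UNIV intro!: poly_mapping_eqI)
    show "lookup ` {\<mu> :: 'n \<Rightarrow>\<^sub>0 nat. total_degree \<mu> = e \<and> perm_exponent \<sigma> \<mu> = \<mu>} \<subseteq>
        invariant_exponents UNIV ((\<langle>$\<rangle>) (inverse \<sigma>)) e"
      by (auto simp: invariant_exponents_def total_degree_UNIV simp flip: lookup_perm_exponent)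
  qed auto
  from bij_betw_same_card[OF this]
  show "fps_nth (Abs_fps (\<lambda>e. character (poly_ring_rep e :: ('k, 'n perm, ('n, 'k) mpoly) rep) \<sigma>)) e =
      fps_nth (symmetric_series UNIV ((\<langle>$\<rangle>) (inverse \<sigma>))) e"
    by (simp add: character_poly_ring symmetric_series_def)
qed

text \<open>
  Both factors are obtained from the series of the permutation representation: \<open>(1 - t) \<chi>\<close> is the first one,
  and the second one times \<open>1 - t\<close> is the inverse of \<open>\<chi>\<close>.
\<close>

lemma std_hook_series_inverse:
  fixes \<sigma> :: "'n::finite perm"
  shows "std_series i0 \<sigma> * (\<Sum>u<CARD('n). fps_const ((- 1) ^ u * hook_trace i0 \<sigma> u) * fps_X ^ u) =
    (1 :: 'k::field_char_0 fps)" (is "_ * ?H = 1")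
proof -
  define \<chi> where "\<chi> = Abs_fps (\<lambda>e. character (poly_ring_rep e :: ('k, 'n perm, ('n, 'k) mpoly) rep) \<sigma>)"
  have nth: "fps_nth \<chi> e = (\<Sum>k\<le>e. fps_nth (std_series i0 \<sigma>) k)" for e
    unfolding \<chi>_def fps_nth_Abs_fps character_std_series[of e \<sigma> i0]
    by (rule sum.reindex_bij_witness[of _ "\<lambda>k. e - k" "\<lambda>k. e - k"]) auto
  have std: "(1 - fps_X) * \<chi> = std_series i0 \<sigma>"
  proof (rule fps_ext)
    fix e show "fps_nth ((1 - fps_X) * \<chi>) e = fps_nth (std_series i0 \<sigma>) e"
      by (cases e) (simp_all add: left_diff_distrib nth)
  qed
  have p: "(\<langle>$\<rangle>) (inverse \<sigma>) permutes UNIV" by (rule bij_imp_permutes) simp_all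
  have "std_series i0 \<sigma> * ?H = ((1 - fps_X) * ?H) * \<chi>" by (simp add: mult_ac flip: std)
  also have "\<dots> = exterior_series UNIV ((\<langle>$\<rangle>) (inverse \<sigma>)) * symmetric_series UNIV ((\<langle>$\<rangle>) (inverse \<sigma>))"
    by (simp only: hook_series \<chi>_def character_symmetric_series)
  also have "\<dots> = 1" by (rule exterior_symmetric_series[OF p]) simp
  finally show ?thesis .
qed

section \<open>The series of the quotient\<close>

text \<open>
  The generator \<open>gs i0\<close> is left out because it is minus the sum of the others.
\<close>

definition generator_index :: "'n \<Rightarrow> nat \<Rightarrow> ('n + nat) set" where
  "generator_index i0 m = Inl ` (- {i0}) \<union> Inr ` {1..m}"

lemma generator_index_iff [simp]:
  "Inl i \<in> generator_index i0 m \<longleftrightarrow> i \<noteq> i0" "Inr j \<in> generator_index i0 m \<longleftrightarrow> j \<in> {1..m}"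
  by (auto simp: generator_index_def)

lemma finite_generator_index [simp]: "finite (generator_index (i0 :: 'n::finite) m)"
  by (simp add: generator_index_def)

locale equivariant_generators =
  fixes I :: "('n::finite, 'k::field_char_0) mpoly set" and d m :: nat and c :: "nat \<Rightarrow> nat"
    and gs :: "'n \<Rightarrow> ('n, 'k) mpoly" and hs :: "nat \<Rightarrow> ('n, 'k) mpoly" and i0 :: 'n
  assumes I: "is_ideal I" and stable: "perm_stable I"
    and homog: "\<And>p e. p \<in> I \<Longrightarrow> hcomp e p \<in> I"
    and d: "0 < d" and c: "\<And>j. j \<in> {1..m} \<Longrightarrow> 0 < c j"
    and gs: "\<And>i. gs i \<in> forms UNIV d" "\<And>i \<sigma>. perm_poly \<sigma> (gs i) = gs (\<sigma> \<langle>$\<rangle> i)" "(\<Sum>i\<in>UNIV. gs i) = 0"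
    and hs: "\<And>j. j \<in> {1..m} \<Longrightarrow> hs j \<in> forms UNIV (c j)"
      "\<And>j \<sigma>. j \<in> {1..m} \<Longrightarrow> perm_poly \<sigma> (hs j) = hs j"
    and Ig: "I = ideal_gen (case_sum gs hs ` (generator_index i0 m))"
    and qr: "\<And>P j. P \<in> forms (generator_index i0 m) j \<Longrightarrow>
      eval (case_sum gs hs) P = 0 \<Longrightarrow> P \<in> coeffs_in I"
begin

definition quotient_basis :: "nat \<Rightarrow> ('n \<Rightarrow>\<^sub>0 nat) set" where
  "quotient_basis e = (SOME K. K \<subseteq> {\<mu>. total_degree \<mu> = e} \<and> basis_mod I (forms UNIV e) K (\<lambda>\<mu>. single \<mu> 1))"

lemma quotient_basis: "quotient_basis e \<subseteq> {\<mu>. total_degree \<mu> = e} \<and> basis_mod I (forms UNIV e) (quotient_basis e) (\<lambda>\<mu>. single \<mu> 1)"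
  unfolding quotient_basis_def using basis_mod_quotient_monomials[OF I, of e] by (rule someI_ex)

sublocale weighted_generators I "case_sum gs hs" "case_sum (\<lambda>_. d) c" "generator_index i0 m" quotient_basis
proof
  fix v assume "v \<in> generator_index i0 m"
  then show "case_sum gs hs v \<in> forms UNIV (case_sum (\<lambda>_. d) c v)" "0 < case_sum (\<lambda>_. d) c v"
    using gs(1) hs(1) d c by (auto split: sum.split)
qed (use I Ig homog qr quotient_basis in auto)

abbreviation "S \<equiv> generator_index i0 m"

lemma weight_parts:
  "weight \<alpha> = d * total_degree (left_part \<alpha>) + (\<Sum>j\<in>keys (right_part \<alpha>). c j * lookup (right_part \<alpha>) j)"
  by (simp add: weight_def sum_keys_parts total_degree_def sum_distrib_left)

lemma keys_S: "keys \<alpha> \<subseteq> S \<longleftrightarrow> lookup \<alpha> (Inl i0) = 0 \<and> keys (right_part \<alpha>) \<subseteq> {1..m}"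
  proof -
  have "i \<noteq> i0" if "lookup \<alpha> (Inl i0) = 0" "i \<in> keys (left_part \<alpha>)" for i
    using that by (auto simp: in_keys_iff)
  moreover have "lookup \<alpha> (Inl i0) = 0" if "\<forall>i\<in>keys (left_part \<alpha>). i \<noteq> i0"
    using that by (auto simp: in_keys_iff)
  ultimately show ?thesis
    unfolding keys_parts[of \<alpha>] Un_subset_iff image_subset_iff generator_index_iff by blast
qed

text \<open>The invariant generators are carried along unchanged.\<close>

lemma generator_monomials_action:
  assumes "keys \<alpha> \<subseteq> S"
  shows "perm_poly \<sigma> (monomial_at (case_sum gs hs) \<alpha>) =
    (\<Sum>\<gamma> | keys \<gamma> \<subseteq> S \<and> weight \<gamma> = weight \<alpha> \<and> total_degree \<gamma> = total_degree \<alpha>.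
      pm_scale (if right_part \<gamma> = right_part \<alpha> then std_coeff i0 \<sigma> (left_part \<gamma>) (left_part \<alpha>) else 0)
        (monomial_at (case_sum gs hs) \<gamma>))"
proof -
  let ?\<beta> = "left_part \<alpha>" and ?\<delta> = "right_part \<alpha>"
  let ?\<Gamma> = "{\<gamma>. keys \<gamma> \<subseteq> S \<and> weight \<gamma> = weight \<alpha> \<and> total_degree \<gamma> = total_degree \<alpha>}"
  have fin: "finite ?\<Gamma>" by (rule finite_subset[OF _ finite_exps[of "weight \<alpha>"]]) auto
  have hs_fixed: "monomial_at (\<lambda>j. perm_poly \<sigma> (hs j)) ?\<delta> = monomial_at hs ?\<delta>"
    using assms hs(2) unfolding keys_S by (intro monomial_at_cong) auto
  have "perm_poly \<sigma> (monomial_at (case_sum gs hs) \<alpha>) = perm_poly \<sigma> (monomial_at gs ?\<beta>) * monomial_at hs ?\<delta>"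
    by (simp add: monomial_at_parts ring_homD(3)[OF ring_hom_perm_poly]
        ring_hom_monomial_at[OF ring_hom_perm_poly, of _ hs] hs_fixed)
  also have "\<dots> = (\<Sum>\<gamma>\<in>std_exponents i0 (total_degree ?\<beta>).
      pm_scale (std_coeff i0 \<sigma> \<gamma> ?\<beta>) (monomial_at (case_sum gs hs) (join_parts \<gamma> ?\<delta>)))"
    unfolding std_action[OF gs(2,3), of \<sigma> ?\<beta> i0] sum_distrib_right
    by (simp only: monomial_at_parts parts_join pm_scale_const mult.assoc)
  also have "\<dots> = (\<Sum>\<gamma>\<in>{\<gamma>\<in>?\<Gamma>. right_part \<gamma> = ?\<delta>}.
      pm_scale (std_coeff i0 \<sigma> (left_part \<gamma>) ?\<beta>) (monomial_at (case_sum gs hs) \<gamma>))"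
  proof (rule sum.reindex_bij_witness[of _ left_part "\<lambda>\<gamma>. join_parts \<gamma> ?\<delta>"])
    show "join_parts (left_part \<gamma>) ?\<delta> = \<gamma>" if "\<gamma> \<in> {\<gamma>\<in>?\<Gamma>. right_part \<gamma> = ?\<delta>}" for \<gamma>
      using that join_parts_inverse[of \<gamma>] by simp
    show "left_part \<gamma> \<in> std_exponents i0 (total_degree ?\<beta>)" if "\<gamma> \<in> {\<gamma>\<in>?\<Gamma>. right_part \<gamma> = ?\<delta>}" for \<gamma>
      using that unfolding keys_S std_exponents_def
      by (auto simp: total_degree_parts[of \<alpha>] total_degree_parts[of \<gamma>])
    show "join_parts \<gamma> ?\<delta> \<in> {\<gamma>\<in>?\<Gamma>. right_part \<gamma> = ?\<delta>}" if "\<gamma> \<in> std_exponents i0 (total_degree ?\<beta>)" for \<gamma>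
      using that assms unfolding keys_S std_exponents_def
      by (simp add: total_degree_parts[of \<alpha>] total_degree_parts[of "join_parts \<gamma> ?\<delta>"] weight_parts)
  qed simp_all
  also have "\<dots> = (\<Sum>\<gamma>\<in>?\<Gamma>. pm_scale (if right_part \<gamma> = ?\<delta> then std_coeff i0 \<sigma> (left_part \<gamma>) ?\<beta> else 0)
      (monomial_at (case_sum gs hs) \<gamma>))"
    by (rule sum.mono_neutral_cong_left[OF fin]) auto
  finally show ?thesis .
qed

lemma generator_trace_series:
  "(\<Sum>\<alpha>\<in>exps w. std_coeff i0 \<sigma> (left_part \<alpha>) (left_part \<alpha>) :: 'k) =
    fps_nth ((std_series i0 \<sigma> oo fps_X ^ d) * trivial_series m c) w"
proof -
  have "(\<Sum>\<alpha>\<in>exps w. std_coeff i0 \<sigma> (left_part \<alpha>) (left_part \<alpha>)) =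
      (\<Sum>(k, \<beta>, \<delta>)\<in>Sigma {k. d * k \<le> w} (\<lambda>k. std_exponents i0 k \<times> trivial_exponents m c (w - d * k)).
        std_coeff i0 \<sigma> \<beta> \<beta> :: 'k)"
    by (rule sum.reindex_bij_witness[of _ "\<lambda>(k, \<beta>, \<delta>). join_parts \<beta> \<delta>"
          "\<lambda>\<alpha>. (total_degree (left_part \<alpha>), left_part \<alpha>, right_part \<alpha>)"])
      (auto simp: exps_def keys_S weight_parts std_exponents_def trivial_exponents_def)
  also have "\<dots> = (\<Sum>k | d * k \<le> w. \<Sum>(\<beta>, \<delta>)\<in>std_exponents i0 k \<times> trivial_exponents m c (w - d * k).
      std_coeff i0 \<sigma> \<beta> \<beta>)"
  proof (rule sum.Sigma[symmetric])
    show "finite {k. d * k \<le> w}"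
      by (rule finite_subset[of _ "{..w}"]) (use d in \<open>auto intro: order_trans[rotated]\<close>)
    show "\<forall>k\<in>{k. d * k \<le> w}. finite (std_exponents i0 k \<times> trivial_exponents m c (w - d * k))"
      using finite_trivial_exponents[OF c]
      by (auto intro!: finite_cartesian_product finite_subset[OF _ finite_exponents] simp: std_exponents_def)
  qed
  also have "\<dots> = (\<Sum>k | d * k \<le> w. fps_nth (std_series i0 \<sigma>) k * fps_nth (trivial_series m c) (w - d * k))"
    by (simp add: std_series_def trivial_series_def sum_distrib_right mult.commute flip: sum.cartesian_product)
  also have "\<dots> = fps_nth ((std_series i0 \<sigma> oo fps_X ^ d) * trivial_series m c) w"
    by (rule fps_compose_power_mult_nth[OF d, symmetric])
  finally show ?thesis .
qed

text \<open>
  Multiply \<open>\<chi>\<^sub>R = T \<chi>\<^bsub>R/I\<^esub>\<close> by the inverses of the two factors of \<open>T\<close>.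
\<close>

lemma quotient_series:
  "Abs_fps (\<lambda>e. character (quotient_rep UNIV I e) \<sigma>) =
    Abs_fps (\<lambda>e. character (poly_ring_rep e :: ('k, 'n perm, ('n, 'k) mpoly) rep) \<sigma>) *
    (\<Sum>u<CARD('n). fps_const ((- 1) ^ u * hook_trace i0 \<sigma> u) * fps_X ^ (d * u)) *
    (\<Prod>j = 1..m. 1 - fps_X ^ c j)"
  (is "?\<chi>Q = ?\<chi>R * ?H' * ?T'")
proof -
  let ?H = "\<Sum>u<CARD('n). fps_const ((- 1) ^ u * hook_trace i0 \<sigma> u) * fps_X ^ u :: 'k fps"
  let ?std = "std_series i0 \<sigma> :: 'k fps" and ?T = "trivial_series m c :: 'k fps"
  have X0: "fps_nth (fps_X ^ d :: 'k fps) 0 = 0" using d by simp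
  have "?\<chi>R = ((?std oo fps_X ^ d) * ?T) * ?\<chi>Q"
  proof (rule fps_ext)
    fix e
    have "character (poly_ring_rep e :: ('k, 'n perm, ('n, 'k) mpoly) rep) \<sigma> = (\<Sum>w = 0..e. (\<Sum>\<alpha>\<in>exps w.
        if right_part \<alpha> = right_part \<alpha> then std_coeff i0 \<sigma> (left_part \<alpha>) (left_part \<alpha>) else 0) *
        character (quotient_rep UNIV I (e - w)) \<sigma>)"
      by (rule trace_factorization[OF stable generator_monomials_action])
    then show "fps_nth ?\<chi>R e = fps_nth (((?std oo fps_X ^ d) * ?T) * ?\<chi>Q) e"
      by (simp add: generator_trace_series fps_mult_nth[of "(?std oo fps_X ^ d) * ?T"])
  qed
  then have "?\<chi>R * (?H oo fps_X ^ d) * ?T' = ((?std oo fps_X ^ d) * (?H oo fps_X ^ d)) * (?T * ?T') * ?\<chi>Q"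
    by (simp only: mult_ac)
  also have "(?std oo fps_X ^ d) * (?H oo fps_X ^ d) = 1"
    using std_hook_series_inverse[of i0 \<sigma>, where 'k = 'k] by (simp flip: fps_compose_mult_distrib[OF X0])
  also have "?T * ?T' = 1" by (rule trivial_series_inverse[OF c])
  also have "?H oo fps_X ^ d = ?H'"
    by (simp add: fps_compose_sum_distrib fps_compose_mult_distrib[OF X0] power_mult d flip: fps_compose_power[OF X0])
  finally show ?thesis by simp
qed

end

text \<open>
  Minimality has two consequences.  In a relation among the generators the coefficients have no
  constant term, as needed in \<open>generators_quasi_regular\<close>.  And no generator is zero, hence none is a constant, since the
  ideal is proper; so all degrees are positive.
\<close>

lemma ex_equivariant_generators_of_complete_intersection:
  fixes I :: "('n::finite, 'k::field_char_0) mpoly set"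
  assumes n: "CARD('n) \<ge> 2" and I: "is_ideal I" and homogeneous: "homogeneous_ideal I"
    and stable: "perm_stable I" and ci: "complete_intersection I"
    and iso: "graded_iso (quotient_rep I (ideal_prod max_ideal I))
           (graded_sum (in_degree d (specht [CARD('n) - 1, 1]))
              (graded_Sum {1..m} (\<lambda>i. in_degree (c i) trivial_rep)))"
  shows "\<exists>gs hs. equivariant_generators I d m c gs hs i0"
proof -
  note homog = homogeneous_ideal_hcomp[OF homogeneous]
  let ?M = "ideal_prod max_ideal I"
  have M: "is_ideal ?M" by (rule ideal_ideal_prod)
  obtain \<psi> \<omega> where "minimal_generators_iso I d m c \<psi> \<omega>"
    using ex_minimal_generators_iso[OF n I stable homog iso] by blast
  then interpret minimal_generators_iso I d m c \<psi> \<omega> .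
  let ?S = "generator_index i0 m"
  obtain gs hs where gs: "\<And>i. gs i \<in> forms UNIV d" "\<And>i \<sigma>. perm_poly \<sigma> (gs i) = gs (\<sigma> \<langle>$\<rangle> i)" "(\<Sum>i\<in>UNIV. gs i) = 0"
    and hs: "\<And>j. j \<in> {1..m} \<Longrightarrow> hs j \<in> forms UNIV (c j)" "\<And>j \<sigma>. j \<in> {1..m} \<Longrightarrow> perm_poly \<sigma> (hs j) = hs j"
    and Ig: "I = ideal_gen (case_sum gs hs ` ?S)"
    and indep: "\<And>a. (\<Sum>v\<in>?S. pm_scale (a v) (case_sum gs hs v)) \<in> ?M \<Longrightarrow> \<forall>v\<in>?S. a v = 0"
    using ex_equivariant_generators[of i0] unfolding generator_index_def by blast
  let ?g = "case_sum gs hs"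
  have gI: "?g v \<in> I" if "v \<in> ?S" for v unfolding Ig using that by (intro regular_module.span_base imageI)
  obtain fs where fs: "regular_sequence fs" "I = ideal_gen (set fs)"
    using ci by (auto simp: complete_intersection_def)
  have proper: "1 \<notin> I"
  proof
    assume "1 \<in> I"
    then have "p \<in> I" for p using ideal_mult[OF I, of 1 p] by simp
    then show False using fs by (auto simp: regular_sequence_def)
  qed
  have nonzero: "?g v \<noteq> 0" if v: "v \<in> ?S" for v
  proof
    assume "?g v = 0"
    then have "pm_scale (if w = v then 1 else 0) (?g w) = 0" for w by auto
    then have "(\<Sum>w\<in>?S. pm_scale (if w = v then 1 else 0) (?g w)) \<in> ?M"
      using ideal_0[OF M] by (simp only: sum.neutral_const)
    from indep[OF this] v show False by (auto dest: bspec[of _ _ v])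
  qed
  have positive: "0 < e" if v: "v \<in> ?S" "?g v \<in> forms UNIV e" for v e
  proof (rule ccontr)
    assume "\<not> 0 < e"
    then have "?g v = hcomp 0 (?g v)" using hcomp_form[OF v(2), of 0] by simp
    then have eq: "?g v = const (lookup (?g v) 0)" unfolding hcomp_0_const .
    then have a: "lookup (?g v) 0 \<noteq> 0" using nonzero[OF v(1)] by (metis single_zero)
    have "const (1 / lookup (?g v) 0) * ?g v \<in> I" by (rule ideal_mult[OF I gI[OF v(1)]])
    also have "const (1 / lookup (?g v) 0) * ?g v = const (1 / lookup (?g v) 0 * lookup (?g v) 0)"
      by (subst (2) eq) (simp add: mult_single)
    finally show False using proper a by simp
  qed
  have d: "0 < d"
  proof -
    have "(- {i0}) \<noteq> {}"
    proof
      assume "- {i0} = {}"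
      then have "card (UNIV :: 'n set) = card {i0}" by (metis Compl_empty_eq double_complement)
      then show False using n by simp
    qed
    then obtain i where "i \<noteq> i0" by auto
    then show ?thesis using positive[of "Inl i" d] gs(1) by auto
  qed
  have relations: "\<forall>v\<in>?S. hcomp 0 (q v) = 0" if zero: "(\<Sum>v\<in>?S. q v * ?g v) = 0" for q
  proof -
    let ?a = "\<lambda>v. lookup (q v) 0"
    have "(\<Sum>v\<in>?S. (q v - const (?a v)) * ?g v) \<in> ?M"
      by (intro ideal_sum[OF M] ideal_prodI gI) (simp_all add: max_ideal_iff lookup_minus)
    moreover have "(\<Sum>v\<in>?S. (q v - const (?a v)) * ?g v) = - (\<Sum>v\<in>?S. pm_scale (?a v) (?g v))"
      by (simp add: left_diff_distrib sum_subtractf zero[simplified] pm_scale_const)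
    ultimately have "(\<Sum>v\<in>?S. pm_scale (?a v) (?g v)) \<in> ?M" using ideal_uminus[OF M] by simp
    from indep[OF this] show ?thesis by (simp add: hcomp_0_const)
  qed
  have set_fs: "set fs = (\<lambda>i. fs ! i) ` {..<length fs}"
    by (auto simp: set_conv_nth)
  have If: "I = ideal_gen ((\<lambda>i. fs ! i) ` {..<length fs})" using fs(2) set_fs by simp
  have "equivariant_generators I d m c gs hs i0"
  proof
    show "P \<in> coeffs_in I" if "P \<in> forms ?S j" "eval ?g P = 0" for P j
      by (rule generators_quasi_regular[OF regular_sequence_quasi_regular[OF fs(1)] If Ig _ relations homog that]) simp_all
    show "0 < c j" if "j \<in> {1..m}" for j using positive[of "Inr j" "c j"] hs(1) that by auto
  qed (use I stable homog d gs hs Ig in auto)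
  then show ?thesis by blast
qed

section \<open>The graded character\<close>

text \<open>
  Evaluation of all coefficients at a group element is a ring homomorphism; as \<open>\<sigma>\<close> varies, it reduces the identity to
  series over the field.
\<close>

definition evaluate :: "'g \<Rightarrow> ('g \<Rightarrow> 'k::field) fps \<Rightarrow> 'k fps" where
  "evaluate \<sigma> A = Abs_fps (\<lambda>e. fps_nth A e \<sigma>)"

lemma sum_apply: "(sum f A) x = (\<Sum>i\<in>A. f i x)" for f :: "'i \<Rightarrow> 'g \<Rightarrow> 'k::comm_monoid_add"
  by (induction A rule: infinite_finite_induct) auto

lemma evaluate_mult: "evaluate \<sigma> (A * B) = evaluate \<sigma> A * evaluate \<sigma> B"
  by (rule fps_ext) (simp add: evaluate_def fps_mult_nth sum_apply)

lemma evaluate_1: "evaluate \<sigma> 1 = 1"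
  by (rule fps_ext) (simp add: evaluate_def)

lemma evaluate_diff: "evaluate \<sigma> (A - B) = evaluate \<sigma> A - evaluate \<sigma> B"
  by (rule fps_ext) (simp add: evaluate_def)

lemma evaluate_uminus: "evaluate \<sigma> (- A) = - evaluate \<sigma> A"
  by (rule fps_ext) (simp add: evaluate_def)

lemma evaluate_sum: "evaluate \<sigma> (sum f A) = (\<Sum>i\<in>A. evaluate \<sigma> (f i))"
  by (rule fps_ext) (simp add: evaluate_def fps_sum_nth sum_apply)

lemma evaluate_prod: "evaluate \<sigma> (prod f A) = (\<Prod>i\<in>A. evaluate \<sigma> (f i))"
  by (induction A rule: infinite_finite_induct) (simp_all add: evaluate_mult evaluate_1)

lemma evaluate_power: "evaluate \<sigma> (A ^ k) = evaluate \<sigma> A ^ k"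
  by (induction k) (simp_all add: evaluate_mult evaluate_1)

lemma evaluate_X: "evaluate \<sigma> fps_X = fps_X"
  by (rule fps_ext) (simp add: evaluate_def fps_X_def)

lemma evaluate_const: "evaluate \<sigma> (fps_const f) = fps_const (f \<sigma>)"
  by (rule fps_ext) (simp add: evaluate_def fps_const_def)

lemmas evaluate_simps = evaluate_mult evaluate_1 evaluate_diff evaluate_uminus evaluate_sum evaluate_prod evaluate_power evaluate_X evaluate_const

theorem theorem3p6:
  fixes I :: "('n::finite, 'k::field_char_0) mpoly set"
    and d m :: nat and c :: "nat \<Rightarrow> nat"
  assumes "CARD('n) \<ge> 2"
    and "is_ideal I" and "homogeneous_ideal I" and "perm_stable I"
    and "complete_intersection I"
    and "graded_iso (quotient_rep I (ideal_prod max_ideal I))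
           (graded_sum (in_degree d (specht [CARD('n) - 1, 1]))
              (graded_Sum {1..m} (\<lambda>i. in_degree (c i) trivial_rep)))"
  shows "graded_character (quotient_rep UNIV I) =
           graded_character (poly_ring_rep :: ('k, 'n perm, ('n, 'k) mpoly) graded_rep)
           * (\<Sum>u = 0..CARD('n) - 1.
                (-1) ^ u * fps_const (character (specht (hook CARD('n) u))) * fps_X ^ (d * u))
           * (\<Prod>i = 1..m. (1 - fps_X ^ c i))"
    (is "?\<chi>Q = ?\<chi>R * ?H * ?T")
proof -
  fix i0 :: 'n
  obtain gs hs where "equivariant_generators I d m c gs hs i0"
    using ex_equivariant_generators_of_complete_intersection[OF assms] by blast
  then interpret equivariant_generators I d m c gs hs i0 .
  have range: "{0..CARD('n) - 1} = {..<CARD('n)}" using assms(1) by auto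
  have "evaluate \<sigma> ?\<chi>Q = evaluate \<sigma> (?\<chi>R * ?H * ?T)" for \<sigma>
  proof -
    have sign: "(- 1) ^ u * fps_const a = fps_const ((- 1) ^ u * a)" for u and a :: 'k
      by (cases "even u") simp_all
    have "evaluate \<sigma> ?H = (\<Sum>u<CARD('n). fps_const ((- 1) ^ u * hook_trace i0 \<sigma> u) * fps_X ^ (d * u))"
      unfolding range evaluate_simps by (intro sum.cong) (simp_all add: character_specht_hook[of _ \<sigma> i0] sign)
    moreover have "evaluate \<sigma> ?T = (\<Prod>j = 1..m. 1 - fps_X ^ c j)" by (simp only: evaluate_simps)
    moreover have "evaluate \<sigma> ?\<chi>R = Abs_fps (\<lambda>e. character (poly_ring_rep e :: ('k, 'n perm, ('n, 'k) mpoly) rep) \<sigma>)"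
      by (simp add: evaluate_def graded_character_def)
    moreover have "evaluate \<sigma> ?\<chi>Q = Abs_fps (\<lambda>e. character (quotient_rep UNIV I e) \<sigma>)"
      by (simp add: evaluate_def graded_character_def)
    ultimately show ?thesis unfolding evaluate_mult by (simp only: quotient_series)
  qed
  then show ?thesis by (auto simp: evaluate_def fps_eq_iff fun_eq_iff)
qed

end
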